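(* Let $K^{(0)}$ be a stable policy and let $\epsilon>0$. There is a constant $C_1>0$, depending only on $\sigma_{\min}(D_{\widetilde\omega})$, $\sigma_{\min}(S)$, $\|R^{-1}\|_2$, $\|A\|_2$, $\|B\|_2$ and $(1-\gamma)J(K^{(0)})$, such that the following holds if $\gamma\in(0,1)$ is sufficiently close to $1$. Suppose that $$\epsilon_0\le\min\left\{\frac{1}{2\|R^{-1}\|_2},\ \frac{C_1\sqrt{\epsilon}}{\sqrt{\|\Sigma_{K^*,\gamma}\|_2}\,J(K^* )}\right\},$$ and that policies are generated by the approximate policy iteration $$K^{(s)}=-\big(\Theta^{(s-1)}_{22}\big)^{-1}\Theta^{(s-1)}_{21},\qquad s=1,2,\dots,T,$$ where for each $s$ the parameter $\Theta^{(s-1)}$ defines an $\epsilon_0$-approximation $\widetilde Q(\cdot,\cdot;\Theta^{(s-1)})$ of the state-action value function $Q_{K^{(s-1)}}$. Then, for $$T\ge\left[\frac{2\|\Sigma_{K^*,\gamma}\|_2}{\gamma^2\sigma_{\min}(D_{\widetilde\omega})}-1\right]\log\frac{J(K^{(0)})-J(K^* )}{\epsilon},$$ the policies $K^{(1)},\dots,K^{(T)}$ are stable, are elements of $\mathbf{Dom}_{K^{(0)},2}$, and satisfy $$J(K^{(T)})-J(K^* )\le\epsilon .$$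
   Context: Setting (discounted LQR with Gaussian linear policies). $A\in\mathbb R^{n\times n}$, $B\in\mathbb R^{n\times d}$; $S\in\mathbb R^{n\times n}$ and $R\in\mathbb R^{d\times d}$ are symmetric positive definite; $\sigma>0$; $\gamma\in(0,1)$ is the discount factor. The noises $\omega_t\sim N(0,D_\omega)$ ($D_\omega$ positive definite) and $\eta_t\sim N(0,\sigma^2 I_d)$, $t\ge0$, are all independent; $\widetilde\omega_t:=B\eta_t+\omega_t$ and $D_{\widetilde\omega}:=\mathbb E[\widetilde\omega_t\widetilde\omega_t^\top]$. A policy is a matrix $K\in\mathbb R^{d\times n}$; under it $x_0=0$, $u_t=Kx_t+\eta_t$, $x_{t+1}=Ax_t+Bu_t+\omega_t=(A+BK)x_t+\widetilde\omega_t$, with cost $c_t=x_t^\top Sx_t+u_t^\top Ru_t$. The objective is $J(K)=\sum_{t\ge0}\gamma^t\mathbb E[c_t]\in(0,+\infty]$. $K$ is called stable if the spectral radius satisfies $\rho(A+BK)<1$; $\mathbf{Dom}$ is the set of stable policies, assumed non-empty. $K^*$ denotes a global minimizer of $J$ (all of $J$, $K^*$ depend on $\gamma$). $\Sigma_{K,\gamma}:=\sum_{t\ge0}\gamma^t\mathbb E[x_tx_t^\top]$, with $x_t$ generated by policy $K$. $\sigma_{\min}$ denotes the smallest singular value, $\|\cdot\|_2$ the spectral norm, $\|\cdot\|_F$ the Frobenius norm. $\mathbf{Dom}_{K,\nu}:=\{\tilde K:\ J(\tilde K)-J(K^* )\le\nu(J(K)-J(K^* ))\}$. State-action value function. With $P_{K,\gamma}:=\sum_{i\ge0}\gamma^i[(A+BK)^i]^\top(S+K^\top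 RK)(A+BK)^i$, for a stable $K$, $$Q_K(x,u)=\mathbb E\Big[\sum_{t\ge0}\gamma^tc_t\,\Big|\,x_0=x,u_0=u\Big]=\begin{bmatrix} x \\ u \end{bmatrix}^\top\begin{bmatrix}S+\gamma A^\top P_{K,\gamma}A&\gamma A^\top P_{K,\gamma}B\\ \gamma B^\top P_{K,\gamma}A&R+\gamma B^\top P_{K,\gamma}B\end{bmatrix}\begin{bmatrix} x \\ u \end{bmatrix}+\frac{\gamma}{1-\gamma}\mathrm{Tr}[\gamma P_{K,\gamma}D_{\widetilde\omega}+\sigma^2R]+\gamma\mathrm{Tr}[P_{K,\gamma}D_\omega]$$ (where in the conditional expectation $u_t=Kx_t+\eta_t$ for $t\ge1$). Approximations have the form $\widetilde Q(x,u;\Theta)=\begin{bmatrix} x \\ u \end{bmatrix}^\top\begin{bmatrix}\Theta_{11}&\Theta_{12}\\ \Theta_{21}&\Theta_{22}\end{bmatrix}\begin{bmatrix} x \\ u \end{bmatrix}+\Theta_0$ with parameters $\Theta$ (blocks and constant). Let $\Theta^*_K$ be the parameters of $Q_K$, i.e. $Q_K=\widetilde Q(\cdot,\cdot;\Theta^*_K)$ as displayed above. $\widetilde Q(\cdot,\cdot;\Theta)$ is an $\epsilon_0$-approximation of $Q_K$ if $\|\Theta-\Theta^*_K\|_F\le\epsilon_0$.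
   Formalization: Membership of K^(1),…,K^(T) in Dom_{K^(0),2} is claimed only when ε ≤ J(K^(0)) − J(K* ); without this it can fail, e.g. if K^(0) is already optimal. Stability and the final bound J(K^(T)) − J(K* ) ≤ ε are proved without the restriction. *)

theory Defs
  imports
    "HOL-Probability.Probability"
    "Jordan_Normal_Form.Gauss_Jordan_Elimination"
    "Jordan_Normal_Form.Spectral_Radius"
begin

text \<open>
  Matrices and vectors are those of \<^theory>\<open>Jordan_Normal_Form.Matrix\<close>, whose dimensions are terms:
  the constant of the main theorem must be chosen before, hence independently of, the dimensions.
\<close>

no_notation inner (infix "\<bullet>" 70)
unbundle no vec_syntax

hide_const (open) Determinants.trace

section \<open>Matrix notions\<close>

definition vnorm :: "real vec \<Rightarrow> real" where
  "vnorm v = sqrt (v \<bullet> v)"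

definition spectral_norm :: "real mat \<Rightarrow> real" where
  "spectral_norm X =
    (SUP v\<in>carrier_vec (dim_col X) - {0\<^sub>v (dim_col X)}. vnorm (X *\<^sub>v v) / vnorm v)"

definition frob_norm :: "real mat \<Rightarrow> real" where
  "frob_norm X = sqrt (\<Sum>i<dim_row X. \<Sum>j<dim_col X. (X $$ (i, j))\<^sup>2)"

text \<open>Only used for square matrices.\<close>
definition singular_values :: "real mat \<Rightarrow> real set" where
  "singular_values X = {s. 0 \<le> s \<and> eigenvalue (X\<^sup>T * X) (s\<^sup>2)}"

definition \<sigma>_min :: "real mat \<Rightarrow> real" where
  "\<sigma>_min X = Min (singular_values X)"

definition trace :: "real mat \<Rightarrow> real" where
  "trace X = (\<Sum>i<dim_row X. X $$ (i, i))"

text \<open>Unspecified if \<open>X\<close> is singular.\<close>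
definition minv :: "real mat \<Rightarrow> real mat" where
  "minv X = the (mat_inverse X)"

definition pos_def :: "nat \<Rightarrow> real mat \<Rightarrow> bool" where
  "pos_def n X \<longleftrightarrow> X \<in> carrier_mat n n \<and> X\<^sup>T = X \<and>
     (\<forall>v\<in>carrier_vec n. v \<noteq> 0\<^sub>v n \<longrightarrow> 0 < v \<bullet> (X *\<^sub>v v))"

text \<open>
  \<open>X \<sim> N(0, D)\<close> for positive definite \<open>D\<close>: every non-trivial linear functional \<open>a \<bullet> X\<close> is
  \<open>N(0, a \<bullet> D a)\<close>. (The library's \<^const>\<open>normal_density\<close> takes the standard deviation.)
\<close>
definition gaussian :: "'m measure \<Rightarrow> nat \<Rightarrow> real mat \<Rightarrow> ('m \<Rightarrow> real vec) \<Rightarrow> bool" where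
  "gaussian M n D X \<longleftrightarrow> (\<forall>w\<in>space M. X w \<in> carrier_vec n) \<and>
     (\<forall>a\<in>carrier_vec n. a \<noteq> 0\<^sub>v n \<longrightarrow>
        distributed M lborel (\<lambda>w. a \<bullet> X w) (normal_density 0 (sqrt (a \<bullet> (D *\<^sub>v a)))))"

text \<open>
  Measurable spaces of vectors are only available on functions, so a random vector enters the
  independence assumption as its family of components.
\<close>
definition components :: "nat \<Rightarrow> real vec \<Rightarrow> nat \<Rightarrow> real" where
  "components n v = (\<lambda>i\<in>{..<n}. v $ i)"

section \<open>The discounted LQR problem\<close>

record 'm lqr =
  dim_x :: nat                                  \<comment> \<open>\<open>n\<close>\<close>
  dim_u :: nat                                  \<comment> \<open>\<open>d\<close>\<close>
  mA :: "real mat"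
  mB :: "real mat"
  mS :: "real mat"
  mR :: "real mat"
  sigma :: real
  D\<omega> :: "real mat"
  prob_sp :: "'m measure"
  \<omega>_noise :: "nat \<Rightarrow> 'm \<Rightarrow> real vec"
  \<eta>_noise :: "nat \<Rightarrow> 'm \<Rightarrow> real vec"

definition lqr_setting :: "'m lqr \<Rightarrow> bool" where
  "lqr_setting P \<longleftrightarrow>
     0 < dim_x P \<and> 0 < dim_u P \<and>
     mA P \<in> carrier_mat (dim_x P) (dim_x P) \<and>
     mB P \<in> carrier_mat (dim_x P) (dim_u P) \<and>
     pos_def (dim_x P) (mS P) \<and> pos_def (dim_u P) (mR P) \<and>
     0 < sigma P \<and> pos_def (dim_x P) (D\<omega> P) \<and>
     prob_space (prob_sp P) \<and>
     (\<forall>t. gaussian (prob_sp P) (dim_x P) (D\<omega> P) (\<omega>_noise P t)) \<and>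
     (\<forall>t. gaussian (prob_sp P) (dim_u P) ((sigma P)\<^sup>2 \<cdot>\<^sub>m 1\<^sub>m (dim_u P)) (\<eta>_noise P t)) \<and>
     prob_space.indep_vars (prob_sp P)
       (case_sum (\<lambda>t::nat. Pi\<^sub>M {..<dim_x P} (\<lambda>_. borel))
                 (\<lambda>t::nat. Pi\<^sub>M {..<dim_u P} (\<lambda>_. borel)))
       (case_sum (\<lambda>t w. components (dim_x P) (\<omega>_noise P t w))
                 (\<lambda>t w. components (dim_u P) (\<eta>_noise P t w)))
       UNIV"

definition second_moment :: "'m measure \<Rightarrow> nat \<Rightarrow> ('m \<Rightarrow> real vec) \<Rightarrow> real mat" where
  "second_moment M n X = Matrix.mat n n (\<lambda>(i, j). integral\<^sup>L M (\<lambda>w. X w $ i * X w $ j))"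

definition \<omega>_tilde :: "'m lqr \<Rightarrow> nat \<Rightarrow> 'm \<Rightarrow> real vec" where
  "\<omega>_tilde P t w = mB P *\<^sub>v \<eta>_noise P t w + \<omega>_noise P t w"

text \<open>The \<open>\<omega>_tilde P t\<close> are identically distributed; \<open>t = 0\<close> is as good as any.\<close>
definition D\<omega>_tilde :: "'m lqr \<Rightarrow> real mat" where
  "D\<omega>_tilde P = second_moment (prob_sp P) (dim_x P) (\<omega>_tilde P 0)"

definition closed_loop :: "'m lqr \<Rightarrow> real mat \<Rightarrow> real mat" where
  "closed_loop P K = mA P + mB P * K"

definition policy :: "'m lqr \<Rightarrow> real mat \<Rightarrow> bool" where
  "policy P K \<longleftrightarrow> K \<in> carrier_mat (dim_u P) (dim_x P)"

definition stable_policy :: "'m lqr \<Rightarrow> real mat \<Rightarrow> bool" where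
  "stable_policy P K \<longleftrightarrow> policy P K \<and> spectral_radius (map_mat complex_of_real (closed_loop P K)) < 1"

primrec state :: "'m lqr \<Rightarrow> real mat \<Rightarrow> nat \<Rightarrow> 'm \<Rightarrow> real vec" where
  "state P K 0 w = 0\<^sub>v (dim_x P)"
| "state P K (Suc t) w =
     mA P *\<^sub>v state P K t w + mB P *\<^sub>v (K *\<^sub>v state P K t w + \<eta>_noise P t w) + \<omega>_noise P t w"

definition action :: "'m lqr \<Rightarrow> real mat \<Rightarrow> nat \<Rightarrow> 'm \<Rightarrow> real vec" where
  "action P K t w = K *\<^sub>v state P K t w + \<eta>_noise P t w"

definition cost :: "'m lqr \<Rightarrow> real mat \<Rightarrow> nat \<Rightarrow> 'm \<Rightarrow> real" where
  "cost P K t w = state P K t w \<bullet> (mS P *\<^sub>v state P K t w) + action P K t w \<bullet> (mR P *\<^sub>v action P K t w)"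

definition J :: "'m lqr \<Rightarrow> real \<Rightarrow> real mat \<Rightarrow> ereal" where
  "J P \<gamma> K = (\<Sum>t. ereal (\<gamma> ^ t * integral\<^sup>L (prob_sp P) (cost P K t)))"

definition global_minimizer :: "'m lqr \<Rightarrow> real \<Rightarrow> real mat \<Rightarrow> bool" where
  "global_minimizer P \<gamma> Kopt \<longleftrightarrow> policy P Kopt \<and> (\<forall>K. policy P K \<longrightarrow> J P \<gamma> Kopt \<le> J P \<gamma> K)"

definition Sigma_mat :: "'m lqr \<Rightarrow> real \<Rightarrow> real mat \<Rightarrow> real mat" where
  "Sigma_mat P \<gamma> K = Matrix.mat (dim_x P) (dim_x P)
     (\<lambda>ij. \<Sum>t. \<gamma> ^ t * second_moment (prob_sp P) (dim_x P) (state P K t) $$ ij)"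

text \<open>
  \<open>Kopt\<close> is the chosen global minimizer. If \<open>K\<close> is itself optimal, this is just the set of
  minimizers, which an inexact policy improvement step leaves. The main theorem therefore claims
  membership only if \<open>K\<close> is not already better than the requested accuracy \<open>\<epsilon>\<close>.
\<close>
definition Dom_sub :: "'m lqr \<Rightarrow> real \<Rightarrow> real mat \<Rightarrow> real mat \<Rightarrow> real \<Rightarrow> real mat set" where
  "Dom_sub P \<gamma> Kopt K \<nu> =
     {K'. policy P K' \<and> J P \<gamma> K' - J P \<gamma> Kopt \<le> ereal \<nu> * (J P \<gamma> K - J P \<gamma> Kopt)}"

section \<open>State-action value function and its approximations\<close>

definition P_mat :: "'m lqr \<Rightarrow> real \<Rightarrow> real mat \<Rightarrow> real mat" where
  "P_mat P \<gamma> K = Matrix.mat (dim_x P) (dim_x P)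
     (\<lambda>ij. \<Sum>i. \<gamma> ^ i *
        ((closed_loop P K ^\<^sub>m i)\<^sup>T * (mS P + K\<^sup>T * mR P * K) * (closed_loop P K ^\<^sub>m i)) $$ ij)"

record params =
  \<Theta>11 :: "real mat"
  \<Theta>12 :: "real mat"
  \<Theta>21 :: "real mat"
  \<Theta>22 :: "real mat"
  \<Theta>0 :: real

definition is_params :: "'m lqr \<Rightarrow> params \<Rightarrow> bool" where
  "is_params P \<Theta> \<longleftrightarrow>
     \<Theta>11 \<Theta> \<in> carrier_mat (dim_x P) (dim_x P) \<and> \<Theta>12 \<Theta> \<in> carrier_mat (dim_x P) (dim_u P) \<and>
     \<Theta>21 \<Theta> \<in> carrier_mat (dim_u P) (dim_x P) \<and> \<Theta>22 \<Theta> \<in> carrier_mat (dim_u P) (dim_u P)"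

text \<open>
  The parameters of the state-action value function of a stable policy \<open>K\<close>, i.e. of
  \<open>Q\<^sub>K(x, u) = E[\<Sum>t. \<gamma>\<^sup>t c\<^sub>t | x\<^sub>0 = x, u\<^sub>0 = u]
    = x \<bullet> \<Theta>11 x + x \<bullet> \<Theta>12 u + u \<bullet> \<Theta>21 x + u \<bullet> \<Theta>22 u + \<Theta>0\<close>.
  For \<open>K\<close> that is not stable the series in \<^const>\<open>P_mat\<close> may diverge and the value is then meaningless.
\<close>
definition \<Theta>_star :: "'m lqr \<Rightarrow> real \<Rightarrow> real mat \<Rightarrow> params" where
  "\<Theta>_star P \<gamma> K = \<lparr>
     \<Theta>11 = mS P + \<gamma> \<cdot>\<^sub>m ((mA P)\<^sup>T * P_mat P \<gamma> K * mA P),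
     \<Theta>12 = \<gamma> \<cdot>\<^sub>m ((mA P)\<^sup>T * P_mat P \<gamma> K * mB P),
     \<Theta>21 = \<gamma> \<cdot>\<^sub>m ((mB P)\<^sup>T * P_mat P \<gamma> K * mA P),
     \<Theta>22 = mR P + \<gamma> \<cdot>\<^sub>m ((mB P)\<^sup>T * P_mat P \<gamma> K * mB P),
     \<Theta>0 = \<gamma> / (1 - \<gamma>) * (trace (\<gamma> \<cdot>\<^sub>m (P_mat P \<gamma> K * D\<omega>_tilde P)) + trace ((sigma P)\<^sup>2 \<cdot>\<^sub>m mR P))
          + \<gamma> * trace (P_mat P \<gamma> K * D\<omega> P) \<rparr>"

definition params_dist :: "params \<Rightarrow> params \<Rightarrow> real" where
  "params_dist \<Theta> \<Theta>' = sqrt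
     ((frob_norm (\<Theta>11 \<Theta> - \<Theta>11 \<Theta>'))\<^sup>2 + (frob_norm (\<Theta>12 \<Theta> - \<Theta>12 \<Theta>'))\<^sup>2 +
      (frob_norm (\<Theta>21 \<Theta> - \<Theta>21 \<Theta>'))\<^sup>2 + (frob_norm (\<Theta>22 \<Theta> - \<Theta>22 \<Theta>'))\<^sup>2 + (\<Theta>0 \<Theta> - \<Theta>0 \<Theta>')\<^sup>2)"

definition approximates_Q :: "'m lqr \<Rightarrow> real \<Rightarrow> real \<Rightarrow> params \<Rightarrow> real mat \<Rightarrow> bool" where
  "approximates_Q P \<gamma> \<epsilon>0 \<Theta> K \<longleftrightarrow> is_params P \<Theta> \<and> params_dist \<Theta> (\<Theta>_star P \<gamma> K) \<le> \<epsilon>0"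

end

theory Submission imports Defs begin

text \<open>
  Write \<open>L = A + B K\<close>, let \<open>D\<close> be the covariance of the combined noise, and let
  \<open>x \<bullet> P\<^sub>K x = (\<Sum>i. \<gamma>\<^sup>i c\<^sub>K(L\<^sup>i x))\<close> be the discounted cost, for the stage cost
  \<open>c\<^sub>K(x) = x \<bullet> S x + K x \<bullet> R K x\<close>, of the noise-free trajectory from \<open>x\<close>.
  The noises at different times are uncorrelated, so the second moments satisfy
  \<open>M\<^sub>t\<^sub>+\<^sub>1 = L M\<^sub>t L\<^sup>T + D\<close>, whence
  \<open>J(K) = \<gamma>/(1 - \<gamma>) tr(P\<^sub>K D) + \<sigma>\<^sup>2/(1 - \<gamma>) tr R\<close> and
  \<open>\<Sigma>\<^sub>K = \<gamma>/(1 - \<gamma>) (\<Sum>i. \<gamma>\<^sup>i L\<^sup>i D (L\<^sup>T)\<^sup>i)\<close>. Factoring \<open>D\<close> into rank one matrices \<open>w\<^sub>k w\<^sub>k\<^sup>T\<close>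
  replaces traces against \<open>D\<close> by sums over the trajectories that start in the \<open>w\<^sub>k\<close>, and everything about
  the objective becomes a statement about quadratic forms along deterministic trajectories.

  As a function of the action, \<open>Q\<^sub>K(x, u)\<close> is quadratic with leading term \<open>u \<bullet> \<Theta>\<^sub>2\<^sub>2 u\<close>, where
  \<open>\<Theta>\<^sub>2\<^sub>2 \<ge> R\<close>; it is minimal at the greedy action. Completing the square measures each policy \<open>C\<close> by
  the excess \<open>F\<^sub>K(C, x)\<close> of \<open>Q\<^sub>K(x, C x)\<close> over that minimum, and telescoping gives the performance difference
  \<open>J(C) - J(K) = \<gamma>/(1 - \<gamma>) (\<Sum>k i. \<gamma>\<^sup>i (F\<^sub>K(C, \<cdot>) - F\<^sub>K(K, \<cdot>))(L\<^sub>C\<^sup>i w\<^sub>k))\<close>. With \<open>E\<close> the matrix of the form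
  \<open>F\<^sub>K(K, \<cdot>)\<close> it yields

  \<^item> for the optimal policy, \<open>J(K) - J(K\<^sup>*) \<le> tr(E \<Sigma>\<^sub>K\<^sub>*) \<le> \<parallel>\<Sigma>\<^sub>K\<^sub>*\<parallel> tr E\<close> (lemma \<open>gap_le_excess\<close>);
  \<^item> for the next iterate \<open>K'\<close>, whose excess is at most \<open>c |x|\<^sup>2\<close> with \<open>c = O(\<epsilon>\<^sub>0\<^sup>2)\<close> (lemma
    \<open>approximate_greedy_excess\<close>), a decrease of at least \<open>\<gamma>/(1 - \<gamma>) \<sigma>\<^sub>m\<^sub>i\<^sub>n(D) tr E\<close> up to an error
    \<open>O(c J(K))\<close> (lemma \<open>near_greedy_improves\<close>).

  Together the gap \<open>g = J(K) - J(K\<^sup>*)\<close> obeys \<open>g' \<le> (1 - y) g + (y/2) \<epsilon>\<close> with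
  \<open>y = \<gamma> \<sigma>\<^sub>m\<^sub>i\<^sub>n(D) / ((1 - \<gamma>) \<parallel>\<Sigma>\<^sub>K\<^sub>*\<parallel>)\<close> (lemma \<open>approximate_policy_iteration_step\<close>), hence stays below the larger of
  \<open>\<epsilon>\<close> and \<open>(1 - y/2)\<^sup>s g\<^sub>0\<close>.

  The same excess bound makes \<open>2 P\<^sub>K\<close> a Lyapunov function for \<open>K'\<close>, so that finiteness of the cost passes from
  iterate to iterate (lemma \<open>near_greedy_finite_cost\<close>). Finite cost means only that the spectral radius is
  below \<open>\<gamma>\<close> to the power \<open>-1/2\<close>. Stability follows for \<open>\<gamma>\<close> close to 1: an unstable closed loop
  has \<open>tr(P\<^sub>K D) \<ge> \<sigma>\<^sub>m\<^sub>i\<^sub>n(S) \<sigma>\<^sub>m\<^sub>i\<^sub>n(D) / (1 - \<gamma>)\<close> (lemma \<open>trace_P_mat_lower\<close>), while along the iteration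
  \<open>tr(P\<^sub>K D) \<le> 4 (1 - \<gamma>) J(K\<^sup>0)\<close>, which is bounded as \<open>\<gamma>\<close> tends to 1 because the powers of the closed loop
  of the stable policy \<open>K\<^sup>0\<close> decay geometrically.
\<close>

section \<open>Positive semidefinite matrices as sums of squares\<close>

lemma bilinear_as_sum:
  fixes X :: "real mat"
  assumes "X \<in> carrier_mat m n" "x \<in> carrier_vec m" "y \<in> carrier_vec n"
  shows "x \<bullet> (X *\<^sub>v y) = (\<Sum>i<m. \<Sum>j<n. X $$ (i,j) * x $ i * y $ j)"
  using assms
  by (auto simp: scalar_prod_def row_def lessThan_atLeast0 sum_distrib_left intro!: sum.cong)

lemma entry_as_bilinear:
  fixes X :: "real mat"
  assumes X: "X \<in> carrier_mat n m" and "i < n" "j < m"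
  shows "X $$ (i,j) = unit_vec n i \<bullet> (X *\<^sub>v unit_vec m j)"
proof -
  have "unit_vec n i \<bullet> (X *\<^sub>v unit_vec m j) = (X *\<^sub>v unit_vec m j) $ i"
    using assms by (intro scalar_prod_left_unit) auto
  also have "\<dots> = X $$ (i,j)" using assms by simp
  finally show ?thesis by simp
qed

lemma mult_transpose_move:
  assumes "C \<in> carrier_mat a b" "x \<in> carrier_vec b" "y \<in> carrier_vec a"
  shows "x \<bullet> (C\<^sup>T *\<^sub>v y) = (C *\<^sub>v x) \<bullet> (y :: real vec)"
  using transpose_vec_mult_scalar[OF assms] assms
  by (metis comm_scalar_prod mult_mat_vec_carrier transpose_carrier_mat)

text \<open>
  Cholesky factorisation by eliminating the last coordinate. Choosing that coordinate so that it minimises the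
  form leaves the form of the Schur complement, which is therefore again positive semidefinite. If the pivot
  vanishes, so does its column, and the convention for division by zero yields the right factor.
\<close>
lemma psd_factor_fun:
  fixes X :: "nat \<Rightarrow> nat \<Rightarrow> real"
  assumes sym: "\<And>i j. i < n \<Longrightarrow> j < n \<Longrightarrow> X i j = X j i"
    and psd: "\<And>f. 0 \<le> (\<Sum>i<n. \<Sum>j<n. X i j * f i * f j)"
  shows "\<exists>d. \<forall>i<n. \<forall>j<n. X i j = (\<Sum>k<n. d k i * d k j)"
  using assms
proof (induction n arbitrary: X)
  case 0
  then show ?case by simp
next
  case (Suc n)
  define c where "c = X n n"
  have expand: "(\<Sum>i<Suc n. \<Sum>j<Suc n. X i j * f i * f j) =
      (\<Sum>i<n. \<Sum>j<n. X i j * f i * f j) + 2 * f n * (\<Sum>i<n. X i n * f i) + c * (f n)\<^sup>2" for f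
  proof -
    have "(\<Sum>j<n. X n j * f n * f j) = f n * (\<Sum>i<n. X i n * f i)"
      unfolding sum_distrib_left by (rule sum.cong) (use Suc.prems(1) in \<open>auto simp: mult_ac\<close>)
    moreover have "(\<Sum>i<n. X i n * f i * f n) = f n * (\<Sum>i<n. X i n * f i)"
      unfolding sum_distrib_left by (rule sum.cong) (auto simp: mult_ac)
    ultimately show ?thesis
      by (simp add: sum.distrib c_def power2_eq_square)
  qed
  have c0: "0 \<le> c"
    using Suc.prems(2)[of "\<lambda>i. if i = n then 1 else 0"] unfolding expand by simp
  have col0: "X i n = 0" if "c = 0" "i < n" for i
  proof (rule ccontr)
    assume ne: "X i n \<noteq> 0"
    \<comment> \<open>With this weight on the last coordinate the form would be \<open>-1\<close>.\<close>
    define t where "t = - (X i i + 1) / (2 * X i n)"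
    have s1: "(\<Sum>k<n. X k n * (if k = i then 1 else if k = n then t else 0)) = X i n"
      using that by (subst sum.cong[OF refl, of _ _ "\<lambda>k. if k = i then X i n else 0"]) auto
    have s2: "(\<Sum>k<n. \<Sum>j<n. X k j * (if k = i then 1 else if k = n then t else 0)
        * (if j = i then 1 else if j = n then t else 0)) = X i i"
    proof -
      have "(\<Sum>k<n. \<Sum>j<n. X k j * (if k = i then 1 else if k = n then t else 0)
        * (if j = i then 1 else if j = n then t else 0))
         = (\<Sum>k<n. \<Sum>j<n. if k = i then (if j = i then X k j else 0) else 0)"
        by (intro sum.cong) auto
      also have "\<dots> = X i i"
        using that by (subst sum.cong[OF refl, of _ _ "\<lambda>k. if k = i then X i i else 0"]) auto
      finally show ?thesis .
    qed
    have "0 \<le> X i i + 2 * t * X i n"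
      using Suc.prems(2)[of "\<lambda>k. if k = i then 1 else if k = n then t else 0"]
      unfolding expand s1 s2 using that by (simp split: if_splits)
    also have "\<dots> = -1" using ne by (simp add: t_def field_simps)
    finally show False by simp
  qed
  \<comment> \<open>The Schur complement of the last diagonal entry.\<close>
  define X' where "X' = (\<lambda>i j. X i j - X i n * X j n / c)"
  have "\<exists>d. \<forall>i<n. \<forall>j<n. X' i j = (\<Sum>k<n. d k i * d k j)"
  proof (rule Suc.IH)
    show "X' i j = X' j i" if "i < n" "j < n" for i j
      using that Suc.prems(1)[of i j] by (simp add: X'_def)
    show "0 \<le> (\<Sum>i<n. \<Sum>j<n. X' i j * f i * f j)" for f
    proof -
      define b where "b = (\<Sum>i<n. X i n * f i)"
      \<comment> \<open>The minimiser of the form over the last coordinate.\<close>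
      define g where "g = f(n := - b / c)"
      have b0: "b = 0" if "c = 0" using col0[OF that] by (simp add: b_def)
      have "0 \<le> (\<Sum>i<n. \<Sum>j<n. X i j * f i * f j) + 2 * g n * b + c * (g n)\<^sup>2"
        using Suc.prems(2)[of g] unfolding expand by (simp add: g_def b_def)
      also have "\<dots> = (\<Sum>i<n. \<Sum>j<n. X i j * f i * f j) - b * b / c"
        using b0 by (cases "c = 0") (auto simp: g_def power2_eq_square field_simps)
      also have "b * b / c = (\<Sum>i<n. \<Sum>j<n. X i n * X j n / c * f i * f j)"
        unfolding b_def sum_product sum_divide_distrib by (intro sum.cong) (auto simp: mult_ac)
      also have "(\<Sum>i<n. \<Sum>j<n. X i j * f i * f j) - \<dots> = (\<Sum>i<n. \<Sum>j<n. X' i j * f i * f j)"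
        by (simp add: X'_def sum_subtractf left_diff_distrib)
      finally show ?thesis .
    qed
  qed
  then obtain d where d: "\<And>i j. i < n \<Longrightarrow> j < n \<Longrightarrow> X' i j = (\<Sum>k<n. d k i * d k j)" by blast
  define d' where "d' = (\<lambda>k i. if k = n then X i n / sqrt c else if i = n then 0 else d k i)"
  have "X i j = (\<Sum>k<Suc n. d' k i * d' k j)" if "i < Suc n" "j < Suc n" for i j
  proof -
    have dn: "d' n i * d' n j = X i n * X j n / c"
      using c0 by (simp add: d'_def)
    show ?thesis
    proof (cases "i = n \<or> j = n")
      case True
      have "(\<Sum>k<n. d' k i * d' k j) = 0"
        using True by (intro sum.neutral) (auto simp: d'_def)
      moreover have "X i j = X i n * X j n / c"
        using True that col0[of i] col0[of j] Suc.prems(1)[of i j]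
        by (cases "c = 0"; cases "i = n"; cases "j = n") (auto simp: c_def)
      ultimately show ?thesis using dn by simp
    next
      case False
      have "(\<Sum>k<n. d' k i * d' k j) = (\<Sum>k<n. d k i * d k j)"
        using False by (intro sum.cong) (auto simp: d'_def)
      also have "\<dots> = X' i j" using d False that by simp
      finally show ?thesis using dn by (simp add: X'_def)
    qed
  qed
  then show ?case by blast
qed

lemma smult_mat_mult_vec:
  fixes X :: "'a :: comm_ring_1 mat"
  assumes "X \<in> carrier_mat m n" "v \<in> carrier_vec n"
  shows "(c \<cdot>\<^sub>m X) *\<^sub>v v = c \<cdot>\<^sub>v (X *\<^sub>v v)"
  using assms by (intro eq_vecI) (auto simp: row_smult)

lemma trace_mult_as_sum:
  assumes "X \<in> carrier_mat n n" "Y \<in> carrier_mat n n"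
  shows "trace (X * Y) = (\<Sum>i<n. \<Sum>j<n. X $$ (i,j) * Y $$ (j,i))"
  using assms by (auto simp: trace_def scalar_prod_def lessThan_atLeast0 intro!: sum.cong)

lemma sym_indexD:
  assumes "X \<in> carrier_mat n n" "X\<^sup>T = X" "i < n" "j < n"
  shows "X $$ (i,j) = X $$ (j,i)"
  by (metis assms carrier_matD index_transpose_mat(1))

text \<open>
  The vectors \<open>d k\<close> are the columns of a square root of \<open>X\<close>; a trace against \<open>X\<close> becomes a sum of values of a
  quadratic form.
\<close>
lemma psd_factor:
  assumes X: "X \<in> carrier_mat n n" and sym: "X\<^sup>T = X"
    and psd: "\<And>v. v \<in> carrier_vec n \<Longrightarrow> 0 \<le> v \<bullet> (X *\<^sub>v v)"
  obtains d :: "nat \<Rightarrow> real vec" where "\<And>k. d k \<in> carrier_vec n"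
    "\<And>i j. i < n \<Longrightarrow> j < n \<Longrightarrow> X $$ (i,j) = (\<Sum>k<n. d k $ i * d k $ j)"
    "\<And>N. N \<in> carrier_mat n n \<Longrightarrow> trace (N * X) = (\<Sum>k<n. d k \<bullet> (N *\<^sub>v d k))"
proof -
  have "\<exists>d. \<forall>i<n. \<forall>j<n. X $$ (i,j) = (\<Sum>k<n. d k i * d k j)"
  proof (rule psd_factor_fun)
    show "X $$ (i,j) = X $$ (j,i)" if "i < n" "j < n" for i j
      using sym_indexD[OF X sym that] .
    show "0 \<le> (\<Sum>i<n. \<Sum>j<n. X $$ (i,j) * f i * f j)" for f :: "nat \<Rightarrow> real"
      using psd[OF vec_carrier, of f] bilinear_as_sum[OF X vec_carrier vec_carrier, of f f] by simp
  qed
  then obtain d where d: "\<And>i j. i < n \<Longrightarrow> j < n \<Longrightarrow> X $$ (i,j) = (\<Sum>k<n. d k i * d k j)" by blast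
  show thesis
  proof (rule that[of "\<lambda>k. Matrix.vec n (d k)"])
    fix N :: "real mat" assume N: "N \<in> carrier_mat n n"
    have "(\<Sum>k<n. Matrix.vec n (d k) \<bullet> (N *\<^sub>v Matrix.vec n (d k))) =
        (\<Sum>k<n. \<Sum>i<n. \<Sum>j<n. N $$ (i,j) * d k i * d k j)"
      by (intro sum.cong refl, subst bilinear_as_sum[OF N]) auto
    also have "\<dots> = (\<Sum>i<n. \<Sum>j<n. \<Sum>k<n. N $$ (i,j) * d k i * d k j)"
      by (subst sum.swap) (rule sum.cong[OF refl], rule sum.swap)
    also have "\<dots> = (\<Sum>i<n. \<Sum>j<n. N $$ (i,j) * X $$ (j,i))"
      using d by (intro sum.cong refl) (simp add: sum_distrib_left mult_ac)
    finally show "trace (N * X) = (\<Sum>k<n. Matrix.vec n (d k) \<bullet> (N *\<^sub>v Matrix.vec n (d k)))"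
      using trace_mult_as_sum[OF N X] by simp
  qed (use d in auto)
qed

lemma bilinear_sym:
  fixes X :: "real mat"
  assumes "X \<in> carrier_mat n n" "X\<^sup>T = X" "x \<in> carrier_vec n" "y \<in> carrier_vec n"
  shows "x \<bullet> (X *\<^sub>v y) = y \<bullet> (X *\<^sub>v x)"
proof -
  have "(X\<^sup>T *\<^sub>v x) \<bullet> y = x \<bullet> (X *\<^sub>v y)"
    by (rule transpose_vec_mult_scalar) (use assms in auto)
  then show ?thesis using assms by (simp add: comm_scalar_prod[of _ n])
qed

text \<open>
  \<open>Y - X\<close> is a sum of matrices \<open>d d\<^sup>T\<close>, so the difference of the traces is a sum of values of the form of \<open>N\<close>.
\<close>
lemma trace_mult_mono:
  assumes X: "X \<in> carrier_mat n n" "X\<^sup>T = X" and Y: "Y \<in> carrier_mat n n" "Y\<^sup>T = Y"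
    and le: "\<And>v. v \<in> carrier_vec n \<Longrightarrow> v \<bullet> (X *\<^sub>v v) \<le> v \<bullet> (Y *\<^sub>v v)"
    and N: "N \<in> carrier_mat n n" "\<And>v. v \<in> carrier_vec n \<Longrightarrow> 0 \<le> v \<bullet> (N *\<^sub>v v)"
  shows "trace (N * X) \<le> trace (N * Y)"
proof -
  have Z: "Y - X \<in> carrier_mat n n" "(Y - X)\<^sup>T = Y - X"
    using X Y by (auto simp: transpose_minus)
  have "0 \<le> v \<bullet> ((Y - X) *\<^sub>v v)" if v: "v \<in> carrier_vec n" for v
    using le[OF v] v X Y by (simp add: minus_mult_distrib_mat_vec[of _ n n] scalar_prod_minus_distrib[of _ n])
  from psd_factor[OF Z this] obtain d where d: "\<And>k. d k \<in> carrier_vec n"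
    "\<And>N. N \<in> carrier_mat n n \<Longrightarrow> trace (N * (Y - X)) = (\<Sum>k<n. d k \<bullet> (N *\<^sub>v d k))" by metis
  have "0 \<le> trace (N * (Y - X))"
    unfolding d(2)[OF N(1)] by (intro sum_nonneg N(2) d(1))
  also have "\<dots> = trace (N * Y) - trace (N * X)"
    using X Y N by (simp add: trace_mult_as_sum[of _ n] Z sum_subtractf right_diff_distrib)
  finally show ?thesis by simp
qed

section \<open>Euclidean, Frobenius and spectral norms\<close>

lemma mult_self_le_imp_le:
  fixes a c :: real
  assumes "a * a \<le> c * a" "0 \<le> a" "0 \<le> c"
  shows "a \<le> c"
  using assms by (cases "a = 0") (auto simp: mult_le_cancel_right)

lemma vnorm_nonneg [simp]: "0 \<le> vnorm v"
  by (auto simp: vnorm_def scalar_prod_def intro!: sum_nonneg)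

lemma scalar_prod_self_nonneg [simp]: "0 \<le> (v :: real vec) \<bullet> v"
  by (auto simp: scalar_prod_def intro!: sum_nonneg)

lemma vnorm_sq: "(vnorm v)\<^sup>2 = v \<bullet> v"
  by (simp add: vnorm_def)

lemma vnorm_eq_0:
  assumes v: "v \<in> carrier_vec n"
  shows "vnorm v = 0 \<longleftrightarrow> v = 0\<^sub>v n"
proof
  assume "vnorm v = 0"
  then have "(\<Sum>i<n. (v $ i)\<^sup>2) = 0"
    using v by (simp add: vnorm_def scalar_prod_def power2_eq_square lessThan_atLeast0)
  then have "\<forall>i<n. v $ i = 0" by (subst (asm) sum_nonneg_eq_0_iff) auto
  then show "v = 0\<^sub>v n" using v by (intro eq_vecI) auto
qed (simp add: vnorm_def)

lemma vnorm_pos: "v \<in> carrier_vec n \<Longrightarrow> v \<noteq> 0\<^sub>v n \<Longrightarrow> 0 < vnorm v"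
  using vnorm_eq_0[of v n] vnorm_nonneg[of v] by linarith

lemma vec_cauchy_schwarz:
  assumes "x \<in> carrier_vec n" "y \<in> carrier_vec n"
  shows "\<bar>x \<bullet> y\<bar> \<le> vnorm x * vnorm y"
proof -
  have "(x \<bullet> y)\<^sup>2 \<le> (x \<bullet> x) * (y \<bullet> y)"
    using Cauchy_Schwarz_ineq_sum[of "\<lambda>i. x $ i" "\<lambda>i. y $ i" "{0..<n}"] assms
    by (simp add: scalar_prod_def power2_eq_square)
  then have "(x \<bullet> y)\<^sup>2 \<le> (vnorm x * vnorm y)\<^sup>2"
    by (simp add: power_mult_distrib vnorm_sq)
  then have "\<bar>x \<bullet> y\<bar> \<le> \<bar>vnorm x * vnorm y\<bar>" by (simp only: abs_le_square_iff)
  then show ?thesis by simp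
qed

lemma vnorm_triangle:
  assumes "x \<in> carrier_vec n" "y \<in> carrier_vec n"
  shows "vnorm (x + y) \<le> vnorm x + vnorm y"
proof (rule power2_le_imp_le)
  have "(vnorm (x + y))\<^sup>2 = x \<bullet> x + 2 * (x \<bullet> y) + y \<bullet> y"
    using assms comm_scalar_prod[OF assms]
    by (simp add: vnorm_sq add_scalar_prod_distrib[of _ n] scalar_prod_add_distrib[of _ n])
  also have "\<dots> \<le> (vnorm x + vnorm y)\<^sup>2"
    using vec_cauchy_schwarz[OF assms] by (simp add: power2_sum vnorm_sq)
  finally show "(vnorm (x + y))\<^sup>2 \<le> (vnorm x + vnorm y)\<^sup>2" .
qed simp

lemma vnorm_uminus [simp]: "vnorm (- x) = vnorm x"
  by (simp add: vnorm_def)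

lemma frob_norm_nonneg [simp]: "0 \<le> frob_norm X"
  by (auto simp: frob_norm_def intro!: sum_nonneg)

lemma vnorm_mult_le_frob:
  assumes X: "X \<in> carrier_mat m n" and v: "v \<in> carrier_vec n"
  shows "vnorm (X *\<^sub>v v) \<le> frob_norm X * vnorm v"
proof (rule power2_le_imp_le)
  have "(vnorm (X *\<^sub>v v))\<^sup>2 = (\<Sum>i<m. (\<Sum>j<n. X $$ (i,j) * v $ j)\<^sup>2)"
    unfolding vnorm_sq using X v by (simp add: scalar_prod_def power2_eq_square lessThan_atLeast0)
  also have "\<dots> \<le> (\<Sum>i<m. (\<Sum>j<n. (X $$ (i,j))\<^sup>2) * (\<Sum>j<n. (v $ j)\<^sup>2))"
    by (intro sum_mono Cauchy_Schwarz_ineq_sum)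
  also have "\<dots> = (frob_norm X * vnorm v)\<^sup>2"
    using X v by (simp add: power_mult_distrib vnorm_sq frob_norm_def sum_nonneg sum_distrib_right
        scalar_prod_def power2_eq_square[of "v $ _"] lessThan_atLeast0)
  finally show "(vnorm (X *\<^sub>v v))\<^sup>2 \<le> (frob_norm X * vnorm v)\<^sup>2" .
qed simp

lemma bilinear_le_frob:
  fixes N :: "real mat"
  assumes "N \<in> carrier_mat n m" "x \<in> carrier_vec n" "y \<in> carrier_vec m"
  shows "\<bar>x \<bullet> (N *\<^sub>v y)\<bar> \<le> frob_norm N * vnorm x * vnorm y"
proof -
  have "\<bar>x \<bullet> (N *\<^sub>v y)\<bar> \<le> vnorm x * vnorm (N *\<^sub>v y)"
    using assms by (intro vec_cauchy_schwarz[of _ n]) auto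
  also have "\<dots> \<le> vnorm x * (frob_norm N * vnorm y)"
    by (intro mult_left_mono vnorm_mult_le_frob[OF assms(1,3)]) simp
  finally show ?thesis by (simp add: mult_ac)
qed

lemma frob_norm_sq_columns:
  assumes X: "X \<in> carrier_mat m n"
  shows "(frob_norm X)\<^sup>2 = (\<Sum>j<n. (vnorm (X *\<^sub>v unit_vec n j))\<^sup>2)"
proof -
  have "(vnorm (X *\<^sub>v unit_vec n j))\<^sup>2 = (\<Sum>i<m. (X $$ (i,j))\<^sup>2)" if "j < n" for j
    unfolding vnorm_sq using X that
    by (simp add: scalar_prod_def[of "X *\<^sub>v unit_vec n j"] power2_eq_square lessThan_atLeast0)
  then show ?thesis
    using X by (simp add: frob_norm_def sum_nonneg sum.swap[of _ "{..<m}"])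
qed

lemma vnorm_mult_le_spectral:
  assumes X: "X \<in> carrier_mat m n" and v: "v \<in> carrier_vec n"
  shows "vnorm (X *\<^sub>v v) \<le> spectral_norm X * vnorm v"
proof (cases "v = 0\<^sub>v n")
  case True
  then have "X *\<^sub>v v = 0\<^sub>v m" using X by auto
  then have "vnorm (X *\<^sub>v v) = 0" by (simp add: vnorm_def)
  then show ?thesis using True by (simp add: vnorm_def)
next
  case False
  have "vnorm (X *\<^sub>v v) / vnorm v \<le> spectral_norm X"
    unfolding spectral_norm_def
  proof (rule cSUP_upper)
    show "v \<in> carrier_vec (dim_col X) - {0\<^sub>v (dim_col X)}" using X v False by auto
    show "bdd_above ((\<lambda>v. vnorm (X *\<^sub>v v) / vnorm v) ` (carrier_vec (dim_col X) - {0\<^sub>v (dim_col X)}))"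
      using X vnorm_mult_le_frob[OF X] vnorm_pos[of _ n]
      by (intro bdd_aboveI2[of _ _ "frob_norm X"]) (auto simp: divide_le_eq)
  qed
  then show ?thesis using vnorm_pos[OF v False] by (simp add: divide_le_eq)
qed

lemma spectral_norm_nonneg:
  assumes "X \<in> carrier_mat m n" "0 < n"
  shows "0 \<le> spectral_norm X"
proof -
  have "0 < vnorm (unit_vec n 0)"
    using assms by (intro vnorm_pos[of _ n]) auto
  moreover have "0 \<le> spectral_norm X * vnorm (unit_vec n 0)"
    using vnorm_mult_le_spectral[OF assms(1), of "unit_vec n 0"] vnorm_nonneg order_trans
    by (metis unit_vec_carrier)
  ultimately show ?thesis by (simp add: zero_le_mult_iff)
qed

lemma bilinear_le_spectral:
  assumes X: "X \<in> carrier_mat n n" and v: "v \<in> carrier_vec n"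
  shows "v \<bullet> (X *\<^sub>v v) \<le> spectral_norm X * (v \<bullet> v)"
proof -
  have "v \<bullet> (X *\<^sub>v v) \<le> vnorm v * vnorm (X *\<^sub>v v)"
    using vec_cauchy_schwarz[of v n "X *\<^sub>v v"] X v by auto
  also have "\<dots> \<le> vnorm v * (spectral_norm X * vnorm v)"
    by (intro mult_left_mono vnorm_mult_le_spectral[OF X v]) simp
  finally show ?thesis by (simp add: vnorm_sq[symmetric] power2_eq_square mult_ac)
qed

section \<open>Inverses and smallest singular values\<close>

lemma minv_inverse:
  assumes X: "X \<in> carrier_mat n n" and inj: "\<And>v. v \<in> carrier_vec n \<Longrightarrow> X *\<^sub>v v = 0\<^sub>v n \<Longrightarrow> v = 0\<^sub>v n"
  shows "minv X \<in> carrier_mat n n" "X * minv X = 1\<^sub>m n" "minv X * X = 1\<^sub>m n"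
proof -
  have "Determinant.det X \<noteq> 0"
    using inj det_0_iff_vec_prod_zero[OF X] by auto
  then have "X \<in> Units (ring_mat TYPE(real) n ())"
    by (rule det_non_zero_imp_unit[OF X])
  with mat_inverse(1)[OF X, of "()"] obtain Y where Y: "mat_inverse X = Some Y" by (cases "mat_inverse X") auto
  from mat_inverse(2)[OF X Y] Y
  show "minv X \<in> carrier_mat n n" "X * minv X = 1\<^sub>m n" "minv X * X = 1\<^sub>m n"
    by (auto simp: minv_def)
qed

lemma minv_solve:
  assumes M: "M \<in> carrier_mat d d" and G: "G \<in> carrier_mat d n"
    and inj: "\<And>v. v \<in> carrier_vec d \<Longrightarrow> M *\<^sub>v v = 0\<^sub>v d \<Longrightarrow> v = 0\<^sub>v d" and x: "x \<in> carrier_vec n"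
  shows "- (minv M * G) \<in> carrier_mat d n" "M *\<^sub>v (- (minv M * G) *\<^sub>v x) = - (G *\<^sub>v x)"
proof -
  note Z = minv_inverse[OF M inj]
  have ZG: "minv M * G \<in> carrier_mat d n" using Z(1) G by (rule mult_carrier_mat)
  then show "- (minv M * G) \<in> carrier_mat d n" by simp
  have Gx: "G *\<^sub>v x \<in> carrier_vec d" by (rule mult_mat_vec_carrier[OF G x])
  have "- (minv M * G) *\<^sub>v x = - ((minv M * G) *\<^sub>v x)"
    using ZG x by (intro uminus_mult_mat_vec) auto
  also have "(minv M * G) *\<^sub>v x = minv M *\<^sub>v (G *\<^sub>v x)" by (rule assoc_mult_mat_vec[OF Z(1) G x])
  also have "M *\<^sub>v - (minv M *\<^sub>v (G *\<^sub>v x)) = - (M *\<^sub>v (minv M *\<^sub>v (G *\<^sub>v x)))"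
    using M carrier_matD[OF Z(1)] by (intro eq_vecI) auto
  also have "M *\<^sub>v (minv M *\<^sub>v (G *\<^sub>v x)) = (M * minv M) *\<^sub>v (G *\<^sub>v x)"
    by (rule assoc_mult_mat_vec[OF M Z(1) Gx, symmetric])
  also have "M * minv M = 1\<^sub>m d" by (rule Z(2))
  also have "1\<^sub>m d *\<^sub>v (G *\<^sub>v x) = G *\<^sub>v x" by (rule one_mult_mat_vec[OF Gx])
  finally show "M *\<^sub>v (- (minv M * G) *\<^sub>v x) = - (G *\<^sub>v x)" .
qed

lemma pos_def_inj:
  assumes X: "pos_def n X" and v: "v \<in> carrier_vec n" "X *\<^sub>v v = 0\<^sub>v n"
  shows "v = 0\<^sub>v n"
  using assms unfolding pos_def_def by (metis less_irrefl scalar_prod_right_zero)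

text \<open>
  In the coordinates given by a square root of \<open>X\<close>, the bilinear form is the Euclidean inner product.
\<close>
lemma psd_cauchy_schwarz:
  fixes X :: "real mat"
  assumes X: "X \<in> carrier_mat n n" "X\<^sup>T = X" "\<And>v. v \<in> carrier_vec n \<Longrightarrow> 0 \<le> v \<bullet> (X *\<^sub>v v)"
    and xy: "x \<in> carrier_vec n" "y \<in> carrier_vec n"
  shows "(x \<bullet> (X *\<^sub>v y))\<^sup>2 \<le> (x \<bullet> (X *\<^sub>v x)) * (y \<bullet> (X *\<^sub>v y))"
proof -
  obtain d where d: "\<And>k. d k \<in> carrier_vec n"
    "\<And>i j. i < n \<Longrightarrow> j < n \<Longrightarrow> X $$ (i,j) = (\<Sum>k<n. d k $ i * d k $ j)"
    using psd_factor[OF X] by metis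
  have eq: "x \<bullet> (X *\<^sub>v y) = (\<Sum>k<n. (d k \<bullet> x) * (d k \<bullet> y))"
    if "x \<in> carrier_vec n" "y \<in> carrier_vec n" for x y
  proof -
    have "(\<Sum>k<n. (d k \<bullet> x) * (d k \<bullet> y)) = (\<Sum>k<n. \<Sum>i<n. \<Sum>j<n. d k $ i * d k $ j * x $ i * y $ j)"
      using that d(1) by (simp add: scalar_prod_def sum_product lessThan_atLeast0 mult_ac)
    also have "\<dots> = (\<Sum>i<n. \<Sum>j<n. \<Sum>k<n. d k $ i * d k $ j * x $ i * y $ j)"
      by (subst sum.swap) (rule sum.cong[OF refl], rule sum.swap)
    also have "\<dots> = x \<bullet> (X *\<^sub>v y)"
      using that by (simp add: bilinear_as_sum[OF X(1)] d(2) sum_distrib_right)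
    finally show ?thesis by simp
  qed
  show ?thesis unfolding eq[OF xy] eq[OF xy(1) xy(1)] eq[OF xy(2) xy(2)]
    using Cauchy_Schwarz_ineq_sum[of "\<lambda>k. d k \<bullet> x" "\<lambda>k. d k \<bullet> y" "{..<n}"]
    by (simp add: power2_eq_square)
qed

text \<open>
  The Cauchy-Schwarz inequality for the form of \<open>X\<close>, applied to \<open>v\<close> and \<open>Z v\<close>, where \<open>X (Z v) = v\<close>.
\<close>
lemma psd_inverse_coercive:
  assumes X: "X \<in> carrier_mat n n" "X\<^sup>T = X" "\<And>v. v \<in> carrier_vec n \<Longrightarrow> 0 \<le> v \<bullet> (X *\<^sub>v v)"
    and Z: "Z \<in> carrier_mat n n" "X * Z = 1\<^sub>m n" and v: "v \<in> carrier_vec n"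
  shows "v \<bullet> v \<le> spectral_norm Z * (v \<bullet> (X *\<^sub>v v))"
proof (cases "v = 0\<^sub>v n")
  case True
  then show ?thesis using X Z by simp
next
  case False
  then have pos: "0 < v \<bullet> v" using vnorm_pos[OF v] by (metis vnorm_sq zero_less_power2 less_irrefl)
  have XZ: "X *\<^sub>v (Z *\<^sub>v v) = v"
    using X Z v by (metis assoc_mult_mat_vec one_mult_mat_vec)
  have Zv: "Z *\<^sub>v v \<in> carrier_vec n" using mult_mat_vec_carrier[OF Z(1) v] .
  have "(v \<bullet> v)\<^sup>2 \<le> (v \<bullet> (X *\<^sub>v v)) * ((Z *\<^sub>v v) \<bullet> v)"
    using psd_cauchy_schwarz[OF X v Zv] unfolding XZ .
  also have "\<dots> = (v \<bullet> (X *\<^sub>v v)) * (v \<bullet> (Z *\<^sub>v v))"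
    using comm_scalar_prod[OF v Zv] by simp
  also have "\<dots> \<le> (v \<bullet> (X *\<^sub>v v)) * (spectral_norm Z * (v \<bullet> v))"
    by (rule mult_left_mono[OF bilinear_le_spectral[OF Z(1) v] X(3)[OF v]])
  finally show ?thesis using pos by (simp add: power2_eq_square mult_ac)
qed

text \<open>
  The infimum \<open>\<mu>\<close> of the Rayleigh quotient is an eigenvalue. Otherwise \<open>X - \<mu> 1\<close> would be positive
  semidefinite and invertible, hence bounded below by a positive multiple of the identity
  (\<open>psd_inverse_coercive\<close>), against the choice of \<open>\<mu>\<close>.
\<close>
lemma exists_min_eigenvector:
  fixes X :: "real mat"
  assumes X: "X \<in> carrier_mat n n" "X\<^sup>T = X" and n: "0 < n"
  obtains \<mu> u where "u \<in> carrier_vec n" "u \<noteq> 0\<^sub>v n" "X *\<^sub>v u = \<mu> \<cdot>\<^sub>v u"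
    "\<And>v. v \<in> carrier_vec n \<Longrightarrow> \<mu> * (v \<bullet> v) \<le> v \<bullet> (X *\<^sub>v v)"
proof -
  define Q where "Q = (\<lambda>v. (v \<bullet> (X *\<^sub>v v)) / (v \<bullet> v))"
  define V where "V = carrier_vec n - {0\<^sub>v n :: real vec}"
  define \<mu> where "\<mu> = (INF v\<in>V. Q v)"
  have pos: "0 < v \<bullet> v" if "v \<in> V" for v
    using that vnorm_pos[of v n] unfolding V_def by (metis DiffD1 DiffD2 singletonI vnorm_sq zero_less_power2 less_irrefl)
  have Vne: "V \<noteq> {}" using n unfolding V_def by (metis DiffI empty_iff singletonD unit_vec_carrier unit_vec_nonzero)
  have bdd: "bdd_below (Q ` V)"
  proof (rule bdd_belowI2)
    fix v assume v: "v \<in> V"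
    have "\<bar>v \<bullet> (X *\<^sub>v v)\<bar> \<le> vnorm v * vnorm (X *\<^sub>v v)"
      using v X by (intro vec_cauchy_schwarz[of _ n]) (auto simp: V_def)
    also have "\<dots> \<le> vnorm v * (spectral_norm X * vnorm v)"
      using v X by (intro mult_left_mono vnorm_mult_le_spectral[of _ n n]) (auto simp: V_def)
    also have "\<dots> = spectral_norm X * (v \<bullet> v)" by (simp add: vnorm_sq[symmetric] power2_eq_square)
    finally show "- spectral_norm X \<le> Q v"
      using pos[OF v] by (simp add: Q_def field_simps)
  qed
  have low: "\<mu> * (v \<bullet> v) \<le> v \<bullet> (X *\<^sub>v v)" if v: "v \<in> carrier_vec n" for v
  proof (cases "v = 0\<^sub>v n")
    case False
    then have vV: "v \<in> V" using v by (simp add: V_def)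
    have "\<mu> \<le> Q v" unfolding \<mu>_def by (rule cINF_lower[OF bdd vV])
    then show ?thesis using pos[OF vV] by (simp add: Q_def field_simps)
  qed (use X in simp)
  define Y where "Y = X - \<mu> \<cdot>\<^sub>m 1\<^sub>m n"
  have Y: "Y \<in> carrier_mat n n" "Y\<^sup>T = Y"
  proof -
    have "(\<mu> \<cdot>\<^sub>m 1\<^sub>m n)\<^sup>T = \<mu> \<cdot>\<^sub>m 1\<^sub>m n" by (rule eq_matI) auto
    then show "Y\<^sup>T = Y" using X by (simp add: Y_def transpose_minus[of _ n n])
  qed (use X in \<open>simp add: Y_def minus_carrier_mat\<close>)
  have Yv: "Y *\<^sub>v v = X *\<^sub>v v - \<mu> \<cdot>\<^sub>v v" if "v \<in> carrier_vec n" for v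
    using that X by (simp add: Y_def minus_mult_distrib_mat_vec[of _ n n] smult_mat_mult_vec[of _ n n])
  have Yq: "v \<bullet> (Y *\<^sub>v v) = v \<bullet> (X *\<^sub>v v) - \<mu> * (v \<bullet> v)" if "v \<in> carrier_vec n" for v
    using that X by (simp add: Yv scalar_prod_minus_distrib[of _ n])
  have Y0: "0 \<le> v \<bullet> (Y *\<^sub>v v)" if "v \<in> carrier_vec n" for v
    using low[OF that] Yq[OF that] by simp
  have "\<exists>u\<in>carrier_vec n. Y *\<^sub>v u = 0\<^sub>v n \<and> u \<noteq> 0\<^sub>v n"
  proof (rule ccontr)
    assume "\<not> ?thesis"
    then have inj: "\<And>v. v \<in> carrier_vec n \<Longrightarrow> Y *\<^sub>v v = 0\<^sub>v n \<Longrightarrow> v = 0\<^sub>v n" by blast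
    note Z = minv_inverse[OF Y(1) inj]
    define c where "c = spectral_norm (minv Y)"
    have co: "v \<bullet> v \<le> c * (v \<bullet> (Y *\<^sub>v v))" if "v \<in> carrier_vec n" for v
      unfolding c_def by (rule psd_inverse_coercive[OF Y Y0 Z(1,2) that])
    obtain w where w: "w \<in> V" using Vne by blast
    have "c \<noteq> 0" using co[of w] pos[OF w] w by (auto simp: V_def)
    moreover have "0 \<le> c" unfolding c_def using spectral_norm_nonneg[OF Z(1) n] .
    ultimately have c: "0 < c" by simp
    have "\<mu> + 1 / c \<le> Q v" if v: "v \<in> V" for v
      using co[of v] Yq[of v] v pos[OF v] c by (simp add: V_def Q_def field_simps)
    then have "\<mu> + 1 / c \<le> \<mu>" unfolding \<mu>_def using Vne by (intro cINF_greatest) auto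
    then show False using c by simp
  qed
  then obtain u where u: "u \<in> carrier_vec n" "Y *\<^sub>v u = 0\<^sub>v n" "u \<noteq> 0\<^sub>v n" by blast
  have "X *\<^sub>v u = \<mu> \<cdot>\<^sub>v u"
  proof (rule eq_vecI)
    fix i assume "i < dim_vec (\<mu> \<cdot>\<^sub>v u)"
    then have i: "i < n" using u by simp
    have "(X *\<^sub>v u - \<mu> \<cdot>\<^sub>v u) $ i = 0" using u(2) Yv[OF u(1)] i by simp
    then show "(X *\<^sub>v u) $ i = (\<mu> \<cdot>\<^sub>v u) $ i" using i X u by (simp del: index_mult_mat_vec)
  qed (use X u in auto)
  with u low show thesis using that by blast
qed

text \<open>
  For positive definite \<open>X\<close> the least eigenvalue \<open>\<mu>\<close> is also a singular value, because \<open>X\<^sup>T X u = \<mu>\<^sup>2 u\<close>.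
\<close>
lemma pos_def_\<sigma>_min:
  assumes X: "pos_def n X" and n: "0 < n"
  shows "0 < \<sigma>_min X" "\<And>v. v \<in> carrier_vec n \<Longrightarrow> \<sigma>_min X * (v \<bullet> v) \<le> v \<bullet> (X *\<^sub>v v)"
proof -
  have Xc: "X \<in> carrier_mat n n" "X\<^sup>T = X" using X by (auto simp: pos_def_def)
  have XX: "X\<^sup>T * X \<in> carrier_mat n n" using Xc by simp
  obtain \<mu> u where u: "u \<in> carrier_vec n" "u \<noteq> 0\<^sub>v n" "X *\<^sub>v u = \<mu> \<cdot>\<^sub>v u"
    and low: "\<And>v. v \<in> carrier_vec n \<Longrightarrow> \<mu> * (v \<bullet> v) \<le> v \<bullet> (X *\<^sub>v v)"
    using exists_min_eigenvector[OF Xc n] by blast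
  have "0 < u \<bullet> (X *\<^sub>v u)" using X u(1,2) unfolding pos_def_def by blast
  then have "0 < \<mu> * (u \<bullet> u)" using u by simp
  then have \<mu>: "0 < \<mu>" using scalar_prod_self_nonneg[of u] by (auto simp: zero_less_mult_iff)
  have "(X\<^sup>T * X) *\<^sub>v u = \<mu>\<^sup>2 \<cdot>\<^sub>v u"
    using Xc u by (simp add: assoc_mult_mat_vec[of _ n n] mult_mat_vec[of _ n n] power2_eq_square smult_smult_assoc)
  then have mem: "\<mu> \<in> singular_values X"
    unfolding singular_values_def eigenvalue_def eigenvector_def using u \<mu> Xc by auto
  have fin: "finite (singular_values X)"
  proof -
    have "finite (spectrum (X\<^sup>T * X))" using card_finite_spectrum(1)[OF XX] .
    then have "finite (sqrt ` spectrum (X\<^sup>T * X))" by simp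
    moreover have "singular_values X \<subseteq> sqrt ` spectrum (X\<^sup>T * X)"
      unfolding singular_values_def spectrum_def by (auto intro!: image_eqI[of _ _ "_\<^sup>2"])
    ultimately show ?thesis using finite_subset by blast
  qed
  have "0 < s" if "s \<in> singular_values X" for s
  proof -
    from that obtain v where s: "0 \<le> s" and v: "v \<in> carrier_vec n" "v \<noteq> 0\<^sub>v n"
      "(X\<^sup>T * X) *\<^sub>v v = s\<^sup>2 \<cdot>\<^sub>v v"
      unfolding singular_values_def eigenvalue_def eigenvector_def using Xc by auto
    have "X *\<^sub>v v \<noteq> 0\<^sub>v n" using pos_def_inj[OF X v(1)] v(2) by auto
    then have "X *\<^sub>v (X *\<^sub>v v) \<noteq> 0\<^sub>v n" using pos_def_inj[OF X, of "X *\<^sub>v v"] Xc v by auto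
    moreover have "X *\<^sub>v (X *\<^sub>v v) = s\<^sup>2 \<cdot>\<^sub>v v"
      using v(3) Xc v(1) by (simp add: assoc_mult_mat_vec[of _ n n])
    moreover have "0 \<cdot>\<^sub>v v = 0\<^sub>v n" using v(1) by auto
    ultimately have "s \<noteq> 0" by auto
    with s show ?thesis by simp
  qed
  moreover have "Min (singular_values X) \<in> singular_values X" using mem fin by (intro Min_in) auto
  ultimately show "0 < \<sigma>_min X" unfolding \<sigma>_min_def by blast
  have "\<sigma>_min X \<le> \<mu>" unfolding \<sigma>_min_def using mem fin by simp
  then show "\<sigma>_min X * (v \<bullet> v) \<le> v \<bullet> (X *\<^sub>v v)" if "v \<in> carrier_vec n" for v
    using low[OF that] mult_right_mono[of "\<sigma>_min X" \<mu> "v \<bullet> v"] by force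
qed

lemma pos_def_nonneg:
  assumes "pos_def n X" "v \<in> carrier_vec n"
  shows "0 \<le> v \<bullet> (X *\<^sub>v v)"
proof (cases "v = 0\<^sub>v n")
  case True
  have "X *\<^sub>v v \<in> carrier_vec n" using assms by (auto simp: pos_def_def)
  then show ?thesis unfolding True by simp
next
  case False
  then show ?thesis using assms unfolding pos_def_def by (simp add: less_imp_le)
qed

lemma pos_def_minv_coercive:
  assumes X: "pos_def n X" and n: "0 < n"
  shows "0 < spectral_norm (minv X)"
    "\<And>v. v \<in> carrier_vec n \<Longrightarrow> v \<bullet> v \<le> spectral_norm (minv X) * (v \<bullet> (X *\<^sub>v v))"
proof -
  have Xc: "X \<in> carrier_mat n n" "X\<^sup>T = X" using X by (auto simp: pos_def_def)
  note Z = minv_inverse[OF Xc(1) pos_def_inj[OF X]]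
  have X0: "0 \<le> v \<bullet> (X *\<^sub>v v)" if "v \<in> carrier_vec n" for v
    using X that Xc by (cases "v = 0\<^sub>v n") (auto simp: pos_def_def less_imp_le)
  show co: "v \<bullet> v \<le> spectral_norm (minv X) * (v \<bullet> (X *\<^sub>v v))" if "v \<in> carrier_vec n" for v
    by (rule psd_inverse_coercive[OF Xc X0 Z(1,2) that])
  have "spectral_norm (minv X) \<noteq> 0"
    using co[of "unit_vec n 0"] n by auto
  then show "0 < spectral_norm (minv X)" using spectral_norm_nonneg[OF Z(1) n] by simp
qed

section \<open>The cost of a policy along noise-free trajectories\<close>

locale discounted_lqr =
  fixes P :: "'m lqr" and \<gamma> :: real
  assumes setting: "lqr_setting P" and \<gamma>_pos: "0 < \<gamma>" and \<gamma>_less_1: "\<gamma> < 1"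
begin

abbreviation "n \<equiv> dim_x P"
abbreviation "d \<equiv> dim_u P"
abbreviation "A \<equiv> mA P"
abbreviation "B \<equiv> mB P"
abbreviation "S \<equiv> mS P"
abbreviation "R \<equiv> mR P"

lemma dims [simp]: "0 < n" "0 < d" "A \<in> carrier_mat n n" "B \<in> carrier_mat n d"
    "S \<in> carrier_mat n n" "R \<in> carrier_mat d d"
  and sym [simp]: "S\<^sup>T = S" "R\<^sup>T = R"
  and pos_def_S: "pos_def n S" and pos_def_R: "pos_def d R"
  using setting by (auto simp: lqr_setting_def pos_def_def)

lemma dims' [simp]: "dim_row A = n" "dim_col A = n" "dim_row B = n" "dim_col B = d"
  "dim_row S = n" "dim_col S = n" "dim_row R = d" "dim_col R = d"
  using carrier_matD[OF dims(3)] carrier_matD[OF dims(4)] carrier_matD[OF dims(5)] carrier_matD[OF dims(6)]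
  by auto

lemma S_nonneg: "x \<in> carrier_vec n \<Longrightarrow> 0 \<le> x \<bullet> (S *\<^sub>v x)"
  by (rule pos_def_nonneg[OF pos_def_S])

lemma R_nonneg: "u \<in> carrier_vec d \<Longrightarrow> 0 \<le> u \<bullet> (R *\<^sub>v u)"
  by (rule pos_def_nonneg[OF pos_def_R])

lemma closed_loop_carrier [simp]: "policy P K \<Longrightarrow> closed_loop P K \<in> carrier_mat n n"
  by (auto simp: closed_loop_def policy_def)

lemma policy_carrier [simp]: "policy P K \<Longrightarrow> K \<in> carrier_mat d n"
  by (simp add: policy_def)

lemma policy_dims [simp]: "policy P K \<Longrightarrow> dim_row K = d" "policy P K \<Longrightarrow> dim_col K = n"
  by (auto simp: policy_def)

lemma closed_loop_mult:
  assumes "policy P K" "x \<in> carrier_vec n"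
  shows "closed_loop P K *\<^sub>v x = A *\<^sub>v x + B *\<^sub>v (K *\<^sub>v x)"
proof -
  have "closed_loop P K *\<^sub>v x = A *\<^sub>v x + (B * K) *\<^sub>v x"
    unfolding closed_loop_def using assms
    by (intro add_mult_distrib_mat_vec[of _ n n]) (auto intro!: carrier_matI)
  also have "(B * K) *\<^sub>v x = B *\<^sub>v (K *\<^sub>v x)"
    using assms by (intro assoc_mult_mat_vec[of _ n d _ n]) auto
  finally show ?thesis .
qed

definition traj :: "real mat \<Rightarrow> nat \<Rightarrow> real vec \<Rightarrow> real vec" where
  "traj K i x = (closed_loop P K ^\<^sub>m i) *\<^sub>v x"

lemma traj_carrier [simp]:
  assumes "policy P K" "x \<in> carrier_vec n"
  shows "traj K i x \<in> carrier_vec n"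
  unfolding traj_def using assms by (intro mult_mat_vec_carrier[of _ n n]) auto

lemma traj_0 [simp]: "policy P K \<Longrightarrow> x \<in> carrier_vec n \<Longrightarrow> traj K 0 x = x"
  using carrier_matD(1)[OF closed_loop_carrier] by (simp add: traj_def)

lemma traj_Suc:
  assumes "policy P K" "x \<in> carrier_vec n"
  shows "traj K (Suc i) x = traj K i (closed_loop P K *\<^sub>v x)"
  unfolding traj_def using assms by (simp add: assoc_mult_mat_vec[of _ n n _ n])

lemma traj_Suc':
  assumes "policy P K" "x \<in> carrier_vec n"
  shows "traj K (Suc i) x = closed_loop P K *\<^sub>v traj K i x"
  using assms(2)
proof (induction i arbitrary: x)
  case (Suc i)
  have "closed_loop P K *\<^sub>v x \<in> carrier_vec n"
    using assms(1) Suc.prems by (intro mult_mat_vec_carrier[of _ n n]) auto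
  from Suc.IH[OF this] show ?case using assms(1) Suc.prems by (simp add: traj_Suc)
next
  case 0
  have "closed_loop P K *\<^sub>v x \<in> carrier_vec n"
    using assms(1) 0 by (intro mult_mat_vec_carrier[of _ n n]) auto
  then show ?case using 0 assms(1) by (simp add: traj_Suc)
qed

lemma closed_loop_mult_carrier [simp]:
  "policy P K \<Longrightarrow> x \<in> carrier_vec n \<Longrightarrow> closed_loop P K *\<^sub>v x \<in> carrier_vec n"
  by (intro mult_mat_vec_carrier[of _ n n]) auto

text \<open>
  Equivalently, the objective is finite. The norm of the powers states this independently of the
  initial state and of the noise.
\<close>
definition finite_cost :: "real mat \<Rightarrow> bool" where
  "finite_cost K \<longleftrightarrow> summable (\<lambda>i. \<gamma> ^ i * (frob_norm (closed_loop P K ^\<^sub>m i))\<^sup>2)"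

lemma summable_traj:
  assumes K: "policy P K" "finite_cost K" and x: "x \<in> carrier_vec n" "y \<in> carrier_vec n"
    and N: "N \<in> carrier_mat n n"
  shows "summable (\<lambda>i. \<gamma> ^ i * (traj K i x \<bullet> (N *\<^sub>v traj K i y)))"
proof (rule summable_comparison_test')
  show "summable (\<lambda>i. \<gamma> ^ i * (frob_norm (closed_loop P K ^\<^sub>m i))\<^sup>2 * (frob_norm N * vnorm x * vnorm y))"
    using K(2) unfolding finite_cost_def by (rule summable_mult2)
  fix i :: nat
  let ?f = "frob_norm (closed_loop P K ^\<^sub>m i)"
  have le: "vnorm (traj K i z) \<le> ?f * vnorm z" if "z \<in> carrier_vec n" for z
    unfolding traj_def using K that by (intro vnorm_mult_le_frob[of _ n n]) auto
  have "\<bar>traj K i x \<bullet> (N *\<^sub>v traj K i y)\<bar> \<le> frob_norm N * vnorm (traj K i x) * vnorm (traj K i y)"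
    using K x N by (intro bilinear_le_frob[of _ n n]) auto
  also have "\<dots> \<le> frob_norm N * (?f * vnorm x) * (?f * vnorm y)"
    using x by (intro mult_mono le mult_left_mono) auto
  finally show "norm (\<gamma> ^ i * (traj K i x \<bullet> (N *\<^sub>v traj K i y))) \<le>
      \<gamma> ^ i * ?f\<^sup>2 * (frob_norm N * vnorm x * vnorm y)"
    using \<gamma>_pos by (simp add: abs_mult power2_eq_square mult_ac)
qed

lemma finite_costI:
  assumes "policy P K"
    and "\<And>x. x \<in> carrier_vec n \<Longrightarrow> summable (\<lambda>i. \<gamma> ^ i * (vnorm (traj K i x))\<^sup>2)"
  shows "finite_cost K"
proof -
  have "summable (\<lambda>i. \<Sum>j<n. \<gamma> ^ i * (vnorm (traj K i (unit_vec n j)))\<^sup>2)"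
    by (intro summable_sum assms(2)) auto
  moreover have "(\<Sum>j<n. \<gamma> ^ i * (vnorm (traj K i (unit_vec n j)))\<^sup>2) =
      \<gamma> ^ i * (frob_norm (closed_loop P K ^\<^sub>m i))\<^sup>2" for i
    using assms(1) by (simp add: frob_norm_sq_columns[of _ n n] traj_def sum_distrib_left)
  ultimately show ?thesis by (simp add: finite_cost_def)
qed

definition stage_cost :: "real mat \<Rightarrow> real vec \<Rightarrow> real" where
  "stage_cost K x = x \<bullet> (S *\<^sub>v x) + (K *\<^sub>v x) \<bullet> (R *\<^sub>v (K *\<^sub>v x))"

abbreviation stage_mat :: "real mat \<Rightarrow> real mat" where
  "stage_mat K \<equiv> S + K\<^sup>T * R * K"

lemma stage_mat_carrier [simp]: "policy P K \<Longrightarrow> stage_mat K \<in> carrier_mat n n"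
  by (auto simp: policy_def)

lemma stage_mat_bilinear:
  assumes K: "policy P K" and x: "x \<in> carrier_vec n" "y \<in> carrier_vec n"
  shows "x \<bullet> (stage_mat K *\<^sub>v y) = x \<bullet> (S *\<^sub>v y) + (K *\<^sub>v x) \<bullet> (R *\<^sub>v (K *\<^sub>v y))"
proof -
  have Kc: "K \<in> carrier_mat d n" using K by simp
  have c: "K\<^sup>T * R \<in> carrier_mat n d" "K\<^sup>T * R * K \<in> carrier_mat n n" "K *\<^sub>v y \<in> carrier_vec d"
    using Kc x by (auto intro!: carrier_matI carrier_vecI)
  have "stage_mat K *\<^sub>v y = S *\<^sub>v y + (K\<^sup>T * R * K) *\<^sub>v y"
    by (rule add_mult_distrib_mat_vec[OF dims(5) c(2) x(2)])
  also have "(K\<^sup>T * R * K) *\<^sub>v y = (K\<^sup>T * R) *\<^sub>v (K *\<^sub>v y)"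
    by (rule assoc_mult_mat_vec[OF c(1) Kc x(2)])
  also have "\<dots> = K\<^sup>T *\<^sub>v (R *\<^sub>v (K *\<^sub>v y))"
    by (rule assoc_mult_mat_vec[OF _ dims(6) c(3)]) (use Kc in simp)
  finally have "stage_mat K *\<^sub>v y = S *\<^sub>v y + K\<^sup>T *\<^sub>v (R *\<^sub>v (K *\<^sub>v y))" .
  moreover have "S *\<^sub>v y \<in> carrier_vec n" "K *\<^sub>v y \<in> carrier_vec d" "R *\<^sub>v (K *\<^sub>v y) \<in> carrier_vec d"
    "K\<^sup>T *\<^sub>v (R *\<^sub>v (K *\<^sub>v y)) \<in> carrier_vec n"
    using Kc x by (auto intro!: carrier_matI carrier_vecI)
  ultimately show ?thesis
    using x mult_transpose_move[OF Kc x(1), of "R *\<^sub>v (K *\<^sub>v y)"]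
    by (simp add: scalar_prod_add_distrib[of _ n])
qed

lemma stage_mat_quad:
  "policy P K \<Longrightarrow> x \<in> carrier_vec n \<Longrightarrow> x \<bullet> (stage_mat K *\<^sub>v x) = stage_cost K x"
  by (simp add: stage_mat_bilinear stage_cost_def)

lemma stage_mat_sym: "policy P K \<Longrightarrow> (stage_mat K)\<^sup>T = stage_mat K"
proof -
  assume "policy P K"
  then have Kc: "K \<in> carrier_mat d n" by simp
  have "(K\<^sup>T * R * K)\<^sup>T = K\<^sup>T * (K\<^sup>T * R)\<^sup>T" using Kc by (intro transpose_mult[of _ n d]) auto
  also have "(K\<^sup>T * R)\<^sup>T = R * K" using Kc by (subst transpose_mult[of _ n d]) auto
  also have "K\<^sup>T * (R * K) = K\<^sup>T * R * K" using Kc by (intro assoc_mult_mat[symmetric, of _ n d _ d _ n]) auto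
  finally show ?thesis using Kc by (subst transpose_add[of _ n n]) auto
qed

lemma stage_cost_ge:
  assumes "policy P K" "x \<in> carrier_vec n"
  shows "\<sigma>_min S * (x \<bullet> x) \<le> stage_cost K x" "x \<bullet> (S *\<^sub>v x) \<le> stage_cost K x" "0 \<le> stage_cost K x"
proof -
  have Kx: "K *\<^sub>v x \<in> carrier_vec d" using assms by (intro mult_mat_vec_carrier[of _ d n]) auto
  show "\<sigma>_min S * (x \<bullet> x) \<le> stage_cost K x" "x \<bullet> (S *\<^sub>v x) \<le> stage_cost K x" "0 \<le> stage_cost K x"
    using pos_def_\<sigma>_min(2)[OF pos_def_S dims(1) assms(2)] R_nonneg[OF Kx] S_nonneg[OF assms(2)]
    unfolding stage_cost_def by linarith+
qed

lemma P_mat_carrier [simp]: "P_mat P \<gamma> K \<in> carrier_mat n n"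
  by (simp add: P_mat_def)

lemma P_mat_dims [simp]: "dim_row (P_mat P \<gamma> K) = n" "dim_col (P_mat P \<gamma> K) = n"
  by (simp_all add: P_mat_def)

lemma P_mat_bilinear:
  assumes K: "policy P K" "finite_cost K" and x: "x \<in> carrier_vec n" "y \<in> carrier_vec n"
  shows "(\<lambda>i. \<gamma> ^ i * (traj K i x \<bullet> (stage_mat K *\<^sub>v traj K i y))) sums (x \<bullet> (P_mat P \<gamma> K *\<^sub>v y))"
proof -
  let ?L = "closed_loop P K"
  define T where "T i = (?L ^\<^sub>m i)\<^sup>T * stage_mat K * (?L ^\<^sub>m i)" for i
  have Li: "?L ^\<^sub>m i \<in> carrier_mat n n" for i using K by simp
  have Tc: "T i \<in> carrier_mat n n" for i
    unfolding T_def using Li[of i] stage_mat_carrier[OF K(1)]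
    by (intro mult_carrier_mat[of _ n n]) (simp_all only: transpose_carrier_mat)
  have bil: "u \<bullet> (T i *\<^sub>v v) = traj K i u \<bullet> (stage_mat K *\<^sub>v traj K i v)"
    if uv: "u \<in> carrier_vec n" "v \<in> carrier_vec n" for u v i
  proof -
    have Lt: "(?L ^\<^sub>m i)\<^sup>T \<in> carrier_mat n n" using Li[of i] by (simp only: transpose_carrier_mat)
    have "T i *\<^sub>v v = ((?L ^\<^sub>m i)\<^sup>T * stage_mat K) *\<^sub>v traj K i v"
      unfolding T_def traj_def
      by (rule assoc_mult_mat_vec[OF mult_carrier_mat[OF Lt stage_mat_carrier[OF K(1)]] Li uv(2)])
    also have "\<dots> = (?L ^\<^sub>m i)\<^sup>T *\<^sub>v (stage_mat K *\<^sub>v traj K i v)"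
      by (rule assoc_mult_mat_vec[OF Lt stage_mat_carrier[OF K(1)] traj_carrier[OF K(1) uv(2)]])
    finally have "T i *\<^sub>v v = (?L ^\<^sub>m i)\<^sup>T *\<^sub>v (stage_mat K *\<^sub>v traj K i v)" .
    moreover have "stage_mat K *\<^sub>v traj K i v \<in> carrier_vec n"
      using uv K by (intro mult_mat_vec_carrier[of _ n n]) auto
    ultimately show ?thesis
      using mult_transpose_move[OF Li uv(1)] by (simp add: traj_def)
  qed
  have entry: "T i $$ (a,b) = unit_vec n a \<bullet> (T i *\<^sub>v unit_vec n b)" if "a < n" "b < n" for a b i
    by (rule entry_as_bilinear[OF Tc that])
  have sum1: "(\<lambda>i. \<gamma> ^ i * T i $$ (a,b)) sums (P_mat P \<gamma> K $$ (a,b))" if ab: "a < n" "b < n" for a b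
  proof -
    have "summable (\<lambda>i. \<gamma> ^ i * T i $$ (a,b))"
      unfolding entry[OF ab] bil[OF unit_vec_carrier unit_vec_carrier]
      using K by (intro summable_traj) auto
    then show ?thesis using ab by (simp add: P_mat_def T_def summable_sums)
  qed
  have "(\<lambda>i. \<Sum>a<n. \<Sum>b<n. \<gamma> ^ i * T i $$ (a,b) * x $ a * y $ b) sums
      (\<Sum>a<n. \<Sum>b<n. P_mat P \<gamma> K $$ (a,b) * x $ a * y $ b)"
    by (intro sums_sum sums_mult2 sum1) auto
  also have "(\<Sum>a<n. \<Sum>b<n. P_mat P \<gamma> K $$ (a,b) * x $ a * y $ b) = x \<bullet> (P_mat P \<gamma> K *\<^sub>v y)"
    using x by (simp add: bilinear_as_sum[of _ n n])
  also have "(\<lambda>i. \<Sum>a<n. \<Sum>b<n. \<gamma> ^ i * T i $$ (a,b) * x $ a * y $ b) =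
      (\<lambda>i. \<gamma> ^ i * (traj K i x \<bullet> (stage_mat K *\<^sub>v traj K i y)))"
    unfolding bil[OF x, symmetric] bilinear_as_sum[OF Tc x] by (simp add: sum_distrib_left mult_ac)
  finally show ?thesis .
qed

lemma P_mat_sums:
  assumes K: "policy P K" "finite_cost K" and x: "x \<in> carrier_vec n"
  shows "(\<lambda>i. \<gamma> ^ i * stage_cost K (traj K i x)) sums (x \<bullet> (P_mat P \<gamma> K *\<^sub>v x))"
  using P_mat_bilinear[OF K x x] K x by (simp add: stage_mat_quad)

lemma P_mat_sym:
  assumes K: "policy P K" "finite_cost K"
  shows "(P_mat P \<gamma> K)\<^sup>T = P_mat P \<gamma> K"
proof (rule eq_matI)
  fix a b assume "a < dim_row (P_mat P \<gamma> K)" "b < dim_col (P_mat P \<gamma> K)"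
  then have ab: "a < n" "b < n" by auto
  have entry: "P_mat P \<gamma> K $$ (a,b) = unit_vec n a \<bullet> (P_mat P \<gamma> K *\<^sub>v unit_vec n b)" if "a < n" "b < n" for a b
    by (rule entry_as_bilinear[OF P_mat_carrier that])
  have "(\<lambda>i. \<gamma> ^ i * (traj K i (unit_vec n a) \<bullet> (stage_mat K *\<^sub>v traj K i (unit_vec n b)))) sums
      P_mat P \<gamma> K $$ (a,b)"
    unfolding entry[OF ab] by (intro P_mat_bilinear K) auto
  moreover have "(\<lambda>i. \<gamma> ^ i * (traj K i (unit_vec n a) \<bullet> (stage_mat K *\<^sub>v traj K i (unit_vec n b)))) sums
      P_mat P \<gamma> K $$ (b,a)"
    unfolding entry[OF ab(2,1)]
    using P_mat_bilinear[OF K, of "unit_vec n b" "unit_vec n a"] K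
      bilinear_sym[OF stage_mat_carrier[OF K(1)] stage_mat_sym[OF K(1)]] by simp
  ultimately have "P_mat P \<gamma> K $$ (a,b) = P_mat P \<gamma> K $$ (b,a)" by (rule sums_unique2)
  then show "(P_mat P \<gamma> K)\<^sup>T $$ (a,b) = P_mat P \<gamma> K $$ (a,b)" using ab by simp
qed auto

text \<open>
  The value function of \<open>K\<close> without the constant that the noise contributes.
\<close>
definition cost_to_go :: "real mat \<Rightarrow> real vec \<Rightarrow> real" where
  "cost_to_go K x = x \<bullet> (P_mat P \<gamma> K *\<^sub>v x)"

lemma cost_to_go_bellman:
  assumes K: "policy P K" "finite_cost K" and x: "x \<in> carrier_vec n"
  shows "cost_to_go K x = stage_cost K x + \<gamma> * cost_to_go K (closed_loop P K *\<^sub>v x)"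
proof -
  have Lx: "closed_loop P K *\<^sub>v x \<in> carrier_vec n" using K x by simp
  have "(\<lambda>i. \<gamma> * (\<gamma> ^ i * stage_cost K (traj K i (closed_loop P K *\<^sub>v x)))) sums
      (\<gamma> * cost_to_go K (closed_loop P K *\<^sub>v x))"
    unfolding cost_to_go_def by (intro sums_mult P_mat_sums K Lx)
  then have "(\<lambda>i. \<gamma> ^ Suc i * stage_cost K (traj K (Suc i) x)) sums (\<gamma> * cost_to_go K (closed_loop P K *\<^sub>v x))"
    using K x by (simp add: traj_Suc mult_ac)
  then have "(\<lambda>i. \<gamma> ^ i * stage_cost K (traj K i x)) sums
      (\<gamma> * cost_to_go K (closed_loop P K *\<^sub>v x) + \<gamma> ^ 0 * stage_cost K (traj K 0 x))"
    by (rule sums_Suc[where f = "\<lambda>i. \<gamma> ^ i * stage_cost K (traj K i x)"])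
  from sums_unique2[OF this P_mat_sums[OF K x]] show ?thesis using K x by (simp add: cost_to_go_def)
qed

lemma cost_to_go_ge_stage_cost:
  assumes K: "policy P K" "finite_cost K" and x: "x \<in> carrier_vec n"
  shows "stage_cost K x \<le> cost_to_go K x"
proof -
  have Lx: "closed_loop P K *\<^sub>v x \<in> carrier_vec n" using K x by simp
  have "0 \<le> cost_to_go K (closed_loop P K *\<^sub>v x)"
    unfolding cost_to_go_def
    by (rule sums_le[OF _ sums_zero P_mat_sums[OF K Lx]])
      (use stage_cost_ge(3)[OF K(1)] K Lx \<gamma>_pos in simp)
  then show ?thesis using cost_to_go_bellman[OF K x] \<gamma>_pos by simp
qed

lemma cost_to_go_nonneg:
  assumes K: "policy P K" "finite_cost K" and x: "x \<in> carrier_vec n"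
  shows "0 \<le> cost_to_go K x"
  using cost_to_go_ge_stage_cost[OF assms] stage_cost_ge(3)[OF K(1) x] by simp

text \<open>
  Telescope \<open>\<gamma>\<^sup>i cost_to_go K\<close> along the trajectory of \<open>K'\<close>; these terms tend to zero because \<open>K'\<close> has finite
  cost.
\<close>
lemma cost_to_go_difference:
  assumes K: "policy P K" "finite_cost K" and K': "policy P K'" "finite_cost K'" and x: "x \<in> carrier_vec n"
    and g: "\<And>z. z \<in> carrier_vec n \<Longrightarrow>
      g z = stage_cost K' z + \<gamma> * cost_to_go K (closed_loop P K' *\<^sub>v z) - cost_to_go K z"
  shows "(\<lambda>i. \<gamma> ^ i * g (traj K' i x)) sums (cost_to_go K' x - cost_to_go K x)"
proof -
  have "(\<lambda>i. \<gamma> ^ i * cost_to_go K (traj K' i x)) \<longlonglongrightarrow> 0"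
    unfolding cost_to_go_def using K' x by (intro summable_LIMSEQ_zero summable_traj) auto
  then have "(\<lambda>i. \<gamma> ^ Suc i * cost_to_go K (traj K' (Suc i) x) - \<gamma> ^ i * cost_to_go K (traj K' i x)) sums
      (0 - \<gamma> ^ 0 * cost_to_go K (traj K' 0 x))"
    by (rule telescope_sums)
  from sums_add[OF P_mat_sums[OF K' x] this]
  have "(\<lambda>i. \<gamma> ^ i * stage_cost K' (traj K' i x) +
      (\<gamma> ^ Suc i * cost_to_go K (traj K' (Suc i) x) - \<gamma> ^ i * cost_to_go K (traj K' i x))) sums
      (cost_to_go K' x - cost_to_go K x)"
    using K' x by (simp add: cost_to_go_def[of K'])
  moreover have "\<gamma> ^ i * g (traj K' i x) = \<gamma> ^ i * stage_cost K' (traj K' i x) +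
      (\<gamma> ^ Suc i * cost_to_go K (traj K' (Suc i) x) - \<gamma> ^ i * cost_to_go K (traj K' i x))" for i
    using K' x by (simp add: g traj_Suc' right_diff_distrib distrib_left mult.assoc mult.left_commute)
  ultimately show ?thesis by simp
qed

text \<open>
  Each step along the trajectory pays for \<open>w\<close> with a decrease of \<open>v\<close>, so that all partial sums stay below
  \<open>v x\<close>. Applied with the cost-to-go of one policy as \<open>v\<close> and the stage cost of another as \<open>w\<close>, this shows
  that the latter has finite cost.
\<close>
lemma lyapunov:
  assumes K': "policy P K'" and x: "x \<in> carrier_vec n"
    and v0: "\<And>z. z \<in> carrier_vec n \<Longrightarrow> 0 \<le> v z"
    and w0: "\<And>z. z \<in> carrier_vec n \<Longrightarrow> 0 \<le> w z"
    and dec: "\<And>z. z \<in> carrier_vec n \<Longrightarrow> w z + \<gamma> * v (closed_loop P K' *\<^sub>v z) \<le> v z"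
  shows "summable (\<lambda>i. \<gamma> ^ i * w (traj K' i x))" "(\<Sum>i. \<gamma> ^ i * w (traj K' i x)) \<le> v x"
proof -
  have part: "(\<Sum>i<N. \<gamma> ^ i * w (traj K' i x)) + \<gamma> ^ N * v (traj K' N x) \<le> v x" for N
  proof (induction N)
    case (Suc N)
    have "w (traj K' N x) + \<gamma> * v (traj K' (Suc N) x) \<le> v (traj K' N x)"
      unfolding traj_Suc'[OF K' x] by (rule dec[OF traj_carrier[OF K' x]])
    then have "\<gamma> ^ N * (w (traj K' N x) + \<gamma> * v (traj K' (Suc N) x)) \<le> \<gamma> ^ N * v (traj K' N x)"
      using \<gamma>_pos by (intro mult_left_mono) simp_all
    with Suc.IH show ?case by (simp add: distrib_left mult.assoc mult.left_commute)
  qed (use K' x in simp)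
  have nn: "0 \<le> \<gamma> ^ i * w (traj K' i x)" for i using w0 K' x \<gamma>_pos by simp
  have le: "(\<Sum>i<N. \<gamma> ^ i * w (traj K' i x)) \<le> v x" for N
  proof -
    have "0 \<le> \<gamma> ^ N * v (traj K' N x)"
      using v0[OF traj_carrier[OF K' x]] \<gamma>_pos by simp
    with part[of N] show ?thesis by linarith
  qed
  show *: "summable (\<lambda>i. \<gamma> ^ i * w (traj K' i x))"
    using nn le by (rule summableI_nonneg_bounded)
  show "(\<Sum>i. \<gamma> ^ i * w (traj K' i x)) \<le> v x"
    using le by (intro suminf_le_const[OF *]) auto
qed

end

section \<open>Perturbed linear systems\<close>

text \<open>
  \<open>M\<close> stretches every vector by at least \<open>1/r\<close>, and \<open>T\<close> differs from it by at most \<open>1/(2 r)\<close>.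
\<close>
lemma perturbed_system_inj:
  assumes M: "M \<in> carrier_mat d d" and T: "T \<in> carrier_mat d d"
    and co: "\<And>u. u \<in> carrier_vec d \<Longrightarrow> u \<bullet> u \<le> r * (u \<bullet> (M *\<^sub>v u))"
    and T_err: "frob_norm (T - M) \<le> e" and small: "2 * r * e \<le> 1" and r: "0 < r"
    and v: "v \<in> carrier_vec d" "T *\<^sub>v v = 0\<^sub>v d"
  shows "v = 0\<^sub>v d"
proof -
  have TM: "T - M \<in> carrier_mat d d" using M by (rule minus_carrier_mat)
  have Mv: "M *\<^sub>v v \<in> carrier_vec d" using M v by (intro mult_mat_vec_carrier[of _ d d])
  have "(T - M) *\<^sub>v v = T *\<^sub>v v - M *\<^sub>v v" by (rule minus_mult_distrib_mat_vec[OF T M v(1)])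
  then have "M *\<^sub>v v = - ((T - M) *\<^sub>v v)" using v Mv by simp
  then have "vnorm (M *\<^sub>v v) \<le> frob_norm (T - M) * vnorm v"
    using vnorm_mult_le_frob[OF TM v(1)] by simp
  also have "\<dots> \<le> e * vnorm v" using T_err by (intro mult_right_mono) simp_all
  finally have le: "vnorm (M *\<^sub>v v) \<le> e * vnorm v" .
  have "(vnorm v)\<^sup>2 \<le> r * (vnorm v * vnorm (M *\<^sub>v v))"
    using co[OF v(1)] vec_cauchy_schwarz[OF v(1) Mv] r unfolding vnorm_sq
    by (smt (verit) mult_left_mono)
  also have "\<dots> \<le> r * (vnorm v * (e * vnorm v))"
    using le r by (intro mult_left_mono) simp_all
  also have "\<dots> = r * e * (vnorm v)\<^sup>2" by (simp add: power2_eq_square)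
  also have "\<dots> \<le> 1 / 2 * (vnorm v)\<^sup>2" using small by (intro mult_right_mono) auto
  finally have "(vnorm v)\<^sup>2 \<le> 0" by simp
  then have "vnorm v = 0" by simp
  then show ?thesis using vnorm_eq_0[OF v(1)] by simp
qed

text \<open>
  The difference \<open>z = u' - u\<close> satisfies \<open>M z = - ((T - M) u' + (H - G) x)\<close>, so
  \<open>|M z| \<le> e (|x| + |u| + |z|)\<close>. Coercivity gives \<open>|z| \<le> r |M z|\<close>, and the smallness of \<open>e\<close> absorbs the last
  term. Measuring the error in the form of \<open>M\<close> keeps the norm of \<open>M\<close> out of the bound.
\<close>
lemma perturbed_system_error:
  assumes M: "M \<in> carrier_mat d d" and T: "T \<in> carrier_mat d d"
    and G: "G \<in> carrier_mat d n" and H: "H \<in> carrier_mat d n"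
    and co: "\<And>u. u \<in> carrier_vec d \<Longrightarrow> u \<bullet> u \<le> r * (u \<bullet> (M *\<^sub>v u))"
    and err: "frob_norm (T - M) \<le> e" "frob_norm (H - G) \<le> e"
    and small: "2 * r * e \<le> 1" and r: "0 < r"
    and x: "x \<in> carrier_vec n" and u: "u \<in> carrier_vec d" "M *\<^sub>v u = - (G *\<^sub>v x)"
    and u': "u' \<in> carrier_vec d" "T *\<^sub>v u' = - (H *\<^sub>v x)"
  shows "(u' - u) \<bullet> (M *\<^sub>v (u' - u)) \<le> 4 * r * e\<^sup>2 * (vnorm x + vnorm u)\<^sup>2"
proof -
  define z where "z = u' - u"
  define m where "m = vnorm (M *\<^sub>v z)"
  define a where "a = vnorm x + vnorm u"
  have z: "z \<in> carrier_vec d" using u u' by (simp add: z_def)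
  have e0: "0 \<le> e" using err(1) frob_norm_nonneg order_trans by blast
  have TM: "T - M \<in> carrier_mat d d" using M by (rule minus_carrier_mat)
  have HG: "H - G \<in> carrier_mat d n" using G by (rule minus_carrier_mat)
  have c: "M *\<^sub>v u' \<in> carrier_vec d" "M *\<^sub>v z \<in> carrier_vec d" "T *\<^sub>v u' \<in> carrier_vec d"
    "G *\<^sub>v x \<in> carrier_vec d" "H *\<^sub>v x \<in> carrier_vec d"
    using M T G H u u' x z by (auto intro: mult_mat_vec_carrier)
  have "M *\<^sub>v z = M *\<^sub>v u' - M *\<^sub>v u" unfolding z_def by (rule mult_minus_distrib_mat_vec[OF M u'(1) u(1)])
  also have "\<dots> = - ((T - M) *\<^sub>v u' + (H - G) *\<^sub>v x)"
    unfolding u(2) minus_mult_distrib_mat_vec[OF T M u'(1)] minus_mult_distrib_mat_vec[OF H G x] u'(2)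
    using carrier_vecD[OF c(1)] carrier_vecD[OF c(4)] carrier_vecD[OF c(5)]
    by (intro eq_vecI) (auto simp del: index_mult_mat_vec dim_mult_mat_vec)
  finally have "m = vnorm ((T - M) *\<^sub>v u' + (H - G) *\<^sub>v x)" by (simp add: m_def)
  also have "\<dots> \<le> vnorm ((T - M) *\<^sub>v u') + vnorm ((H - G) *\<^sub>v x)"
    using TM HG u' x by (intro vnorm_triangle[of _ d] mult_mat_vec_carrier) auto
  also have "\<dots> \<le> e * vnorm u' + e * vnorm x"
    by (intro add_mono order_trans[OF vnorm_mult_le_frob[OF TM u'(1)]]
        order_trans[OF vnorm_mult_le_frob[OF HG x]] mult_right_mono err) simp_all
  finally have m1: "m \<le> e * vnorm u' + e * vnorm x" .
  have "u' = u + z" unfolding z_def using u u' by (intro eq_vecI) auto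
  then have "vnorm u' \<le> vnorm u + vnorm z" using vnorm_triangle[OF u(1) z] by simp
  then have "e * vnorm u' \<le> e * (vnorm u + vnorm z)" using e0 by (intro mult_left_mono)
  with m1 have m2: "m \<le> e * a + e * vnorm z" by (simp add: a_def distrib_left)
  have zMz: "z \<bullet> (M *\<^sub>v z) \<le> vnorm z * m"
    using vec_cauchy_schwarz[OF z c(2)] by (simp add: m_def)
  have "vnorm z * vnorm z \<le> r * (vnorm z * m)"
    using co[OF z] zMz r by (smt (verit) mult_left_mono power2_eq_square vnorm_sq)
  then have "vnorm z * vnorm z \<le> (r * m) * vnorm z" by (simp only: mult_ac)
  then have zm: "vnorm z \<le> r * m" by (rule mult_self_le_imp_le) (use r in \<open>simp_all add: m_def\<close>)
  have "e * vnorm z \<le> e * (r * m)" using zm e0 by (rule mult_left_mono)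
  also have "\<dots> \<le> m / 2" using mult_right_mono[OF small, of m] by (simp add: m_def mult_ac)
  finally have m3: "m \<le> 2 * (e * a)" using m2 by linarith
  have m0: "0 \<le> m" by (simp add: m_def)
  have "z \<bullet> (M *\<^sub>v z) \<le> r * m * m"
    using zMz mult_right_mono[OF zm m0] by linarith
  also have "\<dots> \<le> r * (2 * (e * a)) * (2 * (e * a))"
    using m3 m0 r by (intro mult_mono) (auto simp: a_def e0)
  also have "\<dots> = 4 * r * e\<^sup>2 * a\<^sup>2" by (simp add: power2_eq_square)
  finally show ?thesis unfolding z_def a_def .
qed

section \<open>A form bounded by its trace against a positive definite matrix\<close>

definition outer :: "nat \<Rightarrow> real vec \<Rightarrow> real mat" where
  "outer n v = Matrix.mat n n (\<lambda>(i,j). v $ i * v $ j)"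

lemma outer_carrier [simp]: "outer n v \<in> carrier_mat n n" by (simp add: outer_def)

lemma outer_sym [simp]: "(outer n v)\<^sup>T = outer n v" by (rule eq_matI) (auto simp: outer_def)

lemma trace_mult_outer:
  assumes "N \<in> carrier_mat n n" "v \<in> carrier_vec n"
  shows "trace (N * outer n v) = v \<bullet> (N *\<^sub>v v)"
  using assms by (simp add: trace_mult_as_sum[of _ n] bilinear_as_sum[of _ n n] outer_def mult_ac)

lemma outer_quad:
  assumes "v \<in> carrier_vec n" "x \<in> carrier_vec n"
  shows "x \<bullet> (outer n v *\<^sub>v x) = (v \<bullet> x)\<^sup>2"
proof -
  have "x \<bullet> (outer n v *\<^sub>v x) = (\<Sum>i<n. \<Sum>j<n. (v $ i * x $ i) * (v $ j * x $ j))"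
    using assms by (subst bilinear_as_sum[of _ n n]) (auto simp: outer_def mult_ac)
  also have "\<dots> = (v \<bullet> x)\<^sup>2"
    using assms by (simp add: scalar_prod_def lessThan_atLeast0 power2_eq_square sum_product)
  finally show ?thesis .
qed

text \<open>
  By Cauchy-Schwarz, \<open>\<sigma> x x\<^sup>T \<le> (x \<bullet> x) D\<close> as quadratic forms.
\<close>
lemma quad_le_trace:
  assumes D: "D \<in> carrier_mat n n" "D\<^sup>T = D" "\<And>v. v \<in> carrier_vec n \<Longrightarrow> \<sigma> * (v \<bullet> v) \<le> v \<bullet> (D *\<^sub>v v)"
    and \<sigma>: "0 \<le> \<sigma>"
    and N: "N \<in> carrier_mat n n" "\<And>v. v \<in> carrier_vec n \<Longrightarrow> 0 \<le> v \<bullet> (N *\<^sub>v v)"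
    and x: "x \<in> carrier_vec n"
  shows "\<sigma> * (x \<bullet> (N *\<^sub>v x)) \<le> (x \<bullet> x) * trace (N * D)"
proof -
  have "trace (N * (\<sigma> \<cdot>\<^sub>m outer n x)) \<le> trace (N * ((x \<bullet> x) \<cdot>\<^sub>m D))"
  proof (rule trace_mult_mono[of _ n])
    show "(\<sigma> \<cdot>\<^sub>m outer n x)\<^sup>T = \<sigma> \<cdot>\<^sub>m outer n x" by (rule eq_matI) (auto simp: outer_def)
    show "((x \<bullet> x) \<cdot>\<^sub>m D)\<^sup>T = (x \<bullet> x) \<cdot>\<^sub>m D"
      using D(1) sym_indexD[OF D(1,2)] by (intro eq_matI) auto
    fix v :: "real vec" assume v: "v \<in> carrier_vec n"
    have "v \<bullet> ((\<sigma> \<cdot>\<^sub>m outer n x) *\<^sub>v v) = \<sigma> * (x \<bullet> v)\<^sup>2"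
      using v by (simp add: smult_mat_mult_vec[of _ n n] outer_quad x mult_mat_vec_carrier[of _ n n])
    also have "(x \<bullet> v)\<^sup>2 \<le> (x \<bullet> x) * (v \<bullet> v)"
    proof -
      have "\<bar>x \<bullet> v\<bar>\<^sup>2 \<le> (vnorm x * vnorm v)\<^sup>2"
        by (intro power_mono vec_cauchy_schwarz[OF x v]) simp
      then show ?thesis by (simp add: power_mult_distrib vnorm_sq)
    qed
    then have "\<sigma> * (x \<bullet> v)\<^sup>2 \<le> (x \<bullet> x) * (\<sigma> * (v \<bullet> v))"
      using \<sigma> mult_left_mono[of "(x \<bullet> v)\<^sup>2" "(x \<bullet> x) * (v \<bullet> v)" \<sigma>] by (simp add: mult_ac)
    also have "\<dots> \<le> (x \<bullet> x) * (v \<bullet> (D *\<^sub>v v))"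
      by (intro mult_left_mono D(3) v) simp
    also have "\<dots> = v \<bullet> (((x \<bullet> x) \<cdot>\<^sub>m D) *\<^sub>v v)"
      using v D(1) by (simp add: smult_mat_mult_vec[of _ n n] mult_mat_vec_carrier[of _ n n])
    finally show "v \<bullet> ((\<sigma> \<cdot>\<^sub>m outer n x) *\<^sub>v v) \<le> v \<bullet> (((x \<bullet> x) \<cdot>\<^sub>m D) *\<^sub>v v)" by simp
  qed (use N D in auto)
  moreover have "trace (N * (c \<cdot>\<^sub>m X)) = c * trace (N * X)" if "X \<in> carrier_mat n n" for c X
    using that N(1) by (simp add: trace_mult_as_sum[of _ n] sum_distrib_left mult_ac)
  ultimately show ?thesis
    using D(1) N(1) x by (simp add: trace_mult_outer)
qed

section \<open>Greedy actions and the excess of a policy over them\<close>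

context discounted_lqr
begin

text \<open>
  The blocks \<open>\<Theta>22\<close> and \<open>\<Theta>21\<close> of the parameters of \<open>Q\<^sub>K\<close>: half the Hessian in the action, and the mixed term.
\<close>
definition Hess :: "real mat \<Rightarrow> real mat" where
  "Hess K = R + \<gamma> \<cdot>\<^sub>m (B\<^sup>T * P_mat P \<gamma> K * B)"

definition Cross :: "real mat \<Rightarrow> real mat" where
  "Cross K = \<gamma> \<cdot>\<^sub>m (B\<^sup>T * P_mat P \<gamma> K * A)"

lemma BTP_carrier: "B\<^sup>T * P_mat P \<gamma> K \<in> carrier_mat d n" by (rule mult_carrier_mat[of _ d n, OF _ P_mat_carrier]) simp

lemma Hess_carrier [simp]: "Hess K \<in> carrier_mat d d"
  unfolding Hess_def using mult_carrier_mat[OF BTP_carrier dims(4)]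
  by (intro add_carrier_mat) (simp only: smult_carrier_mat)

lemma Cross_carrier [simp]: "Cross K \<in> carrier_mat d n"
  unfolding Cross_def using mult_carrier_mat[OF BTP_carrier dims(3)] by (simp only: smult_carrier_mat)

lemma BTP_bilinear:
  assumes C: "C \<in> carrier_mat n m" and u: "u \<in> carrier_vec d" and y: "y \<in> carrier_vec m"
  shows "u \<bullet> ((B\<^sup>T * P_mat P \<gamma> K * C) *\<^sub>v y) = (B *\<^sub>v u) \<bullet> (P_mat P \<gamma> K *\<^sub>v (C *\<^sub>v y))"
proof -
  have Cy: "C *\<^sub>v y \<in> carrier_vec n" using C y by (rule mult_mat_vec_carrier)
  have "(B\<^sup>T * P_mat P \<gamma> K * C) *\<^sub>v y = (B\<^sup>T * P_mat P \<gamma> K) *\<^sub>v (C *\<^sub>v y)"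
    by (rule assoc_mult_mat_vec[OF BTP_carrier C y])
  also have "\<dots> = B\<^sup>T *\<^sub>v (P_mat P \<gamma> K *\<^sub>v (C *\<^sub>v y))"
    by (rule assoc_mult_mat_vec[of _ d n, OF _ P_mat_carrier Cy]) simp
  finally show ?thesis
    using mult_transpose_move[OF dims(4) u mult_mat_vec_carrier[OF P_mat_carrier Cy]] by simp
qed

lemma Hess_bilinear:
  assumes u: "u \<in> carrier_vec d" "v \<in> carrier_vec d"
  shows "u \<bullet> (Hess K *\<^sub>v v) = u \<bullet> (R *\<^sub>v v) + \<gamma> * ((B *\<^sub>v u) \<bullet> (P_mat P \<gamma> K *\<^sub>v (B *\<^sub>v v)))"
proof -
  have BPB: "B\<^sup>T * P_mat P \<gamma> K * B \<in> carrier_mat d d" by (rule mult_carrier_mat[OF BTP_carrier]) simp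
  have "Hess K *\<^sub>v v = R *\<^sub>v v + (\<gamma> \<cdot>\<^sub>m (B\<^sup>T * P_mat P \<gamma> K * B)) *\<^sub>v v"
    unfolding Hess_def using BPB u by (intro add_mult_distrib_mat_vec[of _ d d]) auto
  also have "\<dots> = R *\<^sub>v v + \<gamma> \<cdot>\<^sub>v ((B\<^sup>T * P_mat P \<gamma> K * B) *\<^sub>v v)"
    using smult_mat_mult_vec[OF BPB u(2)] by simp
  finally show ?thesis
    using u mult_mat_vec_carrier[OF BPB u(2)] mult_mat_vec_carrier[OF dims(6) u(2)]
    by (simp add: scalar_prod_add_distrib[of _ d] BTP_bilinear[OF dims(4)])
qed

lemma Cross_bilinear:
  assumes u: "u \<in> carrier_vec d" and x: "x \<in> carrier_vec n"
  shows "u \<bullet> (Cross K *\<^sub>v x) = \<gamma> * ((B *\<^sub>v u) \<bullet> (P_mat P \<gamma> K *\<^sub>v (A *\<^sub>v x)))"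
proof -
  have BPA: "B\<^sup>T * P_mat P \<gamma> K * A \<in> carrier_mat d n" by (rule mult_carrier_mat[OF BTP_carrier]) simp
  show ?thesis
    unfolding Cross_def smult_mat_mult_vec[OF BPA x]
    using u mult_mat_vec_carrier[OF BPA x] by (simp add: BTP_bilinear[OF dims(3) u x])
qed

lemma Bu_carrier [simp]: "u \<in> carrier_vec d \<Longrightarrow> B *\<^sub>v u \<in> carrier_vec n"
  by (rule mult_mat_vec_carrier[OF dims(4)])

lemma Ax_carrier [simp]: "x \<in> carrier_vec n \<Longrightarrow> A *\<^sub>v x \<in> carrier_vec n"
  by (rule mult_mat_vec_carrier[OF dims(3)])

lemma Px_carrier [simp]: "x \<in> carrier_vec n \<Longrightarrow> P_mat P \<gamma> K *\<^sub>v x \<in> carrier_vec n"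
  by (rule mult_mat_vec_carrier[OF P_mat_carrier])

lemma Kx_carrier [simp]: "policy P K \<Longrightarrow> x \<in> carrier_vec n \<Longrightarrow> K *\<^sub>v x \<in> carrier_vec d"
  by (rule mult_mat_vec_carrier[OF policy_carrier])

lemma Hess_coercive:
  assumes K: "policy P K" "finite_cost K" and u: "u \<in> carrier_vec d"
  shows "u \<bullet> u \<le> spectral_norm (minv R) * (u \<bullet> (Hess K *\<^sub>v u))"
proof -
  have "0 \<le> cost_to_go K (B *\<^sub>v u)" by (rule cost_to_go_nonneg[OF K Bu_carrier[OF u]])
  then have "u \<bullet> (R *\<^sub>v u) \<le> u \<bullet> (Hess K *\<^sub>v u)"
    using \<gamma>_pos by (simp add: Hess_bilinear[OF u u] cost_to_go_def)
  then show ?thesis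
    using pos_def_minv_coercive[OF pos_def_R dims(2)] u
    by (smt (verit) mult_left_mono)
qed

lemma Hess_nonneg:
  assumes K: "policy P K" "finite_cost K" and u: "u \<in> carrier_vec d"
  shows "0 \<le> u \<bullet> (Hess K *\<^sub>v u)"
  using Hess_coercive[OF assms] pos_def_minv_coercive(1)[OF pos_def_R dims(2)]
    scalar_prod_self_nonneg[of u] by (metis mult_pos_neg not_less order_trans)

lemma Hess_sym:
  assumes K: "policy P K" "finite_cost K"
  shows "(Hess K)\<^sup>T = Hess K"
proof (rule eq_matI)
  fix i j assume "i < dim_row (Hess K)" "j < dim_col (Hess K)"
  then have ij: "i < d" "j < d" using carrier_matD[OF Hess_carrier[of K]] by auto
  have "Hess K $$ (j,i) = Hess K $$ (i,j)"
    unfolding entry_as_bilinear[OF Hess_carrier ij] entry_as_bilinear[OF Hess_carrier ij(2,1)]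
    using bilinear_sym[OF dims(6) sym(2)]
      bilinear_sym[OF P_mat_carrier P_mat_sym[OF K]] by (simp add: Hess_bilinear)
  then show "(Hess K)\<^sup>T $$ (i,j) = Hess K $$ (i,j)" using ij carrier_matD[OF Hess_carrier[of K]] by simp
qed (use carrier_matD[OF Hess_carrier[of K]] in auto)

definition greedy :: "real mat \<Rightarrow> real mat" where
  "greedy K = - (minv (Hess K) * Cross K)"

lemma Hess_inj:
  assumes K: "policy P K" "finite_cost K" and v: "v \<in> carrier_vec d" "Hess K *\<^sub>v v = 0\<^sub>v d"
  shows "v = 0\<^sub>v d"
proof -
  have "v \<bullet> v \<le> 0" using Hess_coercive[OF K v(1)] v by simp
  then have "vnorm v = 0" by (metis antisym scalar_prod_self_nonneg vnorm_def real_sqrt_zero)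
  then show ?thesis using vnorm_eq_0[OF v(1)] by simp
qed

lemma greedy:
  assumes K: "policy P K" "finite_cost K"
  shows "policy P (greedy K)"
    "\<And>x. x \<in> carrier_vec n \<Longrightarrow> Hess K *\<^sub>v (greedy K *\<^sub>v x) = - (Cross K *\<^sub>v x)"
  using minv_solve[OF Hess_carrier Cross_carrier Hess_inj[OF K]] zero_carrier_vec[of n]
  unfolding greedy_def policy_def by blast+

text \<open>
  Up to the term \<open>x \<bullet> S x\<close> and a constant, the left-hand side is \<open>Q\<^sub>K(x, u)\<close>, and \<open>us\<close> is its critical
  point as a function of \<open>u\<close>.
\<close>
lemma complete_square:
  assumes K: "policy P K" "finite_cost K" and x: "x \<in> carrier_vec n" and u: "u \<in> carrier_vec d"
    and us: "us \<in> carrier_vec d" "Hess K *\<^sub>v us = - (Cross K *\<^sub>v x)"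
  shows "u \<bullet> (R *\<^sub>v u) + \<gamma> * cost_to_go K (A *\<^sub>v x + B *\<^sub>v u) =
    \<gamma> * cost_to_go K (A *\<^sub>v x) - us \<bullet> (Hess K *\<^sub>v us) + (u - us) \<bullet> (Hess K *\<^sub>v (u - us))"
proof -
  let ?P = "P_mat P \<gamma> K" let ?H = "Hess K"
  note [simp] = mult_mat_vec_carrier[OF Hess_carrier] mult_mat_vec_carrier[OF Cross_carrier]
  have "cost_to_go K (A *\<^sub>v x + B *\<^sub>v u) =
      (A *\<^sub>v x) \<bullet> (?P *\<^sub>v (A *\<^sub>v x)) + 2 * ((B *\<^sub>v u) \<bullet> (?P *\<^sub>v (A *\<^sub>v x))) + (B *\<^sub>v u) \<bullet> (?P *\<^sub>v (B *\<^sub>v u))"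
    unfolding cost_to_go_def using x u
      bilinear_sym[OF P_mat_carrier P_mat_sym[OF K] Ax_carrier[OF x] Bu_carrier[OF u]]
    by (simp add: mult_add_distrib_mat_vec[OF P_mat_carrier] scalar_prod_add_distrib[of _ n]
        add_scalar_prod_distrib[of _ n])
  then have 1: "u \<bullet> (R *\<^sub>v u) + \<gamma> * cost_to_go K (A *\<^sub>v x + B *\<^sub>v u) =
      \<gamma> * cost_to_go K (A *\<^sub>v x) + 2 * (u \<bullet> (Cross K *\<^sub>v x)) + u \<bullet> (?H *\<^sub>v u)"
    by (simp add: Hess_bilinear[OF u u] Cross_bilinear[OF u x] cost_to_go_def distrib_left)
  have 2: "u \<bullet> (Cross K *\<^sub>v x) = - (u \<bullet> (?H *\<^sub>v us))"
    unfolding us(2) using carrier_vecD[OF mult_mat_vec_carrier[OF Cross_carrier x]] carrier_vecD[OF u]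
    by (subst scalar_prod_uminus_right) (simp_all del: dim_mult_mat_vec)
  have 3: "(u - us) \<bullet> (?H *\<^sub>v (u - us)) = u \<bullet> (?H *\<^sub>v u) - 2 * (u \<bullet> (?H *\<^sub>v us)) + us \<bullet> (?H *\<^sub>v us)"
    using u us(1) bilinear_sym[OF Hess_carrier Hess_sym[OF K] us(1) u]
    by (simp add: mult_minus_distrib_mat_vec[OF Hess_carrier] scalar_prod_minus_distrib[of _ d]
        minus_scalar_prod_distrib[of _ d])
  show ?thesis unfolding 1 2 3 by simp
qed

text \<open>
  The amount by which \<open>Q\<^sub>K(x, C x)\<close> exceeds the minimum of \<open>Q\<^sub>K(x, u)\<close> over all actions \<open>u\<close>.
\<close>
definition excess :: "real mat \<Rightarrow> real mat \<Rightarrow> real vec \<Rightarrow> real" where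
  "excess K C x = (C *\<^sub>v x - greedy K *\<^sub>v x) \<bullet> (Hess K *\<^sub>v (C *\<^sub>v x - greedy K *\<^sub>v x))"

lemma excess_nonneg:
  assumes K: "policy P K" "finite_cost K" and C: "policy P C" and x: "x \<in> carrier_vec n"
  shows "0 \<le> excess K C x"
  unfolding excess_def using x C greedy(1)[OF K] by (intro Hess_nonneg[OF K]) simp

text \<open>
  Both sides are \<open>Q\<^sub>K(x, C x) - Q\<^sub>K(x, K x)\<close>; for the right-hand side the minimum over the actions
  cancels.
\<close>
lemma advantage:
  assumes K: "policy P K" "finite_cost K" and C: "policy P C" and x: "x \<in> carrier_vec n"
  shows "stage_cost C x + \<gamma> * cost_to_go K (closed_loop P C *\<^sub>v x) - cost_to_go K x
    = excess K C x - excess K K x"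
proof -
  define us where "us = greedy K *\<^sub>v x"
  have us: "us \<in> carrier_vec d" "Hess K *\<^sub>v us = - (Cross K *\<^sub>v x)"
    using greedy[OF K] x by (auto simp: us_def)
  have "stage_cost C x + \<gamma> * cost_to_go K (closed_loop P C *\<^sub>v x) =
      x \<bullet> (S *\<^sub>v x) + \<gamma> * cost_to_go K (A *\<^sub>v x) - us \<bullet> (Hess K *\<^sub>v us) + excess K C x"
    if "policy P C" for C
    using complete_square[OF K x Kx_carrier[OF that x] us] x that
    by (simp add: stage_cost_def closed_loop_mult excess_def us_def)
  from this[OF C] this[OF K(1)] show ?thesis
    using cost_to_go_bellman[OF K x] by simp
qed

definition excess_mat :: "real mat \<Rightarrow> real mat" where
  "excess_mat K = (K - greedy K)\<^sup>T * Hess K * (K - greedy K)"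

lemma excess_mat:
  assumes K: "policy P K" "finite_cost K"
  shows "excess_mat K \<in> carrier_mat n n"
    "\<And>x. x \<in> carrier_vec n \<Longrightarrow> x \<bullet> (excess_mat K *\<^sub>v x) = excess K K x"
proof -
  let ?E = "K - greedy K"
  have E: "?E \<in> carrier_mat d n" using greedy(1)[OF K] by (intro minus_carrier_mat) simp
  have Et: "?E\<^sup>T \<in> carrier_mat n d" using E by (simp only: transpose_carrier_mat)
  have EH: "?E\<^sup>T * Hess K \<in> carrier_mat n d" by (rule mult_carrier_mat[OF Et Hess_carrier])
  show "excess_mat K \<in> carrier_mat n n" unfolding excess_mat_def by (rule mult_carrier_mat[OF EH E])
  fix x :: "real vec" assume x: "x \<in> carrier_vec n"
  have Ex: "?E *\<^sub>v x \<in> carrier_vec d" by (rule mult_mat_vec_carrier[OF E x])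
  have "excess_mat K *\<^sub>v x = ?E\<^sup>T *\<^sub>v (Hess K *\<^sub>v (?E *\<^sub>v x))"
    unfolding excess_mat_def assoc_mult_mat_vec[OF EH E x] by (rule assoc_mult_mat_vec[OF Et Hess_carrier Ex])
  then have "x \<bullet> (excess_mat K *\<^sub>v x) = (?E *\<^sub>v x) \<bullet> (Hess K *\<^sub>v (?E *\<^sub>v x))"
    using mult_transpose_move[OF E x mult_mat_vec_carrier[OF Hess_carrier Ex]] by simp
  also have "?E *\<^sub>v x = K *\<^sub>v x - greedy K *\<^sub>v x"
    using K greedy(1)[OF K] x by (intro minus_mult_distrib_mat_vec[of _ d n]) auto
  finally show "x \<bullet> (excess_mat K *\<^sub>v x) = excess K K x" unfolding excess_def .
qed

section \<open>Performance difference and policy improvement\<close>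

text \<open>
  \<open>D\<close> is the sum of the matrices \<open>w k (w k)\<^sup>T\<close>, tested against all traces.
\<close>
definition factors :: "(nat \<Rightarrow> real vec) \<Rightarrow> real mat \<Rightarrow> bool" where
  "factors w D \<longleftrightarrow> D \<in> carrier_mat n n \<and> (\<forall>k. w k \<in> carrier_vec n) \<and>
     (\<forall>N\<in>carrier_mat n n. trace (N * D) = (\<Sum>k<n. w k \<bullet> (N *\<^sub>v w k)))"

text \<open>
  The discounted sum of \<open>L\<^sup>i D (L\<^sup>T)\<^sup>i\<close>; up to a factor, this is \<open>Sigma_mat\<close>.
\<close>
definition occupancy :: "(nat \<Rightarrow> real vec) \<Rightarrow> real mat \<Rightarrow> real mat" where
  "occupancy w K = Matrix.mat n n
     (\<lambda>(a,b). \<Sum>i. \<gamma> ^ i * (\<Sum>k<n. traj K i (w k) $ a * traj K i (w k) $ b))"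

lemma occupancy_carrier [simp]: "occupancy w K \<in> carrier_mat n n"
  by (simp add: occupancy_def)

lemma occupancy_sym [simp]: "(occupancy w K)\<^sup>T = occupancy w K"
  by (rule eq_matI) (auto simp: occupancy_def mult_ac)

lemma occupancy_entry_sums:
  assumes K: "policy P K" "finite_cost K" and w: "\<And>k. w k \<in> carrier_vec n" and ab: "a < n" "b < n"
  shows "(\<lambda>i. \<gamma> ^ i * (\<Sum>k<n. traj K i (w k) $ a * traj K i (w k) $ b)) sums (occupancy w K $$ (a,b))"
proof -
  \<comment> \<open>A matrix whose form picks out one product of coordinates.\<close>
  define U :: "real mat" where "U = Matrix.mat n n (\<lambda>ij. if ij = (a,b) then 1 else 0)"
  have U: "x \<bullet> (U *\<^sub>v x) = x $ a * x $ b" if x: "x \<in> carrier_vec n" for x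
  proof -
    have "x \<bullet> (U *\<^sub>v x) = (\<Sum>i<n. \<Sum>j<n. if i = a then (if j = b then x $ i * x $ j else 0) else 0)"
      using x by (subst bilinear_as_sum[of _ n n]) (auto simp: U_def intro!: sum.cong)
    also have "\<dots> = (\<Sum>i<n. if i = a then x $ i * x $ b else 0)"
      using ab by (intro sum.cong refl) simp
    also have "\<dots> = x $ a * x $ b" using ab by simp
    finally show ?thesis .
  qed
  have "summable (\<lambda>i. \<Sum>k<n. \<gamma> ^ i * (traj K i (w k) \<bullet> (U *\<^sub>v traj K i (w k))))"
    using w by (intro summable_sum summable_traj K) (auto simp: U_def)
  then have "summable (\<lambda>i. \<gamma> ^ i * (\<Sum>k<n. traj K i (w k) $ a * traj K i (w k) $ b))"
    using K w by (simp add: U sum_distrib_left)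
  then show ?thesis using ab by (simp add: occupancy_def summable_sums)
qed

lemma trace_occupancy:
  assumes K: "policy P K" "finite_cost K" and w: "\<And>k. w k \<in> carrier_vec n" and N: "N \<in> carrier_mat n n"
  shows "(\<lambda>i. \<gamma> ^ i * (\<Sum>k<n. traj K i (w k) \<bullet> (N *\<^sub>v traj K i (w k)))) sums trace (N * occupancy w K)"
proof -
  have "(\<lambda>i. \<Sum>a<n. \<Sum>b<n. N $$ (a,b) * (\<gamma> ^ i * (\<Sum>k<n. traj K i (w k) $ b * traj K i (w k) $ a)))
      sums (\<Sum>a<n. \<Sum>b<n. N $$ (a,b) * occupancy w K $$ (b,a))"
    by (intro sums_sum sums_mult occupancy_entry_sums[OF K w]) auto
  moreover have "(\<Sum>a<n. \<Sum>b<n. N $$ (a,b) * (\<gamma> ^ i * (\<Sum>k<n. traj K i (w k) $ b * traj K i (w k) $ a))) =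
      \<gamma> ^ i * (\<Sum>k<n. traj K i (w k) \<bullet> (N *\<^sub>v traj K i (w k)))" for i
  proof -
    have "(\<Sum>k<n. traj K i (w k) \<bullet> (N *\<^sub>v traj K i (w k))) =
        (\<Sum>k<n. \<Sum>a<n. \<Sum>b<n. N $$ (a,b) * traj K i (w k) $ a * traj K i (w k) $ b)"
      using K w by (intro sum.cong refl bilinear_as_sum[OF N]) auto
    also have "\<dots> = (\<Sum>a<n. \<Sum>b<n. \<Sum>k<n. N $$ (a,b) * traj K i (w k) $ a * traj K i (w k) $ b)"
      by (subst sum.swap) (rule sum.cong[OF refl], rule sum.swap)
    finally show ?thesis by (simp add: sum_distrib_left mult_ac)
  qed
  ultimately show ?thesis by (simp add: trace_mult_as_sum[OF N])
qed

text \<open>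
  The covariance \<open>D\<close> is the first term of the series that defines the occupancy.
\<close>
lemma trace_occupancy_ge:
  assumes K: "policy P K" "finite_cost K" and w: "factors w D"
    and N: "N \<in> carrier_mat n n" "\<And>v. v \<in> carrier_vec n \<Longrightarrow> 0 \<le> v \<bullet> (N *\<^sub>v v)"
  shows "trace (N * D) \<le> trace (N * occupancy w K)"
proof -
  have wc: "w k \<in> carrier_vec n" for k using w by (simp add: factors_def)
  note s = trace_occupancy[OF K wc N(1)]
  have "(\<Sum>i\<in>{0}. \<gamma> ^ i * (\<Sum>k<n. traj K i (w k) \<bullet> (N *\<^sub>v traj K i (w k)))) \<le>
      (\<Sum>i. \<gamma> ^ i * (\<Sum>k<n. traj K i (w k) \<bullet> (N *\<^sub>v traj K i (w k))))"
    using N(2) K wc \<gamma>_pos by (intro sum_le_suminf sums_summable[OF s]) (auto intro!: mult_nonneg_nonneg sum_nonneg)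
  then show ?thesis using sums_unique[OF s] w N(1) K wc by (simp add: factors_def)
qed

lemma trace_P_mat:
  assumes w: "factors w D"
  shows "trace (P_mat P \<gamma> K * D) = (\<Sum>k<n. cost_to_go K (w k))"
  using w by (simp add: factors_def cost_to_go_def)

lemma trace_P_mat_sums:
  assumes K: "policy P K" "finite_cost K" and w: "factors w D"
  shows "(\<lambda>i. \<gamma> ^ i * (\<Sum>k<n. stage_cost K (traj K i (w k)))) sums trace (P_mat P \<gamma> K * D)"
proof -
  have wc: "w k \<in> carrier_vec n" for k using w by (simp add: factors_def)
  have "(\<lambda>i. \<Sum>k<n. \<gamma> ^ i * stage_cost K (traj K i (w k))) sums (\<Sum>k<n. w k \<bullet> (P_mat P \<gamma> K *\<^sub>v w k))"
    by (intro sums_sum P_mat_sums K wc)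
  then show ?thesis using trace_P_mat[OF w] by (simp add: sum_distrib_left cost_to_go_def)
qed

text \<open>
  Sum the advantages along the trajectories of \<open>C\<close> that start in the factors of \<open>D\<close>. The excess of \<open>K\<close> itself
  is collected in the trace.
\<close>
lemma performance_difference:
  assumes K: "policy P K" "finite_cost K" and C: "policy P C" "finite_cost C" and w: "factors w D"
  shows "(\<lambda>i. \<gamma> ^ i * (\<Sum>k<n. excess K C (traj C i (w k)))) sums
    (trace (P_mat P \<gamma> C * D) - trace (P_mat P \<gamma> K * D) + trace (excess_mat K * occupancy w C))"
proof -
  have wc: "w k \<in> carrier_vec n" for k using w by (simp add: factors_def)
  have "(\<lambda>i. \<gamma> ^ i * (excess K C (traj C i (w k)) - excess K K (traj C i (w k)))) sums
      (cost_to_go C (w k) - cost_to_go K (w k))" for k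
    by (rule cost_to_go_difference[OF K C wc]) (simp add: advantage[OF K C(1)])
  then have "(\<lambda>i. \<Sum>k<n. \<gamma> ^ i * (excess K C (traj C i (w k)) - excess K K (traj C i (w k)))) sums
      (\<Sum>k<n. cost_to_go C (w k) - cost_to_go K (w k))"
    by (intro sums_sum)
  from sums_add[OF this trace_occupancy[OF C, of w, OF wc excess_mat(1)[OF K]]]
  show ?thesis
    using C wc by (simp add: trace_P_mat[OF w] sum_subtractf excess_mat(2)[OF K]
        sum_distrib_left right_diff_distrib)
qed

text \<open>
  The excess of \<open>C\<close> in the performance difference is nonnegative. For optimal \<open>C\<close> this bounds the
  suboptimality of \<open>K\<close> by what is lost through not acting greedily.
\<close>
lemma gap_le_excess:
  assumes K: "policy P K" "finite_cost K" and C: "policy P C" "finite_cost C" and w: "factors w D"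
  shows "trace (P_mat P \<gamma> K * D) - trace (P_mat P \<gamma> C * D) \<le> trace (excess_mat K * occupancy w C)"
proof -
  have wc: "w k \<in> carrier_vec n" for k using w by (simp add: factors_def)
  have "0 \<le> trace (P_mat P \<gamma> C * D) - trace (P_mat P \<gamma> K * D) + trace (excess_mat K * occupancy w C)"
    by (rule sums_le[OF _ sums_zero performance_difference[OF assms]])
      (use excess_nonneg[OF K C(1)] C wc \<gamma>_pos in \<open>auto intro!: mult_nonneg_nonneg sum_nonneg\<close>)
  then show ?thesis by simp
qed

text \<open>
  The excess of \<open>C\<close> is at most half of its stage cost, so by the advantage identity twice the cost-to-go
  of \<open>K\<close> is a Lyapunov function for \<open>C\<close>.
\<close>
lemma near_greedy_finite_cost:
  assumes K: "policy P K" "finite_cost K" and C: "policy P C"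
    and near: "\<And>x. x \<in> carrier_vec n \<Longrightarrow> excess K C x \<le> c * (x \<bullet> x)"
    and c: "c \<le> \<sigma>_min S / 2"
  shows "finite_cost C" "\<And>x. x \<in> carrier_vec n \<Longrightarrow> cost_to_go C x \<le> 2 * cost_to_go K x"
proof -
  have half: "excess K C z \<le> stage_cost C z / 2" if z: "z \<in> carrier_vec n" for z
  proof -
    have "excess K C z \<le> c * (z \<bullet> z)" by (rule near[OF z])
    also have "\<dots> \<le> \<sigma>_min S / 2 * (z \<bullet> z)" using c by (intro mult_right_mono) simp_all
    also have "\<dots> \<le> stage_cost C z / 2" using stage_cost_ge(1)[OF C z] by simp
    finally show ?thesis .
  qed
  have dec: "stage_cost C z + \<gamma> * (2 * cost_to_go K (closed_loop P C *\<^sub>v z)) \<le> 2 * cost_to_go K z"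
    if z: "z \<in> carrier_vec n" for z
    using advantage[OF K C z] half[OF z] excess_nonneg[OF K K(1) z] by linarith
  have nn: "0 \<le> 2 * cost_to_go K z" if "z \<in> carrier_vec n" for z using cost_to_go_nonneg[OF K that] by simp
  have sm: "summable (\<lambda>i. \<gamma> ^ i * stage_cost C (traj C i x))"
    "(\<Sum>i. \<gamma> ^ i * stage_cost C (traj C i x)) \<le> 2 * cost_to_go K x" if x: "x \<in> carrier_vec n" for x
    using lyapunov[OF C x, of "\<lambda>z. 2 * cost_to_go K z" "stage_cost C"] nn dec stage_cost_ge(3)[OF C] by auto
  have s: "0 < \<sigma>_min S" by (rule pos_def_\<sigma>_min(1)[OF pos_def_S dims(1)])
  show "finite_cost C"
  proof (rule finite_costI[OF C])
    fix x :: "real vec" assume x: "x \<in> carrier_vec n"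
    show "summable (\<lambda>i. \<gamma> ^ i * (vnorm (traj C i x))\<^sup>2)"
    proof (rule summable_comparison_test')
      show "summable (\<lambda>i. (\<gamma> ^ i * stage_cost C (traj C i x)) / \<sigma>_min S)"
        by (intro summable_divide sm x)
      fix i
      have "(vnorm (traj C i x))\<^sup>2 \<le> stage_cost C (traj C i x) / \<sigma>_min S"
        using stage_cost_ge(1)[OF C traj_carrier[OF C x]] s by (simp add: vnorm_sq field_simps)
      from mult_left_mono[OF this, of "\<gamma> ^ i"] \<gamma>_pos
      show "norm (\<gamma> ^ i * (vnorm (traj C i x))\<^sup>2) \<le> (\<gamma> ^ i * stage_cost C (traj C i x)) / \<sigma>_min S"
        by simp
    qed
  qed
  then show "cost_to_go C x \<le> 2 * cost_to_go K x" if "x \<in> carrier_vec n" for x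
    using sm(2)[OF that] sums_unique[OF P_mat_sums[OF C _ that]] by (simp add: cost_to_go_def)
qed

text \<open>
  In the performance difference, the excess of \<open>C\<close> is at most \<open>c / \<sigma>_min S\<close> times its stage cost and hence sums
  to at most that multiple of its total cost, which is at most twice that of \<open>K\<close>.
\<close>
lemma near_greedy_improves:
  assumes K: "policy P K" "finite_cost K" and C: "policy P C"
    and near: "\<And>x. x \<in> carrier_vec n \<Longrightarrow> excess K C x \<le> c * (x \<bullet> x)"
    and c: "0 \<le> c" "c \<le> \<sigma>_min S / 2"
    and w: "factors w D"
  shows "trace (P_mat P \<gamma> C * D) \<le> trace (P_mat P \<gamma> K * D)
    + 2 * c / \<sigma>_min S * trace (P_mat P \<gamma> K * D) - trace (excess_mat K * D)"
proof -
  have finC: "finite_cost C" by (rule near_greedy_finite_cost(1)[OF K C near c(2)])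
  have wc: "w k \<in> carrier_vec n" for k using w by (simp add: factors_def)
  have s: "0 < \<sigma>_min S" by (rule pos_def_\<sigma>_min(1)[OF pos_def_S dims(1)])
  have le: "excess K C z \<le> c / \<sigma>_min S * stage_cost C z" if z: "z \<in> carrier_vec n" for z
  proof -
    have "excess K C z \<le> c / \<sigma>_min S * (\<sigma>_min S * (z \<bullet> z))" using near[OF z] s by simp
    also have "\<dots> \<le> c / \<sigma>_min S * stage_cost C z"
      using s c by (intro mult_left_mono stage_cost_ge(1)[OF C z]) simp
    finally show ?thesis .
  qed
  have "trace (P_mat P \<gamma> C * D) - trace (P_mat P \<gamma> K * D) + trace (excess_mat K * occupancy w C)
      \<le> c / \<sigma>_min S * trace (P_mat P \<gamma> C * D)"
  proof (rule sums_le[OF _ performance_difference[OF K C finC w] sums_mult[OF trace_P_mat_sums[OF C finC w]]])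
    fix i
    have "(\<Sum>k<n. excess K C (traj C i (w k))) \<le> c / \<sigma>_min S * (\<Sum>k<n. stage_cost C (traj C i (w k)))"
      unfolding sum_distrib_left by (intro sum_mono le traj_carrier C wc)
    from mult_left_mono[OF this, of "\<gamma> ^ i"] \<gamma>_pos
    show "\<gamma> ^ i * (\<Sum>k<n. excess K C (traj C i (w k))) \<le>
        c / \<sigma>_min S * (\<gamma> ^ i * (\<Sum>k<n. stage_cost C (traj C i (w k))))" by (simp add: mult_ac)
  qed
  moreover have "trace (P_mat P \<gamma> C * D) \<le> 2 * trace (P_mat P \<gamma> K * D)"
    unfolding trace_P_mat[OF w] sum_distrib_left
    by (intro sum_mono near_greedy_finite_cost(2)[OF K C near c(2)] wc)
  then have "c / \<sigma>_min S * trace (P_mat P \<gamma> C * D) \<le> c / \<sigma>_min S * (2 * trace (P_mat P \<gamma> K * D))"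
    using s c by (intro mult_left_mono) simp_all
  moreover have "trace (excess_mat K * D) \<le> trace (excess_mat K * occupancy w C)"
    using excess_mat[OF K] excess_nonneg[OF K K(1)] by (intro trace_occupancy_ge[OF C finC w]) auto
  moreover have "c / \<sigma>_min S * (2 * trace (P_mat P \<gamma> K * D)) = 2 * c / \<sigma>_min S * trace (P_mat P \<gamma> K * D)"
    by simp
  moreover have "a - b + e \<le> q \<Longrightarrow> q \<le> r \<Longrightarrow> t \<le> e \<Longrightarrow> r = r' \<Longrightarrow> a \<le> b + r' - t"
    for a b e q r r' t :: real by linarith
  ultimately show ?thesis by blast
qed

end

section \<open>Square integrable random vectors\<close>

definition L2 :: "'m measure \<Rightarrow> ('m \<Rightarrow> real) \<Rightarrow> bool" where
  "L2 M f \<longleftrightarrow> f \<in> borel_measurable M \<and> integrable M (\<lambda>w. (f w)\<^sup>2)"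

lemma L2_mult_integrable:
  assumes "L2 M f" "L2 M g"
  shows "integrable M (\<lambda>w. f w * g w)"
proof (rule Bochner_Integration.integrable_bound)
  show "integrable M (\<lambda>w. (f w)\<^sup>2 + (g w)\<^sup>2)" using assms by (auto simp: L2_def)
  show "(\<lambda>w. f w * g w) \<in> borel_measurable M" using assms by (auto simp: L2_def)
  have "\<bar>a * b\<bar> \<le> a\<^sup>2 + b\<^sup>2" for a b :: real
    using sum_squares_bound[of "\<bar>a\<bar>" "\<bar>b\<bar>"] abs_ge_zero[of "a * b"]
    unfolding abs_mult power2_abs by linarith
  then show "AE w in M. norm (f w * g w) \<le> norm ((f w)\<^sup>2 + (g w)\<^sup>2)" by (auto intro: order_trans)
qed

lemma L2_add:
  assumes f: "L2 M f" and g: "L2 M g"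
  shows "L2 M (\<lambda>w. f w + g w)"
proof -
  have "integrable M (\<lambda>w. (f w)\<^sup>2 + (g w)\<^sup>2 + 2 * (f w * g w))"
    using L2_mult_integrable[OF f g] f g by (auto simp: L2_def)
  then show ?thesis using f g by (auto simp: L2_def power2_sum mult.assoc)
qed

lemma L2_zero: "L2 M (\<lambda>w. 0)" by (simp add: L2_def)

lemma L2_cong: "(\<And>w. w \<in> space M \<Longrightarrow> f w = g w) \<Longrightarrow> L2 M f \<longleftrightarrow> L2 M g"
  unfolding L2_def by (intro conj_cong measurable_cong Bochner_Integration.integrable_cong) auto

text \<open>
  Square integrability is tested on linear functionals, in which the Gaussian noise is given.
\<close>
definition L2vec :: "'m measure \<Rightarrow> nat \<Rightarrow> ('m \<Rightarrow> real vec) \<Rightarrow> bool" where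
  "L2vec M k X \<longleftrightarrow> (\<forall>w\<in>space M. X w \<in> carrier_vec k) \<and> (\<forall>a\<in>carrier_vec k. L2 M (\<lambda>w. a \<bullet> X w))"

lemma L2vec_mult:
  assumes X: "L2vec M k X" and C: "C \<in> carrier_mat m k"
  shows "L2vec M m (\<lambda>w. C *\<^sub>v X w)"
  unfolding L2vec_def
proof safe
  fix w assume "w \<in> space M"
  then show "C *\<^sub>v X w \<in> carrier_vec m" using X C by (auto simp: L2vec_def intro: mult_mat_vec_carrier)
next
  fix a :: "real vec" assume a: "a \<in> carrier_vec m"
  have "C\<^sup>T *\<^sub>v a \<in> carrier_vec k" using C a by (intro mult_mat_vec_carrier[of _ k m]) auto
  then have "L2 M (\<lambda>w. (C\<^sup>T *\<^sub>v a) \<bullet> X w)" using X by (simp add: L2vec_def)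
  then show "L2 M (\<lambda>w. a \<bullet> (C *\<^sub>v X w))"
    using X C a by (subst L2_cong[where g = "\<lambda>w. (C\<^sup>T *\<^sub>v a) \<bullet> X w"])
      (auto simp: L2vec_def transpose_vec_mult_scalar[of _ m k])
qed

lemma L2vec_bilinear:
  assumes X: "L2vec M k X" and Y: "L2vec M m Y" and N: "N \<in> carrier_mat k m"
  shows "integrable M (\<lambda>w. X w \<bullet> (N *\<^sub>v Y w))"
    "integral\<^sup>L M (\<lambda>w. X w \<bullet> (N *\<^sub>v Y w)) =
      (\<Sum>i<k. \<Sum>j<m. N $$ (i,j) * integral\<^sup>L M (\<lambda>w. (unit_vec k i \<bullet> X w) * (unit_vec m j \<bullet> Y w)))"
proof -
  have eq: "X w \<bullet> (N *\<^sub>v Y w) = (\<Sum>i<k. \<Sum>j<m. N $$ (i,j) * ((unit_vec k i \<bullet> X w) * (unit_vec m j \<bullet> Y w)))"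
    if "w \<in> space M" for w
    using that X Y by (subst bilinear_as_sum[OF N]) (auto simp: L2vec_def mult_ac intro!: sum.cong)
  have int: "integrable M (\<lambda>w. (unit_vec k i \<bullet> X w) * (unit_vec m j \<bullet> Y w))" for i j
    using X Y by (intro L2_mult_integrable) (auto simp: L2vec_def)
  show "integrable M (\<lambda>w. X w \<bullet> (N *\<^sub>v Y w))"
    using int by (subst Bochner_Integration.integrable_cong[OF refl eq]) auto
  show "integral\<^sup>L M (\<lambda>w. X w \<bullet> (N *\<^sub>v Y w)) =
      (\<Sum>i<k. \<Sum>j<m. N $$ (i,j) * integral\<^sup>L M (\<lambda>w. (unit_vec k i \<bullet> X w) * (unit_vec m j \<bullet> Y w)))"
    using int by (subst Bochner_Integration.integral_cong[OF refl eq]) (auto simp: Bochner_Integration.integral_sum)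
qed

lemma integral_L2_add:
  assumes "L2 M f" "L2 M g" "L2 M h"
  shows "integral\<^sup>L M (\<lambda>w. (f w + g w) * h w) = integral\<^sup>L M (\<lambda>w. f w * h w) + integral\<^sup>L M (\<lambda>w. g w * h w)"
    "integral\<^sup>L M (\<lambda>w. h w * (f w + g w)) = integral\<^sup>L M (\<lambda>w. h w * f w) + integral\<^sup>L M (\<lambda>w. h w * g w)"
  using L2_mult_integrable[OF assms(1,3)] L2_mult_integrable[OF assms(2,3)]
    L2_mult_integrable[OF assms(3,1)] L2_mult_integrable[OF assms(3,2)]
  by (simp_all add: distrib_left distrib_right)

section \<open>Second moments of the noise\<close>

lemma (in prob_space) gaussian_functional:
  assumes X: "gaussian M k D X" and D: "pos_def k D" and a: "a \<in> carrier_vec k"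
  shows "L2 M (\<lambda>w. a \<bullet> X w)" "integrable M (\<lambda>w. a \<bullet> X w)" "expectation (\<lambda>w. a \<bullet> X w) = 0"
    "expectation (\<lambda>w. (a \<bullet> X w)\<^sup>2) = a \<bullet> (D *\<^sub>v a)"
proof -
  have "L2 M (\<lambda>w. a \<bullet> X w) \<and> integrable M (\<lambda>w. a \<bullet> X w) \<and> expectation (\<lambda>w. a \<bullet> X w) = 0 \<and>
    expectation (\<lambda>w. (a \<bullet> X w)\<^sup>2) = a \<bullet> (D *\<^sub>v a)"
  proof (cases "a = 0\<^sub>v k")
    case True
    have z: "a \<bullet> X w = 0" if "w \<in> space M" for w
      unfolding True using X that by (auto simp: gaussian_def)
    have "L2 M (\<lambda>w. a \<bullet> X w)" using L2_cong[of M "\<lambda>w. a \<bullet> X w" "\<lambda>_. 0"] z L2_zero[of M] by auto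
    moreover have "integrable M (\<lambda>w. a \<bullet> X w)"
      using Bochner_Integration.integrable_cong[OF refl z] by auto
    moreover have "expectation (\<lambda>w. a \<bullet> X w) = 0" "expectation (\<lambda>w. (a \<bullet> X w)\<^sup>2) = 0"
      using z by (auto intro: integral_eq_zero_AE)
    moreover have "a \<bullet> (D *\<^sub>v a) = 0"
      using D mult_mat_vec_carrier[of D k k a] unfolding True by (auto simp: pos_def_def)
    ultimately show ?thesis by simp
  next
    case False
    define s where "s = sqrt (a \<bullet> (D *\<^sub>v a))"
    have q: "0 < a \<bullet> (D *\<^sub>v a)" using D a False unfolding pos_def_def by blast
    then have s: "0 < s" by (simp add: s_def)
    have dist: "distributed M lborel (\<lambda>w. a \<bullet> X w) (normal_density 0 s)"
      using X a False unfolding gaussian_def s_def by blast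
    have meas: "(\<lambda>w. a \<bullet> X w) \<in> borel_measurable M"
      using distributed_measurable[OF dist] by simp
    have i2: "integrable M (\<lambda>w. (a \<bullet> X w)\<^sup>2)"
      using distributed_integrable[OF dist, of "\<lambda>x. x\<^sup>2"] integrable_normal_moment[OF s, of 0 2] by simp
    have i1: "integrable M (\<lambda>w. a \<bullet> X w)"
      using distributed_integrable[OF dist, of "\<lambda>x. x"] integrable_normal_moment[OF s, of 0 1] by simp
    have e: "expectation (\<lambda>w. a \<bullet> X w) = 0" by (rule normal_distributed_expectation[OF s dist])
    have "variance (\<lambda>w. a \<bullet> X w) = s\<^sup>2" by (rule normal_distributed_variance[OF s dist])
    with e q show ?thesis using meas i1 i2 by (simp add: L2_def s_def)
  qed
  then show "L2 M (\<lambda>w. a \<bullet> X w)" "integrable M (\<lambda>w. a \<bullet> X w)" "expectation (\<lambda>w. a \<bullet> X w) = 0"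
    "expectation (\<lambda>w. (a \<bullet> X w)\<^sup>2) = a \<bullet> (D *\<^sub>v a)" by auto
qed

text \<open>
  Polarisation of the variances of the linear functionals.
\<close>
lemma (in prob_space) gaussian_covariance:
  assumes X: "gaussian M k D X" and D: "pos_def k D" and a: "a \<in> carrier_vec k" and b: "b \<in> carrier_vec k"
  shows "expectation (\<lambda>w. (a \<bullet> X w) * (b \<bullet> X w)) = a \<bullet> (D *\<^sub>v b)"
proof -
  have Dc: "D \<in> carrier_mat k k" "D\<^sup>T = D" using D by (auto simp: pos_def_def)
  have ab: "a + b \<in> carrier_vec k" using a b by simp
  note ga = gaussian_functional[OF X D a] and gb = gaussian_functional[OF X D b]
  have "expectation (\<lambda>w. ((a + b) \<bullet> X w)\<^sup>2) =
      expectation (\<lambda>w. (a \<bullet> X w)\<^sup>2 + (b \<bullet> X w)\<^sup>2 + 2 * ((a \<bullet> X w) * (b \<bullet> X w)))"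
    using X a b by (intro Bochner_Integration.integral_cong)
      (auto simp: gaussian_def add_scalar_prod_distrib[of _ k] power2_sum)
  also have "\<dots> = a \<bullet> (D *\<^sub>v a) + b \<bullet> (D *\<^sub>v b) + 2 * expectation (\<lambda>w. (a \<bullet> X w) * (b \<bullet> X w))"
    using ga gb L2_mult_integrable[OF ga(1) gb(1)] by (simp add: L2_def)
  finally have "(a + b) \<bullet> (D *\<^sub>v (a + b)) =
      a \<bullet> (D *\<^sub>v a) + b \<bullet> (D *\<^sub>v b) + 2 * expectation (\<lambda>w. (a \<bullet> X w) * (b \<bullet> X w))"
    using gaussian_functional(4)[OF X D ab] by simp
  moreover have "(a + b) \<bullet> (D *\<^sub>v (a + b)) = a \<bullet> (D *\<^sub>v a) + b \<bullet> (D *\<^sub>v b) + 2 * (a \<bullet> (D *\<^sub>v b))"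
    using a b mult_mat_vec_carrier[OF Dc(1)] bilinear_sym[OF Dc b a]
    by (simp add: mult_add_distrib_mat_vec[OF Dc(1)] scalar_prod_add_distrib[of _ k] add_scalar_prod_distrib[of _ k])
  ultimately show ?thesis by simp
qed

context discounted_lqr
begin

abbreviation "M \<equiv> prob_sp P"

text \<open>
  Both families of noises as one, over the disjoint sum that indexes the independence assumption.
\<close>
definition noise :: "nat + nat \<Rightarrow> 'm \<Rightarrow> real vec" where
  "noise = case_sum (\<omega>_noise P) (\<eta>_noise P)"

definition noise_dim :: "nat + nat \<Rightarrow> nat" where
  "noise_dim = case_sum (\<lambda>_. n) (\<lambda>_. d)"

definition noise_cov :: "nat + nat \<Rightarrow> real mat" where
  "noise_cov = case_sum (\<lambda>_. D\<omega> P) (\<lambda>_. (sigma P)\<^sup>2 \<cdot>\<^sub>m 1\<^sub>m d)"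

definition noise_time :: "nat + nat \<Rightarrow> nat" where
  "noise_time = case_sum (\<lambda>t. t) (\<lambda>t. t)"

lemma prob_space_M: "prob_space M" using setting by (simp add: lqr_setting_def)

sublocale prob_space M by (rule prob_space_M)

lemma sigma_pos: "0 < sigma P" and pos_def_D\<omega>: "pos_def n (D\<omega> P)"
  using setting by (auto simp: lqr_setting_def)

lemma D\<omega>_carrier [simp]: "D\<omega> P \<in> carrier_mat n n" using pos_def_D\<omega> by (simp add: pos_def_def)

lemma scaled_identity_bilinear:
  assumes "a \<in> carrier_vec k" "b \<in> carrier_vec k"
  shows "a \<bullet> ((c \<cdot>\<^sub>m 1\<^sub>m k) *\<^sub>v b) = c * (a \<bullet> (b :: real vec))"
  using assms by (simp add: smult_mat_mult_vec[of _ k k])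

lemma pos_def_noise_cov: "pos_def (noise_dim s) (noise_cov s)"
proof (cases s)
  case (Inr t)
  have "0 < v \<bullet> (((sigma P)\<^sup>2 \<cdot>\<^sub>m 1\<^sub>m d) *\<^sub>v v)" if v: "v \<in> carrier_vec d" "v \<noteq> 0\<^sub>v d" for v
  proof -
    have "0 < (vnorm v)\<^sup>2" using vnorm_pos[OF v] by simp
    then show ?thesis using sigma_pos v by (simp add: scaled_identity_bilinear vnorm_sq)
  qed
  moreover have "((sigma P)\<^sup>2 \<cdot>\<^sub>m 1\<^sub>m d)\<^sup>T = (sigma P)\<^sup>2 \<cdot>\<^sub>m 1\<^sub>m d" by (rule eq_matI) auto
  ultimately show ?thesis using Inr by (simp add: noise_dim_def noise_cov_def pos_def_def)
qed (use pos_def_D\<omega> in \<open>simp add: noise_dim_def noise_cov_def\<close>)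

lemma gaussian_noise: "gaussian M (noise_dim s) (noise_cov s) (noise s)"
  using setting by (cases s) (auto simp: lqr_setting_def noise_def noise_dim_def noise_cov_def)

lemma L2vec_noise: "L2vec M (noise_dim s) (noise s)"
  using gaussian_functional(1)[OF gaussian_noise pos_def_noise_cov] gaussian_noise[of s]
  by (auto simp: L2vec_def gaussian_def)

lemma noise_covariance:
  "a \<in> carrier_vec (noise_dim s) \<Longrightarrow> b \<in> carrier_vec (noise_dim s) \<Longrightarrow>
    expectation (\<lambda>w. (a \<bullet> noise s w) * (b \<bullet> noise s w)) = a \<bullet> (noise_cov s *\<^sub>v b)"
  by (rule gaussian_covariance[OF gaussian_noise pos_def_noise_cov])

text \<open>
  Independence turns the expectation into a product of expectations, each of which is zero.
\<close>
lemma noise_uncorrelated: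
  assumes ss: "s \<noteq> s'" and a: "a \<in> carrier_vec (noise_dim s)" and b: "b \<in> carrier_vec (noise_dim s')"
  shows "expectation (\<lambda>w. (a \<bullet> noise s w) * (b \<bullet> noise s' w)) = 0"
proof -
  have ind: "indep_vars (\<lambda>s. Pi\<^sub>M {..<noise_dim s} (\<lambda>_. borel)) (\<lambda>s w. components (noise_dim s) (noise s w)) UNIV"
  proof -
    have "(\<lambda>s. Pi\<^sub>M {..<noise_dim s} (\<lambda>_. borel :: real measure)) =
        case_sum (\<lambda>t::nat. Pi\<^sub>M {..<n} (\<lambda>_. borel)) (\<lambda>t::nat. Pi\<^sub>M {..<d} (\<lambda>_. borel))"
      by (auto simp: noise_dim_def fun_eq_iff split: sum.splits)
    moreover have "(\<lambda>s w. components (noise_dim s) (noise s w)) =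
       case_sum (\<lambda>t w. components n (\<omega>_noise P t w)) (\<lambda>t w. components d (\<eta>_noise P t w))"
      by (auto simp: noise_dim_def noise_def fun_eq_iff split: sum.splits)
    ultimately show ?thesis using setting by (simp add: lqr_setting_def)
  qed
  define c where "c r = (if r = s then a else b)" for r
  define f where "f r v = (\<Sum>i<noise_dim r. c r $ i * v i)" for r and v :: "nat \<Rightarrow> real"
  have "indep_vars (\<lambda>_. borel) (\<lambda>r w. f r (components (noise_dim r) (noise r w))) {s, s'}"
  proof (rule indep_vars_compose2[OF indep_vars_subset[OF ind]])
    show "f r \<in> measurable (Pi\<^sub>M {..<noise_dim r} (\<lambda>_. borel)) borel" for r
      unfolding f_def by measurable
  qed simp
  moreover have fc: "f r (components (noise_dim r) (noise r w)) = c r \<bullet> noise r w"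
    if "w \<in> space M" for r w
    using that gaussian_noise[of r]
    by (auto simp: f_def components_def scalar_prod_def gaussian_def lessThan_atLeast0)
  have cc: "c r \<in> carrier_vec (noise_dim r)" if "r \<in> {s, s'}" for r using that a b ss by (auto simp: c_def)
  have c_int: "integrable M (\<lambda>w. f r (components (noise_dim r) (noise r w)))"
    "expectation (\<lambda>w. f r (components (noise_dim r) (noise r w))) = 0" if "r \<in> {s, s'}" for r
  proof -
    note g = gaussian_functional(2,3)[OF gaussian_noise pos_def_noise_cov cc[OF that]]
    show "integrable M (\<lambda>w. f r (components (noise_dim r) (noise r w)))"
      using g(1) by (subst Bochner_Integration.integrable_cong[OF refl fc])
    show "expectation (\<lambda>w. f r (components (noise_dim r) (noise r w))) = 0"
      using g(2) by (subst Bochner_Integration.integral_cong[OF refl fc])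
  qed
  ultimately have "expectation (\<lambda>w. \<Prod>r\<in>{s,s'}. f r (components (noise_dim r) (noise r w))) =
      (\<Prod>r\<in>{s,s'}. expectation (\<lambda>w. f r (components (noise_dim r) (noise r w))))"
    by (intro indep_vars_lebesgue_integral) (auto intro: c_int)
  also have "\<dots> = 0" using c_int(2) by (intro prod_zero) auto
  also have "expectation (\<lambda>w. \<Prod>r\<in>{s,s'}. f r (components (noise_dim r) (noise r w))) =
      expectation (\<lambda>w. (a \<bullet> noise s w) * (b \<bullet> noise s' w))"
    using ss by (intro Bochner_Integration.integral_cong) (auto simp: fc c_def)
  finally show ?thesis .
qed

lemma Bt_carrier [simp]: "y \<in> carrier_vec n \<Longrightarrow> B\<^sup>T *\<^sub>v y \<in> carrier_vec d"
  by (rule mult_mat_vec_carrier[of _ d n]) auto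

lemma noise_carrier:
  "w \<in> space M \<Longrightarrow> \<omega>_noise P t w \<in> carrier_vec n" "w \<in> space M \<Longrightarrow> \<eta>_noise P t w \<in> carrier_vec d"
  using setting by (auto simp: lqr_setting_def gaussian_def)

lemma \<omega>_tilde_dot:
  assumes "w \<in> space M" "y \<in> carrier_vec n"
  shows "y \<bullet> \<omega>_tilde P t w = (B\<^sup>T *\<^sub>v y) \<bullet> noise (Inr t) w + y \<bullet> noise (Inl t) w"
  using assms noise_carrier[OF assms(1)]
  by (simp add: \<omega>_tilde_def noise_def scalar_prod_add_distrib[of _ n] transpose_vec_mult_scalar[of _ n d])

lemma L2_noise_dots:
  "y \<in> carrier_vec d \<Longrightarrow> L2 M (\<lambda>w. y \<bullet> noise (Inr t) w)"
  "x \<in> carrier_vec n \<Longrightarrow> L2 M (\<lambda>w. x \<bullet> noise (Inl t) w)"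
  using L2vec_noise[of "Inr t"] L2vec_noise[of "Inl t"] by (auto simp: L2vec_def noise_dim_def)

lemma \<omega>_tilde_L2: "y \<in> carrier_vec n \<Longrightarrow> L2 M (\<lambda>w. y \<bullet> \<omega>_tilde P t w)"
  by (subst L2_cong[OF \<omega>_tilde_dot]) (auto intro!: L2_add L2_noise_dots)

lemma \<omega>_tilde_cov:
  assumes y: "y \<in> carrier_vec n" and z: "z \<in> carrier_vec n"
  shows "expectation (\<lambda>w. (y \<bullet> \<omega>_tilde P t w) * (z \<bullet> \<omega>_tilde P t w)) =
    (sigma P)\<^sup>2 * ((B\<^sup>T *\<^sub>v y) \<bullet> (B\<^sup>T *\<^sub>v z)) + y \<bullet> (D\<omega> P *\<^sub>v z)"
proof -
  let ?a = "\<lambda>y w. (B\<^sup>T *\<^sub>v y) \<bullet> noise (Inr t) w" and ?b = "\<lambda>y w. y \<bullet> noise (Inl t) w"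
  have "expectation (\<lambda>w. (y \<bullet> \<omega>_tilde P t w) * (z \<bullet> \<omega>_tilde P t w)) =
      expectation (\<lambda>w. (?a y w + ?b y w) * (?a z w + ?b z w))"
    using y z by (intro Bochner_Integration.integral_cong) (auto simp: \<omega>_tilde_dot)
  also have "\<dots> = expectation (\<lambda>w. ?a y w * ?a z w) + expectation (\<lambda>w. ?a y w * ?b z w) +
      (expectation (\<lambda>w. ?b y w * ?a z w) + expectation (\<lambda>w. ?b y w * ?b z w))"
    using y z by (subst integral_L2_add(1); (subst integral_L2_add(2))?; (subst integral_L2_add(2))?)
      (auto intro!: L2_add L2_noise_dots)
  also have "\<dots> = (sigma P)\<^sup>2 * ((B\<^sup>T *\<^sub>v y) \<bullet> (B\<^sup>T *\<^sub>v z)) + y \<bullet> (D\<omega> P *\<^sub>v z)"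
    using y z noise_covariance[of "B\<^sup>T *\<^sub>v y" "Inr t" "B\<^sup>T *\<^sub>v z"] noise_covariance[of y "Inl t" z]
      noise_uncorrelated[of "Inr t" "Inl t" "B\<^sup>T *\<^sub>v y" z] noise_uncorrelated[of "Inl t" "Inr t" y "B\<^sup>T *\<^sub>v z"]
    by (simp add: noise_dim_def noise_cov_def scaled_identity_bilinear)
  finally show ?thesis .
qed

lemma \<omega>_tilde_carrier: "w \<in> space M \<Longrightarrow> \<omega>_tilde P t w \<in> carrier_vec n"
  using noise_carrier[of w t] by (simp add: \<omega>_tilde_def)

lemma D\<omega>_tilde_carrier [simp]: "D\<omega>_tilde P \<in> carrier_mat n n"
  by (simp add: D\<omega>_tilde_def second_moment_def)

lemma D\<omega>_tilde_bilinear: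
  assumes y: "y \<in> carrier_vec n" and z: "z \<in> carrier_vec n"
  shows "y \<bullet> (D\<omega>_tilde P *\<^sub>v z) = (sigma P)\<^sup>2 * ((B\<^sup>T *\<^sub>v y) \<bullet> (B\<^sup>T *\<^sub>v z)) + y \<bullet> (D\<omega> P *\<^sub>v z)"
proof -
  let ?E = "(sigma P)\<^sup>2 \<cdot>\<^sub>m (B * B\<^sup>T) + D\<omega> P"
  have BB: "B * B\<^sup>T \<in> carrier_mat n n" by (rule mult_carrier_mat[of _ n d]) auto
  have E: "?E \<in> carrier_mat n n" using BB by simp
  have bil: "y \<bullet> (?E *\<^sub>v z) = (sigma P)\<^sup>2 * ((B\<^sup>T *\<^sub>v y) \<bullet> (B\<^sup>T *\<^sub>v z)) + y \<bullet> (D\<omega> P *\<^sub>v z)"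
    if y: "y \<in> carrier_vec n" and z: "z \<in> carrier_vec n" for y z
  proof -
    have "?E *\<^sub>v z = ((sigma P)\<^sup>2 \<cdot>\<^sub>m (B * B\<^sup>T)) *\<^sub>v z + D\<omega> P *\<^sub>v z"
      using BB z by (intro add_mult_distrib_mat_vec[of _ n n]) auto
    also have "((sigma P)\<^sup>2 \<cdot>\<^sub>m (B * B\<^sup>T)) *\<^sub>v z = (sigma P)\<^sup>2 \<cdot>\<^sub>v ((B * B\<^sup>T) *\<^sub>v z)"
      by (rule smult_mat_mult_vec[OF BB z])
    also have "(B * B\<^sup>T) *\<^sub>v z = B *\<^sub>v (B\<^sup>T *\<^sub>v z)"
      using z by (intro assoc_mult_mat_vec[of _ n d _ n]) auto
    finally show ?thesis
      using y z mult_mat_vec_carrier[OF D\<omega>_carrier z] Bt_carrier[OF z]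
      by (simp add: scalar_prod_add_distrib[of _ n] transpose_vec_mult_scalar[of _ n d])
  qed
  have "D\<omega>_tilde P = ?E"
  proof (rule eq_matI)
    fix i j assume "i < dim_row ?E" "j < dim_col ?E"
    then have ij: "i < n" "j < n" unfolding carrier_matD[OF E] by auto
    have "D\<omega>_tilde P $$ (i,j) = expectation (\<lambda>w. (unit_vec n i \<bullet> \<omega>_tilde P 0 w) * (unit_vec n j \<bullet> \<omega>_tilde P 0 w))"
      using ij \<omega>_tilde_carrier
      by (auto simp: D\<omega>_tilde_def second_moment_def intro!: Bochner_Integration.integral_cong)
    also have "\<dots> = ?E $$ (i,j)"
      unfolding entry_as_bilinear[OF E ij] by (subst \<omega>_tilde_cov) (simp_all only: bil unit_vec_carrier)
    finally show "D\<omega>_tilde P $$ (i,j) = ?E $$ (i,j)" .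
  qed (simp_all only: carrier_matD[OF E] carrier_matD[OF D\<omega>_tilde_carrier])
  then show ?thesis using bil[OF y z] by simp
qed

lemma D\<omega>_tilde_sym: "(D\<omega>_tilde P)\<^sup>T = D\<omega>_tilde P"
  by (rule eq_matI) (auto simp: D\<omega>_tilde_def second_moment_def mult_ac)

lemma pos_def_D\<omega>_tilde: "pos_def n (D\<omega>_tilde P)"
  unfolding pos_def_def
proof (intro conjI ballI impI)
  fix v :: "real vec" assume v: "v \<in> carrier_vec n" "v \<noteq> 0\<^sub>v n"
  have "0 < v \<bullet> (D\<omega> P *\<^sub>v v)" using pos_def_D\<omega> v unfolding pos_def_def by blast
  moreover have "0 \<le> (sigma P)\<^sup>2 * ((B\<^sup>T *\<^sub>v v) \<bullet> (B\<^sup>T *\<^sub>v v))" by simp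
  ultimately show "0 < v \<bullet> (D\<omega>_tilde P *\<^sub>v v)" unfolding D\<omega>_tilde_bilinear[OF v(1) v(1)] by linarith
qed (simp_all add: D\<omega>_tilde_sym)

lemma factors_exist: "\<exists>w. factors w (D\<omega>_tilde P)"
proof -
  have "0 \<le> v \<bullet> (D\<omega>_tilde P *\<^sub>v v)" if "v \<in> carrier_vec n" for v
    by (rule pos_def_nonneg[OF pos_def_D\<omega>_tilde that])
  from psd_factor[OF D\<omega>_tilde_carrier D\<omega>_tilde_sym this] show ?thesis
    unfolding factors_def by (metis D\<omega>_tilde_carrier)
qed

lemma factors_bilinear:
  assumes w: "factors w D" and y: "y \<in> carrier_vec n" and z: "z \<in> carrier_vec n"
  shows "y \<bullet> (D *\<^sub>v z) = (\<Sum>k<n. (y \<bullet> w k) * (z \<bullet> w k))"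
proof -
  have D: "D \<in> carrier_mat n n" and wc: "\<And>k. w k \<in> carrier_vec n" using w by (auto simp: factors_def)
  define N where "N = Matrix.mat n n (\<lambda>(i,j). z $ i * y $ j)"
  have N: "N \<in> carrier_mat n n" by (simp add: N_def)
  have "trace (N * D) = (\<Sum>i<n. \<Sum>j<n. D $$ (j,i) * y $ j * z $ i)"
    unfolding trace_mult_as_sum[OF N D] by (intro sum.cong refl) (simp add: N_def)
  also have "\<dots> = y \<bullet> (D *\<^sub>v z)" unfolding bilinear_as_sum[OF D y z] by (rule sum.swap)
  finally have "y \<bullet> (D *\<^sub>v z) = (\<Sum>k<n. w k \<bullet> (N *\<^sub>v w k))" using w N by (simp add: factors_def)
  moreover have "w k \<bullet> (N *\<^sub>v w k) = (y \<bullet> w k) * (z \<bullet> w k)" for k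
  proof -
    have "w k \<bullet> (N *\<^sub>v w k) = (\<Sum>i<n. \<Sum>j<n. (z $ i * w k $ i) * (y $ j * w k $ j))"
      unfolding bilinear_as_sum[OF N wc wc] by (intro sum.cong refl) (simp add: N_def)
    also have "\<dots> = (z \<bullet> w k) * (y \<bullet> w k)"
      using y z wc[of k] by (simp add: scalar_prod_def lessThan_atLeast0 sum_product)
    finally show ?thesis by (simp add: mult.commute)
  qed
  ultimately show ?thesis by simp
qed

section \<open>Second moments of the state and the expected cost\<close>

lemma state_carrier: "policy P K \<Longrightarrow> w \<in> space M \<Longrightarrow> state P K t w \<in> carrier_vec n"
proof (induction t)
  case (Suc t)
  have "K *\<^sub>v state P K t w + \<eta>_noise P t w \<in> carrier_vec d" using noise_carrier[of w t] Suc by simp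
  then show ?case using Suc noise_carrier[of w t] by simp
qed simp

lemma state_Suc:
  assumes K: "policy P K" and w: "w \<in> space M"
  shows "state P K (Suc t) w = closed_loop P K *\<^sub>v state P K t w + \<omega>_tilde P t w"
proof -
  note x = state_carrier[OF K w, of t] and nc = noise_carrier[OF w, of t]
  have Kx: "K *\<^sub>v state P K t w \<in> carrier_vec d" using K x by simp
  have "B *\<^sub>v (K *\<^sub>v state P K t w + \<eta>_noise P t w) = B *\<^sub>v (K *\<^sub>v state P K t w) + B *\<^sub>v \<eta>_noise P t w"
    by (rule mult_add_distrib_mat_vec[OF dims(4) Kx nc(2)])
  then show ?thesis
    using Ax_carrier[OF x] Bu_carrier[OF Kx] Bu_carrier[OF nc(2)] nc(1)
    by (simp add: closed_loop_mult[OF K x] \<omega>_tilde_def assoc_add_vec[of _ n] del: dims)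
qed

lemma closed_loop_transpose_carrier [simp]:
  "policy P K \<Longrightarrow> y \<in> carrier_vec n \<Longrightarrow> (closed_loop P K)\<^sup>T *\<^sub>v y \<in> carrier_vec n"
  by (rule mult_mat_vec_carrier[of _ n n]) auto

lemma state_Suc_dot:
  assumes K: "policy P K" and w: "w \<in> space M" and y: "y \<in> carrier_vec n"
  shows "y \<bullet> state P K (Suc t) w = ((closed_loop P K)\<^sup>T *\<^sub>v y) \<bullet> state P K t w + y \<bullet> \<omega>_tilde P t w"
  unfolding state_Suc[OF K w] using state_carrier[OF K w, of t] \<omega>_tilde_carrier[OF w, of t] y K
  by (simp add: scalar_prod_add_distrib[of _ n] transpose_vec_mult_scalar[of _ n n])

lemma state_L2: "policy P K \<Longrightarrow> y \<in> carrier_vec n \<Longrightarrow> L2 M (\<lambda>w. y \<bullet> state P K t w)"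
proof (induction t arbitrary: y)
  case 0
  then show ?case by (simp add: L2_zero)
next
  case (Suc t)
  then show ?case
    by (subst L2_cong[OF state_Suc_dot]) (auto intro!: L2_add \<omega>_tilde_L2 simp del: state.simps)
qed

lemma L2vec_state: "policy P K \<Longrightarrow> L2vec M n (state P K t)"
  using state_L2 state_carrier by (simp add: L2vec_def)

lemma noise_\<omega>_tilde_uncorrelated:
  assumes y: "y \<in> carrier_vec n" and b: "b \<in> carrier_vec (noise_dim s)" and t: "t < noise_time s"
  shows "expectation (\<lambda>w. (y \<bullet> \<omega>_tilde P t w) * (b \<bullet> noise s w)) = 0"
proof -
  have ne: "Inr t \<noteq> s" "Inl t \<noteq> s" using t by (auto simp: noise_time_def)
  have L: "L2 M (\<lambda>w. b \<bullet> noise s w)" using L2vec_noise[of s] b by (simp add: L2vec_def)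
  have "expectation (\<lambda>w. (y \<bullet> \<omega>_tilde P t w) * (b \<bullet> noise s w)) =
      expectation (\<lambda>w. ((B\<^sup>T *\<^sub>v y) \<bullet> noise (Inr t) w + y \<bullet> noise (Inl t) w) * (b \<bullet> noise s w))"
    using y by (intro Bochner_Integration.integral_cong) (auto simp: \<omega>_tilde_dot)
  also have "\<dots> = 0"
    using y b noise_uncorrelated[OF ne(1), of "B\<^sup>T *\<^sub>v y" b] noise_uncorrelated[OF ne(2), of y b]
    by (subst integral_L2_add(1)) (auto intro!: L2_noise_dots L simp: noise_dim_def)
  finally show ?thesis .
qed

text \<open>
  The state at time \<open>t\<close> is a linear combination of noises of earlier times.
\<close>
lemma state_noise_uncorrelated:
  assumes K: "policy P K" and y: "y \<in> carrier_vec n" and b: "b \<in> carrier_vec (noise_dim s)" and t: "t \<le> noise_time s"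
  shows "expectation (\<lambda>w. (y \<bullet> state P K t w) * (b \<bullet> noise s w)) = 0"
  using y t
proof (induction t arbitrary: y)
  case (Suc t)
  have L: "L2 M (\<lambda>w. b \<bullet> noise s w)" using L2vec_noise[of s] b by (simp add: L2vec_def)
  have "expectation (\<lambda>w. (y \<bullet> state P K (Suc t) w) * (b \<bullet> noise s w)) =
      expectation (\<lambda>w. (((closed_loop P K)\<^sup>T *\<^sub>v y) \<bullet> state P K t w + y \<bullet> \<omega>_tilde P t w) * (b \<bullet> noise s w))"
    using Suc.prems K by (intro Bochner_Integration.integral_cong) (auto simp: state_Suc_dot simp del: state.simps)
  also have "\<dots> = 0"
    using Suc K noise_\<omega>_tilde_uncorrelated[OF Suc.prems(1) b, of t]
    by (subst integral_L2_add(1)) (auto intro!: state_L2 \<omega>_tilde_L2 L simp del: state.simps)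
  finally show ?case .
qed simp

lemma state_\<omega>_tilde_uncorrelated:
  assumes K: "policy P K" and y: "y \<in> carrier_vec n" and z: "z \<in> carrier_vec n"
  shows "expectation (\<lambda>w. (y \<bullet> state P K t w) * (z \<bullet> \<omega>_tilde P t w)) = 0"
proof -
  have "expectation (\<lambda>w. (y \<bullet> state P K t w) * (z \<bullet> \<omega>_tilde P t w)) =
      expectation (\<lambda>w. (y \<bullet> state P K t w) * ((B\<^sup>T *\<^sub>v z) \<bullet> noise (Inr t) w + z \<bullet> noise (Inl t) w))"
    using z by (intro Bochner_Integration.integral_cong) (auto simp: \<omega>_tilde_dot)
  also have "\<dots> = 0"
    using y z state_noise_uncorrelated[OF K y, of "B\<^sup>T *\<^sub>v z" "Inr t" t] state_noise_uncorrelated[OF K y, of z "Inl t" t]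
    by (subst integral_L2_add(2)) (auto intro!: L2_noise_dots state_L2 K simp: noise_dim_def noise_time_def)
  finally show ?thesis .
qed

lemma traj_transpose_dot:
  assumes K: "policy P K" and y: "y \<in> carrier_vec n" and x: "x \<in> carrier_vec n"
  shows "((closed_loop P K)\<^sup>T *\<^sub>v y) \<bullet> traj K i x = y \<bullet> traj K (Suc i) x"
  unfolding traj_Suc'[OF K x] using assms by (intro transpose_vec_mult_scalar[of _ n n]) auto

text \<open>
  This solves the recursion \<open>M\<^sub>t\<^sub>+\<^sub>1 = L M\<^sub>t L\<^sup>T + D\<close> of the covariances. The transposed closed loop acts on the
  test vectors \<open>y\<close> and \<open>z\<close>, which shifts the trajectories by one step.
\<close>
lemma state_second_moment:
  assumes K: "policy P K" and v: "factors v (D\<omega>_tilde P)" and y: "y \<in> carrier_vec n" and z: "z \<in> carrier_vec n"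
  shows "expectation (\<lambda>w. (y \<bullet> state P K t w) * (z \<bullet> state P K t w)) =
    (\<Sum>i<t. \<Sum>k<n. (y \<bullet> traj K i (v k)) * (z \<bullet> traj K i (v k)))"
  using y z
proof (induction t arbitrary: y z)
  case (Suc t)
  let ?L = "closed_loop P K"
  have vc: "v k \<in> carrier_vec n" for k using v by (simp add: factors_def)
  let ?a = "\<lambda>y w. (?L\<^sup>T *\<^sub>v y) \<bullet> state P K t w" and ?b = "\<lambda>y w. y \<bullet> \<omega>_tilde P t w"
  have "expectation (\<lambda>w. (y \<bullet> state P K (Suc t) w) * (z \<bullet> state P K (Suc t) w)) =
      expectation (\<lambda>w. (?a y w + ?b y w) * (?a z w + ?b z w))"
    using Suc.prems K by (intro Bochner_Integration.integral_cong) (auto simp: state_Suc_dot simp del: state.simps)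
  also have "\<dots> = expectation (\<lambda>w. ?a y w * ?a z w) + expectation (\<lambda>w. ?a y w * ?b z w) +
      (expectation (\<lambda>w. ?b y w * ?a z w) + expectation (\<lambda>w. ?b y w * ?b z w))"
    using Suc.prems K by (subst integral_L2_add(1); (subst integral_L2_add(2))?; (subst integral_L2_add(2))?)
      (auto intro!: L2_add state_L2 \<omega>_tilde_L2)
  also have "expectation (\<lambda>w. ?b y w * ?a z w) = expectation (\<lambda>w. ?a z w * ?b y w)" by (simp add: mult.commute)
  also have "expectation (\<lambda>w. ?a y w * ?a z w) = (\<Sum>i<t. \<Sum>k<n. (y \<bullet> traj K (Suc i) (v k)) * (z \<bullet> traj K (Suc i) (v k)))"
    using Suc.prems K vc by (subst Suc.IH) (simp_all add: traj_transpose_dot)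
  also have "expectation (\<lambda>w. ?b y w * ?b z w) = (\<Sum>k<n. (y \<bullet> v k) * (z \<bullet> v k))"
    unfolding factors_bilinear[OF v Suc.prems, symmetric]
    using Suc.prems by (simp add: \<omega>_tilde_cov D\<omega>_tilde_bilinear)
  also have "(\<Sum>k<n. (y \<bullet> v k) * (z \<bullet> v k)) = (\<Sum>k<n. (y \<bullet> traj K 0 (v k)) * (z \<bullet> traj K 0 (v k)))"
    using K vc by simp
  finally show ?case
    using state_\<omega>_tilde_uncorrelated[OF K] Suc.prems K by (simp add: sum.lessThan_Suc_shift del: state.simps sum.lessThan_Suc)
qed simp

lemma expected_quadratic_state:
  assumes K: "policy P K" and v: "factors v (D\<omega>_tilde P)" and N: "N \<in> carrier_mat n n"
  shows "expectation (\<lambda>w. state P K t w \<bullet> (N *\<^sub>v state P K t w)) =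
    (\<Sum>i<t. \<Sum>k<n. traj K i (v k) \<bullet> (N *\<^sub>v traj K i (v k)))"
proof -
  have vc: "v k \<in> carrier_vec n" for k using v by (simp add: factors_def)
  have "expectation (\<lambda>w. state P K t w \<bullet> (N *\<^sub>v state P K t w)) =
      (\<Sum>a<n. \<Sum>b<n. N $$ (a,b) * (\<Sum>i<t. \<Sum>k<n. (unit_vec n a \<bullet> traj K i (v k)) * (unit_vec n b \<bullet> traj K i (v k))))"
    unfolding L2vec_bilinear(2)[OF L2vec_state[OF K] L2vec_state[OF K] N]
    by (subst state_second_moment[OF K v]) simp_all
  also have "\<dots> = (\<Sum>a<n. \<Sum>b<n. \<Sum>i<t. \<Sum>k<n. N $$ (a,b) * traj K i (v k) $ a * traj K i (v k) $ b)"
    using K vc by (intro sum.cong refl) (simp add: sum_distrib_left mult_ac)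
  also have "\<dots> = (\<Sum>a<n. \<Sum>i<t. \<Sum>b<n. \<Sum>k<n. N $$ (a,b) * traj K i (v k) $ a * traj K i (v k) $ b)"
    by (rule sum.cong[OF refl], rule sum.swap)
  also have "\<dots> = (\<Sum>i<t. \<Sum>a<n. \<Sum>b<n. \<Sum>k<n. N $$ (a,b) * traj K i (v k) $ a * traj K i (v k) $ b)"
    by (rule sum.swap)
  also have "\<dots> = (\<Sum>i<t. \<Sum>k<n. traj K i (v k) \<bullet> (N *\<^sub>v traj K i (v k)))"
  proof (rule sum.cong[OF refl])
    fix i
    have "(\<Sum>a<n. \<Sum>b<n. \<Sum>k<n. N $$ (a,b) * traj K i (v k) $ a * traj K i (v k) $ b) =
        (\<Sum>a<n. \<Sum>k<n. \<Sum>b<n. N $$ (a,b) * traj K i (v k) $ a * traj K i (v k) $ b)"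
      by (rule sum.cong[OF refl], rule sum.swap)
    also have "\<dots> = (\<Sum>k<n. \<Sum>a<n. \<Sum>b<n. N $$ (a,b) * traj K i (v k) $ a * traj K i (v k) $ b)"
      by (rule sum.swap)
    finally show "(\<Sum>a<n. \<Sum>b<n. \<Sum>k<n. N $$ (a,b) * traj K i (v k) $ a * traj K i (v k) $ b) =
        (\<Sum>k<n. traj K i (v k) \<bullet> (N *\<^sub>v traj K i (v k)))"
      using K vc by (simp add: bilinear_as_sum[OF N])
  qed
  finally show ?thesis .
qed

lemma second_moment_state:
  assumes K: "policy P K" and v: "factors v (D\<omega>_tilde P)" and ab: "a < n" "b < n"
  shows "second_moment M n (state P K t) $$ (a,b) =
    (\<Sum>i<t. \<Sum>k<n. traj K i (v k) $ a * traj K i (v k) $ b)"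
proof -
  have vc: "v k \<in> carrier_vec n" for k using v by (simp add: factors_def)
  have "second_moment M n (state P K t) $$ (a,b) =
      expectation (\<lambda>w. (unit_vec n a \<bullet> state P K t w) * (unit_vec n b \<bullet> state P K t w))"
    using ab state_carrier[OF K] by (auto simp: second_moment_def intro!: Bochner_Integration.integral_cong)
  also have "\<dots> = (\<Sum>i<t. \<Sum>k<n. traj K i (v k) $ a * traj K i (v k) $ b)"
    using ab K vc by (simp add: state_second_moment[OF K v])
  finally show ?thesis .
qed

lemma expected_cost:
  assumes K: "policy P K" and v: "factors v (D\<omega>_tilde P)"
  shows "expectation (cost P K t) = (\<Sum>i<t. \<Sum>k<n. stage_cost K (traj K i (v k))) + (sigma P)\<^sup>2 * trace R"
proof -
  have vc: "v k \<in> carrier_vec n" for k using v by (simp add: factors_def)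
  let ?x = "state P K t" and ?e = "noise (Inr t)"
  have Lx: "L2vec M n ?x" by (rule L2vec_state[OF K])
  have LKx: "L2vec M d (\<lambda>w. K *\<^sub>v ?x w)" using K by (intro L2vec_mult[OF Lx]) simp
  have Le: "L2vec M d ?e" using L2vec_noise[of "Inr t"] by (simp add: noise_dim_def)
  have "cost P K t w = ?x w \<bullet> (stage_mat K *\<^sub>v ?x w) + (K *\<^sub>v ?x w) \<bullet> (R *\<^sub>v ?e w)
      + ?e w \<bullet> (R *\<^sub>v (K *\<^sub>v ?x w)) + ?e w \<bullet> (R *\<^sub>v ?e w)" if w: "w \<in> space M" for w
  proof -
    have x: "?x w \<in> carrier_vec n" by (rule state_carrier[OF K w])
    have Kx: "K *\<^sub>v ?x w \<in> carrier_vec d" using K x by simp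
    have e: "?e w \<in> carrier_vec d" using noise_carrier(2)[OF w] by (simp add: noise_def)
    show ?thesis
      using x Kx e mult_mat_vec_carrier[OF dims(6) Kx] mult_mat_vec_carrier[OF dims(6) e]
      by (simp add: cost_def action_def noise_def stage_mat_quad[OF K] stage_cost_def
          mult_add_distrib_mat_vec[OF dims(6)] scalar_prod_add_distrib[of _ d] add_scalar_prod_distrib[of _ d])
  qed
  then have "expectation (cost P K t) = expectation (\<lambda>w. ?x w \<bullet> (stage_mat K *\<^sub>v ?x w) + (K *\<^sub>v ?x w) \<bullet> (R *\<^sub>v ?e w)
      + ?e w \<bullet> (R *\<^sub>v (K *\<^sub>v ?x w)) + ?e w \<bullet> (R *\<^sub>v ?e w))"
    by (intro Bochner_Integration.integral_cong) auto
  also have "\<dots> = expectation (\<lambda>w. ?x w \<bullet> (stage_mat K *\<^sub>v ?x w)) + expectation (\<lambda>w. (K *\<^sub>v ?x w) \<bullet> (R *\<^sub>v ?e w))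
      + expectation (\<lambda>w. ?e w \<bullet> (R *\<^sub>v (K *\<^sub>v ?x w))) + expectation (\<lambda>w. ?e w \<bullet> (R *\<^sub>v ?e w))"
    using L2vec_bilinear(1)[OF Lx Lx stage_mat_carrier[OF K]] L2vec_bilinear(1)[OF LKx Le dims(6)]
      L2vec_bilinear(1)[OF Le LKx dims(6)] L2vec_bilinear(1)[OF Le Le dims(6)] by simp
  also have "expectation (\<lambda>w. ?x w \<bullet> (stage_mat K *\<^sub>v ?x w)) = (\<Sum>i<t. \<Sum>k<n. stage_cost K (traj K i (v k)))"
    using K vc by (simp add: expected_quadratic_state[OF K v stage_mat_carrier[OF K]] stage_mat_quad)
  finally have total: "expectation (cost P K t) = (\<Sum>i<t. \<Sum>k<n. stage_cost K (traj K i (v k)))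
      + expectation (\<lambda>w. (K *\<^sub>v ?x w) \<bullet> (R *\<^sub>v ?e w))
      + expectation (\<lambda>w. ?e w \<bullet> (R *\<^sub>v (K *\<^sub>v ?x w))) + expectation (\<lambda>w. ?e w \<bullet> (R *\<^sub>v ?e w))" .
  have cross: "expectation (\<lambda>w. (y \<bullet> (K *\<^sub>v ?x w)) * (b \<bullet> ?e w)) = 0"
    if "y \<in> carrier_vec d" "b \<in> carrier_vec d" for y b
  proof -
    have Kty: "K\<^sup>T *\<^sub>v y \<in> carrier_vec n" using K that by (intro mult_mat_vec_carrier[of _ n d]) auto
    have "expectation (\<lambda>w. (y \<bullet> (K *\<^sub>v ?x w)) * (b \<bullet> ?e w)) = expectation (\<lambda>w. ((K\<^sup>T *\<^sub>v y) \<bullet> ?x w) * (b \<bullet> ?e w))"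
      using that K state_carrier[OF K] by (intro Bochner_Integration.integral_cong)
        (auto simp: transpose_vec_mult_scalar[of _ d n])
    also have "\<dots> = 0" using Kty that by (intro state_noise_uncorrelated K) (auto simp: noise_dim_def noise_time_def)
    finally show ?thesis .
  qed
  have "expectation (\<lambda>w. (K *\<^sub>v ?x w) \<bullet> (R *\<^sub>v ?e w)) = 0"
    unfolding L2vec_bilinear(2)[OF LKx Le dims(6)] by (simp add: cross)
  moreover have "expectation (\<lambda>w. ?e w \<bullet> (R *\<^sub>v (K *\<^sub>v ?x w))) = 0"
    unfolding L2vec_bilinear(2)[OF Le LKx dims(6)]
    by (simp add: cross mult.commute[of "_ \<bullet> ?e _"])
  moreover have "expectation (\<lambda>w. ?e w \<bullet> (R *\<^sub>v ?e w)) = (sigma P)\<^sup>2 * trace R"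
  proof -
    have "expectation (\<lambda>w. (unit_vec d i \<bullet> ?e w) * (unit_vec d j \<bullet> ?e w)) = (if i = j then (sigma P)\<^sup>2 else 0)"
      if "i < d" "j < d" for i j
      using that noise_covariance[of "unit_vec d i" "Inr t" "unit_vec d j"]
      by (auto simp: noise_dim_def noise_cov_def scaled_identity_bilinear)
    then have "expectation (\<lambda>w. ?e w \<bullet> (R *\<^sub>v ?e w)) = (\<Sum>i<d. \<Sum>j<d. if i = j then R $$ (i,j) * (sigma P)\<^sup>2 else 0)"
      unfolding L2vec_bilinear(2)[OF Le Le dims(6)] by (intro sum.cong refl) auto
    then show ?thesis by (simp add: trace_def sum_distrib_left mult.commute)
  qed
  ultimately show ?thesis unfolding total by simp
qed

end

section \<open>Spectral radius and growth of powers\<close>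

lemma smult_pow_mat:
  fixes X :: "'a :: comm_ring_1 mat"
  assumes X: "X \<in> carrier_mat n n"
  shows "(c \<cdot>\<^sub>m X) ^\<^sub>m k = c ^ k \<cdot>\<^sub>m (X ^\<^sub>m k)"
proof (induction k)
  case 0
  show ?case using X by auto
next
  case (Suc k)
  have Xk: "X ^\<^sub>m k \<in> carrier_mat n n" using X by simp
  have "(c \<cdot>\<^sub>m X) ^\<^sub>m Suc k = (c ^ k \<cdot>\<^sub>m (X ^\<^sub>m k)) * (c \<cdot>\<^sub>m X)" using Suc by simp
  also have "\<dots> = c ^ k \<cdot>\<^sub>m ((X ^\<^sub>m k) * (c \<cdot>\<^sub>m X))"
    using X Xk by (intro mult_smult_assoc_mat[of _ n n _ n]) auto
  also have "(X ^\<^sub>m k) * (c \<cdot>\<^sub>m X) = c \<cdot>\<^sub>m ((X ^\<^sub>m k) * X)"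
    using X Xk by (intro mult_smult_distrib[of _ n n _ n]) auto
  also have "c ^ k \<cdot>\<^sub>m (c \<cdot>\<^sub>m ((X ^\<^sub>m k) * X)) = c ^ Suc k \<cdot>\<^sub>m (X ^\<^sub>m Suc k)"
    by (rule eq_matI) (auto simp: mult_ac)
  finally show ?case .
qed

text \<open>
  Divide \<open>X\<close> by some \<open>s\<close> strictly between its spectral radius and 1. The quotient still has spectral radius
  below 1, so by the Jordan normal form its powers are bounded.
\<close>
lemma spectral_radius_less_1_decay:
  fixes X :: "real mat"
  assumes X: "X \<in> carrier_mat n n" and n: "0 < n"
    and sr: "spectral_radius (map_mat complex_of_real X) < 1"
  obtains C r where "0 \<le> C" "0 < r" "r < 1" "\<And>k. (frob_norm (X ^\<^sub>m k))\<^sup>2 \<le> C * r ^ k"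
proof -
  let ?X = "map_mat complex_of_real X"
  have Xc: "?X \<in> carrier_mat n n" using X by simp
  have "0 \<le> spectral_radius ?X" using spectral_radius_mem_max(1)[OF Xc n] by auto
  then obtain s where s: "spectral_radius ?X < s" "s < 1" "0 < s"
    using sr dense[of "spectral_radius ?X" 1] by force
  define Y where "Y = complex_of_real (1 / s) \<cdot>\<^sub>m ?X"
  have Y: "Y \<in> carrier_mat n n" using Xc by (simp add: Y_def)
  have "spectral_radius Y < 1"
  proof -
    from spectral_radius_mem_max(1)[OF Y n] obtain \<mu> where \<mu>: "\<mu> \<in> spectrum Y" "spectral_radius Y = norm \<mu>" by auto
    from \<mu>(1) obtain v where v: "v \<in> carrier_vec n" "v \<noteq> 0\<^sub>v n" "Y *\<^sub>v v = \<mu> \<cdot>\<^sub>v v"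
      using Y unfolding spectrum_def eigenvalue_def eigenvector_def by auto
    have Xv: "?X *\<^sub>v v \<in> carrier_vec n" using Xc v by simp
    have "complex_of_real (1 / s) \<cdot>\<^sub>v (?X *\<^sub>v v) = Y *\<^sub>v v"
      unfolding Y_def by (rule smult_mat_mult_vec[OF Xc v(1), symmetric])
    then have eq: "complex_of_real (1 / s) \<cdot>\<^sub>v (?X *\<^sub>v v) = \<mu> \<cdot>\<^sub>v v" using v by simp
    have "?X *\<^sub>v v = (complex_of_real s * \<mu>) \<cdot>\<^sub>v v"
    proof (rule eq_vecI)
      fix i assume i: "i < dim_vec ((complex_of_real s * \<mu>) \<cdot>\<^sub>v v)"
      have "complex_of_real (1 / s) * (?X *\<^sub>v v) $ i = \<mu> * v $ i"
        using arg_cong[OF eq, of "\<lambda>u. u $ i"] i v carrier_vecD[OF Xv]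
        by (simp del: index_mult_mat_vec dim_mult_mat_vec)
      then have "complex_of_real s * (complex_of_real (1 / s) * (?X *\<^sub>v v) $ i) = complex_of_real s * (\<mu> * v $ i)" by simp
      then show "(?X *\<^sub>v v) $ i = ((complex_of_real s * \<mu>) \<cdot>\<^sub>v v) $ i"
        using s i by (simp del: index_mult_mat_vec)
    qed (use v Xc in auto)
    then have "complex_of_real s * \<mu> \<in> spectrum ?X"
      unfolding spectrum_def eigenvalue_def eigenvector_def using v Xc by auto
    then have "norm (complex_of_real s * \<mu>) \<le> spectral_radius ?X"
      by (intro spectral_radius_mem_max(2)[OF Xc n]) auto
    moreover have "norm (complex_of_real s * \<mu>) = s * norm \<mu>" using s by (simp add: norm_mult)
    ultimately have "s * norm \<mu> < s * 1" using s by linarith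
    then show ?thesis using s \<mu>(2) by simp
  qed
  moreover have "\<exists>n_as. jordan_nf Y n_as"
    using char_poly_factorized[OF Y] jordan_nf_exists[OF Y] by blast
  ultimately obtain c where c: "\<And>k. norm_bound (Y ^\<^sub>m k) c"
    using spectral_radius_jnf_norm_bound_less_1[OF Y] by blast
  have entry: "\<bar>(X ^\<^sub>m k) $$ (i,j)\<bar> \<le> \<bar>c\<bar> * s ^ k" if ij: "i < n" "j < n" for i j k
  proof -
    have Xk: "X ^\<^sub>m k \<in> carrier_mat n n" using X by simp
    have Yk: "Y ^\<^sub>m k = complex_of_real (1 / s) ^ k \<cdot>\<^sub>m map_mat complex_of_real (X ^\<^sub>m k)"
      unfolding Y_def smult_pow_mat[OF Xc] of_real_hom.mat_hom_pow[OF X] ..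
    have "norm ((Y ^\<^sub>m k) $$ (i,j)) \<le> c"
      using c[of k] ij carrier_matD[OF pow_carrier_mat[OF Y, of k]] unfolding norm_bound_def by simp
    moreover have "norm ((Y ^\<^sub>m k) $$ (i,j)) = \<bar>(X ^\<^sub>m k) $$ (i,j)\<bar> / s ^ k"
      unfolding Yk using ij carrier_matD[OF Xk] s by (simp add: norm_mult norm_power norm_divide power_divide)
    ultimately have "\<bar>(X ^\<^sub>m k) $$ (i,j)\<bar> \<le> c * s ^ k" using s by (simp add: field_simps)
    also have "\<dots> \<le> \<bar>c\<bar> * s ^ k" using s by (intro mult_right_mono) auto
    finally show ?thesis .
  qed
  show thesis
  proof (rule that[of "(\<Sum>i<n. \<Sum>j<n. \<bar>c\<bar>\<^sup>2)" "s\<^sup>2"])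
    fix k
    have Xk: "X ^\<^sub>m k \<in> carrier_mat n n" using X by simp
    have "(frob_norm (X ^\<^sub>m k))\<^sup>2 = (\<Sum>i<n. \<Sum>j<n. \<bar>(X ^\<^sub>m k) $$ (i,j)\<bar>\<^sup>2)"
      using carrier_matD[OF Xk] by (simp add: frob_norm_def sum_nonneg)
    also have "\<dots> \<le> (\<Sum>i<n. \<Sum>j<n. (\<bar>c\<bar> * s ^ k)\<^sup>2)"
      by (intro sum_mono power_mono entry) auto
    also have "\<dots> = (\<Sum>i<n. \<Sum>j<n. \<bar>c\<bar>\<^sup>2) * (s\<^sup>2) ^ k"
      by (simp add: sum_distrib_right power_mult_distrib power_mult[symmetric] mult.commute)
    finally show "(frob_norm (X ^\<^sub>m k))\<^sup>2 \<le> (\<Sum>i<n. \<Sum>j<n. \<bar>c\<bar>\<^sup>2) * (s\<^sup>2) ^ k" .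
  qed (use s in \<open>auto simp: power_less_one_iff abs_square_less_1 intro!: sum_nonneg\<close>)
qed

text \<open>
  Apply the powers to a complex eigenvector whose eigenvalue is of modulus at least 1.
\<close>
lemma spectral_radius_ge_1_powers:
  fixes X :: "real mat"
  assumes X: "X \<in> carrier_mat n n" and n: "0 < n"
    and sr: "1 \<le> spectral_radius (map_mat complex_of_real X)"
  shows "1 \<le> (frob_norm (X ^\<^sub>m k))\<^sup>2"
proof -
  let ?X = "map_mat complex_of_real X"
  have Xc: "?X \<in> carrier_mat n n" using X by simp
  have Xk: "X ^\<^sub>m k \<in> carrier_mat n n" using X by simp
  from spectral_radius_mem_max(1)[OF Xc n] sr obtain \<mu> where \<mu>: "\<mu> \<in> spectrum ?X" "1 \<le> norm \<mu>" by auto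
  from \<mu>(1) obtain v where ev: "eigenvector ?X v \<mu>" unfolding spectrum_def eigenvalue_def by auto
  then have v: "v \<in> carrier_vec n" "v \<noteq> 0\<^sub>v n" using Xc by (auto simp: eigenvector_def)
  define V where "V = (\<Sum>j<n. (norm (v $ j))\<^sup>2)"
  obtain j where j: "j < n" "v $ j \<noteq> 0" using v by (metis eq_vecI carrier_vecD index_zero_vec)
  have V: "0 < V" unfolding V_def by (rule sum_pos2[of _ j]) (use j in auto)
  have "map_mat complex_of_real (X ^\<^sub>m k) *\<^sub>v v = \<mu> ^ k \<cdot>\<^sub>v v"
    unfolding of_real_hom.mat_hom_pow[OF X] by (rule eigenvector_pow[OF Xc ev])
  then have at: "(\<mu> ^ k \<cdot>\<^sub>v v) $ i = (map_mat complex_of_real (X ^\<^sub>m k) *\<^sub>v v) $ i" for i by simp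
  have row: "\<mu> ^ k * v $ i = (\<Sum>j<n. complex_of_real ((X ^\<^sub>m k) $$ (i,j)) * v $ j)" if "i < n" for i
    using at[of i]
      that v carrier_matD[OF Xk] by (simp add: scalar_prod_def lessThan_atLeast0 del: pow_mat_dim)
  have "(norm (\<mu> ^ k))\<^sup>2 * V = (\<Sum>i<n. (norm (\<mu> ^ k * v $ i))\<^sup>2)"
    by (simp add: V_def sum_distrib_left norm_mult power_mult_distrib)
  also have "\<dots> \<le> (\<Sum>i<n. (\<Sum>j<n. ((X ^\<^sub>m k) $$ (i,j))\<^sup>2) * V)"
  proof (rule sum_mono)
    fix i assume "i \<in> {..<n}"
    then have i: "i < n" by simp
    have "norm (\<mu> ^ k * v $ i) \<le> (\<Sum>j<n. \<bar>(X ^\<^sub>m k) $$ (i,j)\<bar> * norm (v $ j))"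
      unfolding row[OF i] by (rule order_trans[OF norm_sum]) (simp add: norm_mult)
    then have "(norm (\<mu> ^ k * v $ i))\<^sup>2 \<le> (\<Sum>j<n. \<bar>(X ^\<^sub>m k) $$ (i,j)\<bar> * norm (v $ j))\<^sup>2"
      by (rule power_mono) simp
    also have "\<dots> \<le> (\<Sum>j<n. \<bar>(X ^\<^sub>m k) $$ (i,j)\<bar>\<^sup>2) * (\<Sum>j<n. (norm (v $ j))\<^sup>2)"
      by (rule Cauchy_Schwarz_ineq_sum)
    finally show "(norm (\<mu> ^ k * v $ i))\<^sup>2 \<le> (\<Sum>j<n. ((X ^\<^sub>m k) $$ (i,j))\<^sup>2) * V" by (simp add: V_def)
  qed
  also have "\<dots> = (frob_norm (X ^\<^sub>m k))\<^sup>2 * V"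
    using carrier_matD[OF Xk] by (simp add: frob_norm_def sum_nonneg sum_distrib_right)
  finally have "(norm (\<mu> ^ k))\<^sup>2 \<le> (frob_norm (X ^\<^sub>m k))\<^sup>2" using V by simp
  moreover have "1 \<le> (norm (\<mu> ^ k))\<^sup>2" using \<mu>(2) by (simp add: norm_power one_le_power)
  ultimately show ?thesis by linarith
qed

section \<open>The discounted objective\<close>

text \<open>
  The Cauchy product with the geometric series, without its diagonal.
\<close>
lemma discounted_partial_sums:
  fixes a :: "nat \<Rightarrow> real"
  assumes a: "summable (\<lambda>i. \<bar>\<gamma> ^ i * a i\<bar>)" and \<gamma>: "0 < \<gamma>" "\<gamma> < 1"
  shows "(\<lambda>t. \<gamma> ^ t * (\<Sum>i<t. a i)) sums (\<gamma> / (1 - \<gamma>) * (\<Sum>i. \<gamma> ^ i * a i))"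
proof -
  let ?X = "\<Sum>i. \<gamma> ^ i * a i"
  have prod: "(\<lambda>t. \<Sum>i\<le>t. (\<gamma> ^ i * a i) * \<gamma> ^ (t - i)) sums (?X * (\<Sum>i. \<gamma> ^ i))"
    by (rule Cauchy_product_sums) (use a \<gamma> in \<open>simp_all add: summable_geometric_iff norm_power\<close>)
  have conv: "(\<Sum>i\<le>t. (\<gamma> ^ i * a i) * \<gamma> ^ (t - i)) = \<gamma> ^ t * (\<Sum>i<t. a i) + \<gamma> ^ t * a t" for t
  proof -
    have "(\<Sum>i\<le>t. (\<gamma> ^ i * a i) * \<gamma> ^ (t - i)) = (\<Sum>i\<le>t. \<gamma> ^ t * a i)"
    proof (rule sum.cong[OF refl])
      fix i assume "i \<in> {..t}"
      then have "\<gamma> ^ i * \<gamma> ^ (t - i) = \<gamma> ^ t" by (simp add: power_add[symmetric])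
      moreover have "(\<gamma> ^ i * a i) * \<gamma> ^ (t - i) = \<gamma> ^ i * \<gamma> ^ (t - i) * a i" by simp
      ultimately show "(\<gamma> ^ i * a i) * \<gamma> ^ (t - i) = \<gamma> ^ t * a i" by (simp only:)
    qed
    also have "\<dots> = (\<Sum>i<t. \<gamma> ^ t * a i) + \<gamma> ^ t * a t"
      by (rule sum.lessThan_Suc[of "\<lambda>i. \<gamma> ^ t * a i" t, unfolded lessThan_Suc_atMost])
    finally show ?thesis unfolding sum_distrib_left .
  qed
  have "(\<lambda>t. \<gamma> ^ t * a t) sums ?X"
    by (rule summable_sums[OF summable_rabs_cancel[OF a]])
  from sums_diff[OF prod[unfolded conv] this]
  have "(\<lambda>t. \<gamma> ^ t * (\<Sum>i<t. a i)) sums (?X * (\<Sum>i. \<gamma> ^ i) - ?X)" by (simp only: add_diff_cancel_right')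
  moreover have "?X * (\<Sum>i. \<gamma> ^ i) - ?X = \<gamma> / (1 - \<gamma>) * ?X"
  proof -
    have "(\<Sum>i. \<gamma> ^ i) = 1 / (1 - \<gamma>)" by (rule suminf_geometric) (use \<gamma> in simp)
    moreover have "x * (1 / (1 - \<gamma>)) - x = \<gamma> / (1 - \<gamma>) * x" for x
      using \<gamma> by (simp add: field_simps)
    ultimately show ?thesis by (simp only:)
  qed
  ultimately show ?thesis by (simp only:)
qed

context discounted_lqr
begin

abbreviation "sS \<equiv> \<sigma>_min S"
abbreviation "sD \<equiv> \<sigma>_min (D\<omega>_tilde P)"

lemma sS_pos: "0 < sS" by (rule pos_def_\<sigma>_min(1)[OF pos_def_S dims(1)])
lemma sD_pos: "0 < sD" by (rule pos_def_\<sigma>_min(1)[OF pos_def_D\<omega>_tilde dims(1)])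

lemma trace_mult_smult:
  assumes "N \<in> carrier_mat n n" "X \<in> carrier_mat n n"
  shows "trace (N * (c \<cdot>\<^sub>m X)) = c * trace (N * X)"
  using assms by (simp add: trace_mult_as_sum[of _ n] sum_distrib_left mult_ac)

lemma trace_le_trace_noise:
  assumes N: "N \<in> carrier_mat n n" "\<And>v. v \<in> carrier_vec n \<Longrightarrow> 0 \<le> v \<bullet> (N *\<^sub>v v)"
  shows "sD * trace N \<le> trace (N * D\<omega>_tilde P)"
proof -
  have "trace (N * (sD \<cdot>\<^sub>m 1\<^sub>m n)) \<le> trace (N * D\<omega>_tilde P)"
  proof (rule trace_mult_mono[of _ n])
    show "(sD \<cdot>\<^sub>m 1\<^sub>m n)\<^sup>T = sD \<cdot>\<^sub>m 1\<^sub>m n" by (rule eq_matI) auto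
    show "v \<bullet> ((sD \<cdot>\<^sub>m 1\<^sub>m n) *\<^sub>v v) \<le> v \<bullet> (D\<omega>_tilde P *\<^sub>v v)" if "v \<in> carrier_vec n" for v
      using pos_def_\<sigma>_min(2)[OF pos_def_D\<omega>_tilde dims(1) that] that by (simp add: scaled_identity_bilinear)
  qed (use N D\<omega>_tilde_sym in auto)
  then show ?thesis using N(1) by (simp add: trace_mult_smult)
qed

text \<open>
  The noise excites every direction with variance at least \<open>sD\<close>.
\<close>
lemma frob_le_noise:
  assumes v: "factors v (D\<omega>_tilde P)" and X: "X \<in> carrier_mat n n"
  shows "sD * (frob_norm X)\<^sup>2 \<le> (\<Sum>k<n. (vnorm (X *\<^sub>v v k))\<^sup>2)"
proof -
  have vc: "v k \<in> carrier_vec n" for k using v by (simp add: factors_def)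
  have Xt: "X\<^sup>T \<in> carrier_mat n n" using X by simp
  have XX: "X\<^sup>T * X \<in> carrier_mat n n" by (rule mult_carrier_mat[OF Xt X])
  have q: "x \<bullet> ((X\<^sup>T * X) *\<^sub>v x) = (vnorm (X *\<^sub>v x))\<^sup>2" if x: "x \<in> carrier_vec n" for x
    unfolding vnorm_sq assoc_mult_mat_vec[OF Xt X x]
    by (rule mult_transpose_move[OF X x mult_mat_vec_carrier[OF X x]])
  have "trace (X\<^sup>T * X) = (\<Sum>j<n. unit_vec n j \<bullet> ((X\<^sup>T * X) *\<^sub>v unit_vec n j))"
    unfolding trace_def carrier_matD(1)[OF XX] by (intro sum.cong refl entry_as_bilinear[OF XX]) auto
  also have "\<dots> = (frob_norm X)\<^sup>2" by (simp add: q frob_norm_sq_columns[OF X])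
  finally have "trace (X\<^sup>T * X) = (frob_norm X)\<^sup>2" .
  moreover have "trace ((X\<^sup>T * X) * D\<omega>_tilde P) = (\<Sum>k<n. (vnorm (X *\<^sub>v v k))\<^sup>2)"
    using v XX q[OF vc] by (simp add: factors_def)
  moreover have "sD * trace (X\<^sup>T * X) \<le> trace ((X\<^sup>T * X) * D\<omega>_tilde P)"
    by (rule trace_le_trace_noise[OF XX]) (simp add: q)
  ultimately show ?thesis by simp
qed

lemma frob_le_stage_costs:
  assumes K: "policy P K" and v: "factors v (D\<omega>_tilde P)"
  shows "sS * sD * (frob_norm (closed_loop P K ^\<^sub>m i))\<^sup>2 \<le> (\<Sum>k<n. stage_cost K (traj K i (v k)))"
proof -
  have vc: "v k \<in> carrier_vec n" for k using v by (simp add: factors_def)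
  have Li: "closed_loop P K ^\<^sub>m i \<in> carrier_mat n n" using K by simp
  have "sS * (sD * (frob_norm (closed_loop P K ^\<^sub>m i))\<^sup>2) \<le> sS * (\<Sum>k<n. (vnorm (traj K i (v k)))\<^sup>2)"
    unfolding traj_def using sS_pos by (intro mult_left_mono frob_le_noise[OF v Li]) simp
  also have "\<dots> \<le> (\<Sum>k<n. stage_cost K (traj K i (v k)))"
    unfolding sum_distrib_left vnorm_sq by (intro sum_mono stage_cost_ge(1) K traj_carrier vc)
  finally show ?thesis by (simp add: mult.assoc)
qed

lemma trace_R_nonneg: "0 \<le> trace R"
proof -
  have "trace R = (\<Sum>i<d. unit_vec d i \<bullet> (R *\<^sub>v unit_vec d i))"
    unfolding trace_def by (intro sum.cong) (simp_all add: entry_as_bilinear[OF dims(6)] del: index_mult_mat_vec scalar_prod_left_unit)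
  also have "0 \<le> \<dots>" by (intro sum_nonneg R_nonneg) simp
  finally show ?thesis .
qed

lemma J_formula:
  assumes K: "policy P K" "finite_cost K"
  shows "J P \<gamma> K = ereal (\<gamma> / (1 - \<gamma>) * trace (P_mat P \<gamma> K * D\<omega>_tilde P) + (sigma P)\<^sup>2 * trace R / (1 - \<gamma>))"
proof -
  obtain v where v: "factors v (D\<omega>_tilde P)" using factors_exist by blast
  have vc: "v k \<in> carrier_vec n" for k using v by (simp add: factors_def)
  let ?a = "\<lambda>i. \<Sum>k<n. stage_cost K (traj K i (v k))"
  have a0: "0 \<le> ?a i" for i by (intro sum_nonneg stage_cost_ge(3) K traj_carrier vc)
  note s = trace_P_mat_sums[OF K v]
  have "(\<lambda>t. \<gamma> ^ t * (\<Sum>i<t. ?a i)) sums (\<gamma> / (1 - \<gamma>) * (\<Sum>i. \<gamma> ^ i * ?a i))"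
    using sums_summable[OF s] a0 \<gamma>_pos \<gamma>_less_1 by (intro discounted_partial_sums) (simp_all add: abs_mult)
  moreover have "(\<lambda>t. \<gamma> ^ t * ((sigma P)\<^sup>2 * trace R)) sums (1 / (1 - \<gamma>) * ((sigma P)\<^sup>2 * trace R))"
    using \<gamma>_pos \<gamma>_less_1 by (intro sums_mult2 geometric_sums) simp
  ultimately have "(\<lambda>t. \<gamma> ^ t * (\<Sum>i<t. ?a i) + \<gamma> ^ t * ((sigma P)\<^sup>2 * trace R)) sums
      (\<gamma> / (1 - \<gamma>) * (\<Sum>i. \<gamma> ^ i * ?a i) + 1 / (1 - \<gamma>) * ((sigma P)\<^sup>2 * trace R))"
    by (rule sums_add)
  then have "(\<lambda>t. ereal (\<gamma> ^ t * expectation (cost P K t))) sums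
      ereal (\<gamma> / (1 - \<gamma>) * (\<Sum>i. \<gamma> ^ i * ?a i) + 1 / (1 - \<gamma>) * ((sigma P)\<^sup>2 * trace R))"
    unfolding sums_ereal expected_cost[OF K(1) v] by (simp add: distrib_left)
  then show ?thesis unfolding J_def using sums_unique[OF s] by (simp add: sums_iff)
qed

text \<open>
  The expected cost at time \<open>i + 1\<close> dominates the stage costs \<open>i\<close> steps after the factors of \<open>D\<close>, and with
  them the square of the Frobenius norm of the \<open>i\<close>-th power.
\<close>
lemma finite_cost_if_J_finite:
  assumes K: "policy P K" and J: "J P \<gamma> K \<noteq> \<infinity>"
  shows "finite_cost K"
proof -
  obtain v where v: "factors v (D\<omega>_tilde P)" using factors_exist by blast
  have vc: "v k \<in> carrier_vec n" for k using v by (simp add: factors_def)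
  let ?a = "\<lambda>i. \<Sum>k<n. stage_cost K (traj K i (v k))"
  let ?f = "\<lambda>t. \<gamma> ^ t * expectation (cost P K t)"
  have a0: "0 \<le> ?a i" for i by (intro sum_nonneg stage_cost_ge(3) K traj_carrier vc)
  have r0: "0 \<le> (sigma P)\<^sup>2 * trace R" using trace_R_nonneg by simp
  have "0 \<le> ?f t" for t
    unfolding expected_cost[OF K v] using \<gamma>_pos
    by (intro mult_nonneg_nonneg[OF zero_le_power add_nonneg_nonneg[OF sum_nonneg[OF a0] r0]]) simp
  then have "summable ?f" using J unfolding J_def by (intro summable_ereal) auto
  then have "summable (\<lambda>i. ?f (Suc i) / (\<gamma> * (sS * sD)))" 
    by (intro summable_divide summable_Suc_iff[of ?f, THEN iffD2])
  then show ?thesis unfolding finite_cost_def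
  proof (rule summable_comparison_test'[where N = 0])
    fix i :: nat
    let ?F = "(frob_norm (closed_loop P K ^\<^sub>m i))\<^sup>2"
    have p: "0 < sS * sD" using sS_pos sD_pos by simp
    have "?a i \<le> (\<Sum>j<Suc i. ?a j)" using a0 by (intro member_le_sum) auto
    also have "\<dots> \<le> expectation (cost P K (Suc i))" unfolding expected_cost[OF K v] using r0 by simp
    finally have "sS * sD * ?F \<le> expectation (cost P K (Suc i))"
      using frob_le_stage_costs[OF K v, of i] by linarith
    then have "\<gamma> ^ Suc i * (sS * sD * ?F) \<le> ?f (Suc i)" using \<gamma>_pos by (intro mult_left_mono) auto
    then have "\<gamma> ^ i * ?F * (\<gamma> * (sS * sD)) \<le> ?f (Suc i)" by (simp add: mult_ac)
    then show "norm (\<gamma> ^ i * ?F) \<le> ?f (Suc i) / (\<gamma> * (sS * sD))"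
      using p \<gamma>_pos by (subst pos_le_divide_eq) simp_all
  qed
qed

text \<open>
  The bound in the second part does not depend on \<open>\<gamma>\<close>, so \<open>(1 - \<gamma>) J(K)\<close> stays bounded as \<open>\<gamma>\<close>
  tends to 1.
\<close>
lemma finite_cost_if_decay:
  assumes K: "policy P K" and C: "0 \<le> C" "0 < r" "r < 1" "\<And>k. (frob_norm (closed_loop P K ^\<^sub>m k))\<^sup>2 \<le> C * r ^ k"
  shows "finite_cost K"
    "(1 - \<gamma>) * real_of_ereal (J P \<gamma> K) \<le> frob_norm (stage_mat K) * C * trace (D\<omega>_tilde P) / (1 - r) + (sigma P)\<^sup>2 * trace R"
proof -
  have gr: "\<gamma> ^ k * (frob_norm (closed_loop P K ^\<^sub>m k))\<^sup>2 \<le> C * r ^ k" for k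
  proof -
    have "\<gamma> ^ k * (frob_norm (closed_loop P K ^\<^sub>m k))\<^sup>2 \<le> 1 * (frob_norm (closed_loop P K ^\<^sub>m k))\<^sup>2"
      using \<gamma>_pos \<gamma>_less_1 by (intro mult_right_mono power_le_one) auto
    then show ?thesis using C(4)[of k] by linarith
  qed
  have gs: "summable (\<lambda>k. C * r ^ k)" using C by (intro summable_mult summable_geometric) simp
  show finite_cost: "finite_cost K" unfolding finite_cost_def
    by (rule summable_comparison_test'[OF gs, of 0]) (use gr \<gamma>_pos in simp)
  obtain v where v: "factors v (D\<omega>_tilde P)" using factors_exist by blast
  have vc: "v k \<in> carrier_vec n" for k using v by (simp add: factors_def)
  have tr: "(\<Sum>k<n. (vnorm (v k))\<^sup>2) = trace (D\<omega>_tilde P)"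
  proof -
    have "trace (1\<^sub>m n * D\<omega>_tilde P) = (\<Sum>k<n. v k \<bullet> (1\<^sub>m n *\<^sub>v v k))" using v by (simp add: factors_def)
    then show ?thesis using vc by (simp add: vnorm_sq left_mult_one_mat[of _ n n])
  qed
  have "trace (P_mat P \<gamma> K * D\<omega>_tilde P) \<le> frob_norm (stage_mat K) * trace (D\<omega>_tilde P) * (C * (1 / (1 - r)))"
  proof (rule sums_le[OF _ trace_P_mat_sums[OF K finite_cost v] sums_mult[OF sums_mult[OF geometric_sums]]])
    fix i
    have "(\<Sum>k<n. stage_cost K (traj K i (v k))) \<le>
        (\<Sum>k<n. frob_norm (stage_mat K) * (frob_norm (closed_loop P K ^\<^sub>m i))\<^sup>2 * (vnorm (v k))\<^sup>2)"
    proof (rule sum_mono)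
      fix k
      have t: "traj K i (v k) \<in> carrier_vec n" using K vc by simp
      have "stage_cost K (traj K i (v k)) \<le> frob_norm (stage_mat K) * vnorm (traj K i (v k)) * vnorm (traj K i (v k))"
        using bilinear_le_frob[OF stage_mat_carrier[OF K] t t] by (simp add: stage_mat_quad[OF K t])
      also have "\<dots> = frob_norm (stage_mat K) * (vnorm (traj K i (v k)))\<^sup>2" by (simp add: power2_eq_square)
      also have "\<dots> \<le> frob_norm (stage_mat K) * (frob_norm (closed_loop P K ^\<^sub>m i) * vnorm (v k))\<^sup>2"
        unfolding traj_def using K vc
        by (intro mult_left_mono power_mono vnorm_mult_le_frob[of _ n n]) auto
      finally show "stage_cost K (traj K i (v k)) \<le>
          frob_norm (stage_mat K) * (frob_norm (closed_loop P K ^\<^sub>m i))\<^sup>2 * (vnorm (v k))\<^sup>2"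
        by (simp add: power_mult_distrib mult.assoc)
    qed
    also have "\<dots> = frob_norm (stage_mat K) * trace (D\<omega>_tilde P) * (frob_norm (closed_loop P K ^\<^sub>m i))\<^sup>2"
      unfolding sum_distrib_left[symmetric] tr by (simp add: mult_ac)
    finally have "\<gamma> ^ i * (\<Sum>k<n. stage_cost K (traj K i (v k))) \<le>
        \<gamma> ^ i * (frob_norm (stage_mat K) * trace (D\<omega>_tilde P) * (frob_norm (closed_loop P K ^\<^sub>m i))\<^sup>2)"
      using \<gamma>_pos by (intro mult_left_mono) auto
    also have "\<dots> = frob_norm (stage_mat K) * trace (D\<omega>_tilde P) * (\<gamma> ^ i * (frob_norm (closed_loop P K ^\<^sub>m i))\<^sup>2)"
      by (simp add: mult_ac)
    also have "\<dots> \<le> frob_norm (stage_mat K) * trace (D\<omega>_tilde P) * (C * r ^ i)"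
      using tr[symmetric] by (intro mult_left_mono gr) (auto intro!: mult_nonneg_nonneg sum_nonneg)
    finally show "\<gamma> ^ i * (\<Sum>k<n. stage_cost K (traj K i (v k))) \<le>
        frob_norm (stage_mat K) * trace (D\<omega>_tilde P) * (C * r ^ i)" .
  qed (use C in simp)
  then have "\<gamma> * trace (P_mat P \<gamma> K * D\<omega>_tilde P) \<le> 1 * (frob_norm (stage_mat K) * C * trace (D\<omega>_tilde P) / (1 - r))"
  proof (intro mult_mono)
    have "0 \<le> trace (D\<omega>_tilde P)" unfolding tr[symmetric] by (intro sum_nonneg) simp
    show "0 \<le> trace (P_mat P \<gamma> K * D\<omega>_tilde P)"
      unfolding trace_P_mat[OF v] by (intro sum_nonneg cost_to_go_nonneg K finite_cost vc)
  qed (use \<gamma>_less_1 in \<open>simp_all add: mult_ac\<close>)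
  moreover have "(1 - \<gamma>) * real_of_ereal (J P \<gamma> K) = \<gamma> * trace (P_mat P \<gamma> K * D\<omega>_tilde P) + (sigma P)\<^sup>2 * trace R"
    unfolding J_formula[OF K finite_cost] using \<gamma>_less_1 by (simp add: distrib_left)
  ultimately show "(1 - \<gamma>) * real_of_ereal (J P \<gamma> K) \<le> frob_norm (stage_mat K) * C * trace (D\<omega>_tilde P) / (1 - r) + (sigma P)\<^sup>2 * trace R"
    by simp
qed

text \<open>
  The powers of an unstable closed loop have norm at least 1, so that its discounted cost is at least a
  geometric series. This turns a cost bound that is uniform in \<open>\<gamma>\<close> into stability.
\<close>
lemma trace_P_mat_lower:
  assumes K: "policy P K" "finite_cost K"
  shows "sS * sD \<le> trace (P_mat P \<gamma> K * D\<omega>_tilde P)"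
    "\<not> stable_policy P K \<Longrightarrow> sS * sD / (1 - \<gamma>) \<le> trace (P_mat P \<gamma> K * D\<omega>_tilde P)"
proof -
  obtain v where v: "factors v (D\<omega>_tilde P)" using factors_exist by blast
  let ?F = "\<lambda>i. (frob_norm (closed_loop P K ^\<^sub>m i))\<^sup>2"
  have ge: "sS * sD * (\<Sum>i. \<gamma> ^ i * ?F i) \<le> trace (P_mat P \<gamma> K * D\<omega>_tilde P)"
  proof (rule sums_le[OF _ _ trace_P_mat_sums[OF K v]])
    show "(\<lambda>i. sS * sD * (\<gamma> ^ i * ?F i)) sums (sS * sD * (\<Sum>i. \<gamma> ^ i * ?F i))"
      using K(2) unfolding finite_cost_def by (intro sums_mult summable_sums)
    show "sS * sD * (\<gamma> ^ i * ?F i) \<le> \<gamma> ^ i * (\<Sum>k<n. stage_cost K (traj K i (v k)))" for i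
      using mult_left_mono[OF frob_le_stage_costs[OF K(1) v, of i], of "\<gamma> ^ i"] \<gamma>_pos by (simp add: mult_ac)
  qed
  have p: "0 < sS * sD" using sS_pos sD_pos by simp
  show "sS * sD / (1 - \<gamma>) \<le> trace (P_mat P \<gamma> K * D\<omega>_tilde P)" if ns: "\<not> stable_policy P K"
  proof -
    have "1 / (1 - \<gamma>) \<le> (\<Sum>i. \<gamma> ^ i * ?F i)"
    proof (rule sums_le[OF _ geometric_sums summable_sums])
      fix i
      have "1 \<le> ?F i"
        using ns K(1) unfolding stable_policy_def by (intro spectral_radius_ge_1_powers[of _ n]) auto
      then show "\<gamma> ^ i \<le> \<gamma> ^ i * ?F i" using \<gamma>_pos by simp
    qed (use K(2) \<gamma>_pos \<gamma>_less_1 in \<open>simp_all add: finite_cost_def\<close>)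
    from mult_left_mono[OF this, of "sS * sD"] p ge show ?thesis by simp
  qed
  have "1 \<le> ?F 0"
  proof -
    have "?F 0 = real n"
      using K(1) carrier_matD[OF closed_loop_carrier[OF K(1)]] by (simp add: frob_norm_def sum_nonneg if_distrib[of "\<lambda>x. x\<^sup>2"] cong: if_cong)
    then show ?thesis using Suc_leI[OF dims(1)] by linarith
  qed
  also have "?F 0 \<le> (\<Sum>i. \<gamma> ^ i * ?F i)"
    using sum_le_suminf[OF K(2)[unfolded finite_cost_def], of "{0}"] \<gamma>_pos by simp
  finally show "sS * sD \<le> trace (P_mat P \<gamma> K * D\<omega>_tilde P)"
    using ge mult_left_mono[of 1 "\<Sum>i. \<gamma> ^ i * ?F i" "sS * sD"] p by linarith
qed

lemma Sigma_mat_eq: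
  assumes K: "policy P K" "finite_cost K" and v: "factors v (D\<omega>_tilde P)"
  shows "Sigma_mat P \<gamma> K = (\<gamma> / (1 - \<gamma>)) \<cdot>\<^sub>m occupancy v K"
proof (rule eq_matI)
  fix a b assume "a < dim_row ((\<gamma> / (1 - \<gamma>)) \<cdot>\<^sub>m occupancy v K)" "b < dim_col ((\<gamma> / (1 - \<gamma>)) \<cdot>\<^sub>m occupancy v K)"
  then have ab: "a < n" "b < n" by (auto simp: occupancy_def)
  have vc: "\<And>k. v k \<in> carrier_vec n" using v by (simp add: factors_def)
  let ?c = "\<lambda>a b i. \<Sum>k<n. traj K i (v k) $ a * traj K i (v k) $ b"
  have "summable (\<lambda>i. \<bar>\<gamma> ^ i * ?c a b i\<bar>)"
  proof (rule summable_comparison_test'[where N = 0])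
    show "summable (\<lambda>i. \<gamma> ^ i * ?c a a i + \<gamma> ^ i * ?c b b i)"
      using ab by (intro summable_add sums_summable[OF occupancy_entry_sums[OF K vc]])
    fix i :: nat
    have "\<bar>x * y\<bar> \<le> x * x + y * y" for x y :: real
      using sum_squares_bound[of "\<bar>x\<bar>" "\<bar>y\<bar>"] abs_ge_zero[of "x * y"]
      unfolding abs_mult power2_abs power2_eq_square abs_mult_self_eq by linarith
    then have "\<bar>?c a b i\<bar> \<le> (\<Sum>k<n. traj K i (v k) $ a * traj K i (v k) $ a + traj K i (v k) $ b * traj K i (v k) $ b)"
      by (intro order_trans[OF sum_abs] sum_mono)
    then have "\<bar>?c a b i\<bar> \<le> ?c a a i + ?c b b i" by (simp add: sum.distrib)
    then have "\<gamma> ^ i * \<bar>?c a b i\<bar> \<le> \<gamma> ^ i * (?c a a i + ?c b b i)" using \<gamma>_pos by (intro mult_left_mono) auto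
    then show "norm \<bar>\<gamma> ^ i * ?c a b i\<bar> \<le> \<gamma> ^ i * ?c a a i + \<gamma> ^ i * ?c b b i"
      using \<gamma>_pos by (simp add: abs_mult distrib_left)
  qed
  from discounted_partial_sums[OF this \<gamma>_pos \<gamma>_less_1]
  have "(\<lambda>t. \<gamma> ^ t * second_moment M n (state P K t) $$ (a,b)) sums (\<gamma> / (1 - \<gamma>) * (\<Sum>i. \<gamma> ^ i * ?c a b i))"
    by (simp add: second_moment_state[OF K(1) v ab])
  then show "Sigma_mat P \<gamma> K $$ (a,b) = ((\<gamma> / (1 - \<gamma>)) \<cdot>\<^sub>m occupancy v K) $$ (a,b)"
    using ab carrier_matD[OF occupancy_carrier[of v K]] by (simp add: Sigma_mat_def occupancy_def sums_iff)
qed (auto simp: Sigma_mat_def occupancy_def)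

text \<open>
  The first part tests \<open>Sigma_mat\<close> on a unit vector; the second replaces it by the multiple
  \<open>\<parallel>Sigma_mat\<parallel> 1\<close> of the identity.
\<close>
lemma spectral_Sigma:
  assumes K: "policy P K" "finite_cost K" and v: "factors v (D\<omega>_tilde P)"
  shows "\<gamma> / (1 - \<gamma>) * sD \<le> spectral_norm (Sigma_mat P \<gamma> K)"
    "\<And>N. N \<in> carrier_mat n n \<Longrightarrow> (\<And>x. x \<in> carrier_vec n \<Longrightarrow> 0 \<le> x \<bullet> (N *\<^sub>v x)) \<Longrightarrow>
      \<gamma> / (1 - \<gamma>) * trace (N * occupancy v K) \<le> spectral_norm (Sigma_mat P \<gamma> K) * trace N"
proof -
  let ?s = "spectral_norm (Sigma_mat P \<gamma> K)" and ?c = "\<gamma> / (1 - \<gamma>)"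
  have Sc: "Sigma_mat P \<gamma> K \<in> carrier_mat n n" by (simp add: Sigma_mat_def)
  have c0: "0 < ?c" using \<gamma>_pos \<gamma>_less_1 by simp
  show *: "?c * trace (N * occupancy v K) \<le> ?s * trace N"
    if N: "N \<in> carrier_mat n n" "\<And>x. x \<in> carrier_vec n \<Longrightarrow> 0 \<le> x \<bullet> (N *\<^sub>v x)" for N
  proof -
    have "trace (N * Sigma_mat P \<gamma> K) \<le> trace (N * (?s \<cdot>\<^sub>m 1\<^sub>m n))"
    proof (rule trace_mult_mono[of _ n])
      show "(?s \<cdot>\<^sub>m 1\<^sub>m n)\<^sup>T = ?s \<cdot>\<^sub>m 1\<^sub>m n" by (rule eq_matI) auto
      show "(Sigma_mat P \<gamma> K)\<^sup>T = Sigma_mat P \<gamma> K"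
        unfolding Sigma_mat_eq[OF K v] by (rule eq_matI) (auto simp: occupancy_def mult_ac)
      show "x \<bullet> (Sigma_mat P \<gamma> K *\<^sub>v x) \<le> x \<bullet> ((?s \<cdot>\<^sub>m 1\<^sub>m n) *\<^sub>v x)" if "x \<in> carrier_vec n" for x
        using bilinear_le_spectral[OF Sc that] that by (simp add: scaled_identity_bilinear)
    qed (use N Sc in auto)
    then show ?thesis using N by (simp add: Sigma_mat_eq[OF K v] trace_mult_smult)
  qed
  \<comment> \<open>Any unit vector would do.\<close>
  let ?N = "outer n (unit_vec n 0)"
  have N: "0 \<le> x \<bullet> (?N *\<^sub>v x)" if "x \<in> carrier_vec n" for x
    using that by (simp add: outer_quad)
  have trN: "trace ?N = 1"
  proof -
    have "trace ?N = trace (1\<^sub>m n * ?N)" by (simp add: left_mult_one_mat[of _ n n])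
    also have "\<dots> = unit_vec n 0 \<bullet> (1\<^sub>m n *\<^sub>v unit_vec n 0)" by (rule trace_mult_outer) auto
    finally show ?thesis by simp
  qed
  have "sD * trace ?N \<le> trace (?N * D\<omega>_tilde P)" by (rule trace_le_trace_noise) (use N in auto)
  also have "\<dots> \<le> trace (?N * occupancy v K)" by (rule trace_occupancy_ge[OF K v]) (use N in auto)
  finally have "?c * sD \<le> ?c * trace (?N * occupancy v K)" using c0 trN by (intro mult_left_mono) auto
  then show "?c * sD \<le> ?s" using *[of ?N] N trN by simp
qed

end

section \<open>One approximate improvement step\<close>

text \<open>
  With \<open>f = (1 - \<gamma>) J(K0)\<close>, the traces of all iterates against the noise covariance are at most \<open>4 f\<close>, so
  \<open>4 f / sd\<close> bounds the norm of \<open>P_mat\<close> and \<open>4 f r a b / sd\<close> that of the greedy gain. The rest balances the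
  error of one step against its contraction. The value outside the relevant range only has to be positive.
\<close>
definition step_const :: "real \<Rightarrow> real \<Rightarrow> real \<Rightarrow> real \<Rightarrow> real \<Rightarrow> real \<Rightarrow> real" where
  "step_const sd ss r a b f =
    (if 0 < sd \<and> 0 < ss \<and> 0 < r \<and> 0 \<le> a \<and> 0 \<le> b \<and> 0 < f
     then sqrt ((ss * sd) ^ 3 / (64 * r * (1 + 4 * f * r * a * b / sd)\<^sup>2 * (f + ss * sd))) else 1)"

lemma step_const_pos: "0 < step_const sd ss r a b f"
proof (cases "0 < sd \<and> 0 < ss \<and> 0 < r \<and> 0 \<le> a \<and> 0 \<le> b \<and> 0 < f")
  case True
  then have "0 \<le> 4 * f * r * a * b / sd" by simp
  then have k: "0 < (1 + 4 * f * r * a * b / sd)\<^sup>2" by (intro zero_less_power) linarith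
  have "0 < (ss * sd) ^ 3 / (64 * r * (1 + 4 * f * r * a * b / sd)\<^sup>2 * (f + ss * sd))"
    using True by (intro divide_pos_pos mult_pos_pos k) (auto intro: add_pos_pos)
  then have "0 < sqrt ((ss * sd) ^ 3 / (64 * r * (1 + 4 * f * r * a * b / sd)\<^sup>2 * (f + ss * sd)))"
    by (rule real_sqrt_gt_zero)
  then show ?thesis unfolding step_const_def if_P[OF True] .
next
  case False
  show ?thesis unfolding step_const_def if_not_P[OF False] by simp
qed

text \<open>
  The factor \<open>(1 - z)\<^sup>N\<close> is at most \<open>exp (- z N)\<close>, and \<open>z (x - 1) \<ge> 4 - z \<ge> 1\<close>; the slack in \<open>z x\<close> pays for
  the \<open>- 1\<close> in the number of iterations.
\<close>
lemma contraction_horizon: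
  fixes N :: nat
  assumes g: "0 \<le> g" and \<epsilon>: "0 < \<epsilon>" and z: "0 < z" "z \<le> 1 / 2" and zx: "4 \<le> z * x"
    and N: "(x - 1) * ln (g / \<epsilon>) \<le> real N"
  shows "(1 - z) ^ N * g \<le> \<epsilon>"
proof (cases "g \<le> \<epsilon>")
  case True
  have "(1 - z) ^ N * g \<le> 1 * g" using z g by (intro mult_right_mono power_le_one) auto
  then show ?thesis using True by simp
next
  case False
  define L where "L = ln (g / \<epsilon>)"
  have L: "0 < L" using False \<epsilon> by (simp add: L_def)
  have "L \<le> (z * x - z) * L" using zx z L by simp
  also have "\<dots> = z * ((x - 1) * L)" by (simp add: algebra_simps)
  also have "\<dots> \<le> z * real N" using N z by (intro mult_left_mono) (auto simp: L_def)
  finally have zN: "L \<le> real N * z" by (simp add: mult.commute)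
  have "(1 - z) ^ N \<le> exp (- z) ^ N" using exp_ge_add_one_self[of "- z"] z by (intro power_mono) auto
  also have "\<dots> = exp (- (real N * z))" by (simp add: exp_of_nat_mult[symmetric])
  also have "\<dots> \<le> exp (- L)" using zN by simp
  also have "exp (- L) = \<epsilon> / g" using False \<epsilon> g by (simp add: L_def exp_minus)
  finally have "(1 - z) ^ N * g \<le> \<epsilon> / g * g" using g by (rule mult_right_mono)
  then show ?thesis using False \<epsilon> by simp
qed

context discounted_lqr
begin

abbreviation "rR \<equiv> spectral_norm (minv R)"

lemma rR_pos: "0 < rR" by (rule pos_def_minv_coercive(1)[OF pos_def_R dims(2)])

lemma Bt_bound:
  assumes y: "y \<in> carrier_vec n"
  shows "vnorm (B\<^sup>T *\<^sub>v y) \<le> spectral_norm B * vnorm y"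
proof -
  have u: "B\<^sup>T *\<^sub>v y \<in> carrier_vec d" using y by simp
  have "vnorm (B\<^sup>T *\<^sub>v y) * vnorm (B\<^sup>T *\<^sub>v y) = y \<bullet> (B *\<^sub>v (B\<^sup>T *\<^sub>v y))"
    using transpose_vec_mult_scalar[OF dims(4) u y] by (simp add: vnorm_sq[symmetric] power2_eq_square)
  also have "\<dots> \<le> vnorm y * vnorm (B *\<^sub>v (B\<^sup>T *\<^sub>v y))"
    using vec_cauchy_schwarz[OF y Bu_carrier[OF u]] by linarith
  also have "\<dots> \<le> vnorm y * (spectral_norm B * vnorm (B\<^sup>T *\<^sub>v y))"
    by (intro mult_left_mono vnorm_mult_le_spectral[OF dims(4) u]) simp
  finally have "vnorm (B\<^sup>T *\<^sub>v y) * vnorm (B\<^sup>T *\<^sub>v y) \<le> (spectral_norm B * vnorm y) * vnorm (B\<^sup>T *\<^sub>v y)"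
    by (simp only: mult_ac)
  then show ?thesis
    by (rule mult_self_le_imp_le) (use spectral_norm_nonneg[OF dims(4) dims(2)] in simp_all)
qed

text \<open>
  The form of \<open>P_mat\<close> is bounded through its trace against the noise covariance; the norm bound follows from
  the Cauchy-Schwarz inequality for that form.
\<close>
lemma P_mat_bound:
  assumes K: "policy P K" "finite_cost K" and y: "y \<in> carrier_vec n" and c: "trace (P_mat P \<gamma> K * D\<omega>_tilde P) \<le> c * sD"
  shows "vnorm (P_mat P \<gamma> K *\<^sub>v y) \<le> c * vnorm y"
proof -
  let ?P = "P_mat P \<gamma> K"
  have pc: "x \<bullet> (?P *\<^sub>v x) \<le> c * (x \<bullet> x)" if x: "x \<in> carrier_vec n" for x
  proof -
    have "sD * (x \<bullet> (?P *\<^sub>v x)) \<le> (x \<bullet> x) * trace (?P * D\<omega>_tilde P)"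
      using cost_to_go_nonneg[OF K] sD_pos x
      by (intro quad_le_trace[of _ n] D\<omega>_tilde_carrier D\<omega>_tilde_sym pos_def_\<sigma>_min(2)[OF pos_def_D\<omega>_tilde dims(1)] P_mat_carrier)
        (auto simp: cost_to_go_def)
    also have "\<dots> \<le> (x \<bullet> x) * (c * sD)" using c by (intro mult_left_mono) simp_all
    finally have "sD * (x \<bullet> (?P *\<^sub>v x)) \<le> sD * (c * (x \<bullet> x))" by (simp add: mult_ac)
    then show ?thesis using sD_pos by simp
  qed
  let ?z = "?P *\<^sub>v y"
  have z: "?z \<in> carrier_vec n" using y by simp
  have P0: "0 \<le> v \<bullet> (?P *\<^sub>v v)" if "v \<in> carrier_vec n" for v
    using cost_to_go_nonneg[OF K that] by (simp add: cost_to_go_def)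
  have "0 < c * sD" using c trace_P_mat_lower(1)[OF K] mult_pos_pos[OF sS_pos sD_pos] by linarith
  then have c0: "0 \<le> c" using zero_less_mult_pos2[OF _ sD_pos] by (intro less_imp_le)
  have "((vnorm ?z)\<^sup>2)\<^sup>2 \<le> (?z \<bullet> (?P *\<^sub>v ?z)) * (y \<bullet> (?P *\<^sub>v y))"
    using psd_cauchy_schwarz[OF P_mat_carrier P_mat_sym[OF K] P0 z y] by (simp add: vnorm_sq)
  also have "\<dots> \<le> (c * (?z \<bullet> ?z)) * (c * (y \<bullet> y))"
    using c0 by (intro mult_mono pc P0 z y) simp_all
  also have "\<dots> = (c * vnorm y * vnorm ?z)\<^sup>2" by (simp add: vnorm_sq[symmetric] power2_eq_square)
  finally have "(vnorm ?z)\<^sup>2 \<le> c * vnorm y * vnorm ?z"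
    using c0 by (intro power2_le_imp_le[of "(vnorm ?z)\<^sup>2"]) simp_all
  then have "vnorm ?z * vnorm ?z \<le> (c * vnorm y) * vnorm ?z" by (simp add: power2_eq_square)
  then show ?thesis by (rule mult_self_le_imp_le) (use c0 in simp_all)
qed

text \<open>
  Test the equation \<open>Hess K (greedy K x) = - Cross K x\<close> with the greedy action itself.
\<close>
lemma greedy_bound:
  assumes K: "policy P K" "finite_cost K" and x: "x \<in> carrier_vec n" and c: "trace (P_mat P \<gamma> K * D\<omega>_tilde P) \<le> c * sD"
  shows "vnorm (greedy K *\<^sub>v x) \<le> rR * spectral_norm A * spectral_norm B * c * vnorm x"
proof -
  let ?u = "greedy K *\<^sub>v x" and ?P = "P_mat P \<gamma> K"
  let ?w = "?P *\<^sub>v (A *\<^sub>v x)"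
  have u: "?u \<in> carrier_vec d" using greedy(1)[OF K] x by simp
  have w: "?w \<in> carrier_vec n" using x by simp
  have nb: "0 \<le> spectral_norm B" and na: "0 \<le> spectral_norm A"
    using spectral_norm_nonneg[OF dims(4) dims(2)] spectral_norm_nonneg[OF dims(3) dims(1)] by auto
  have "0 < c * sD" using c trace_P_mat_lower(1)[OF K] mult_pos_pos[OF sS_pos sD_pos] by linarith
  then have c0: "0 \<le> c" using zero_less_mult_pos2[OF _ sD_pos] by (intro less_imp_le)
  have "vnorm ?w \<le> c * vnorm (A *\<^sub>v x)" by (rule P_mat_bound[OF K Ax_carrier[OF x] c])
  also have "\<dots> \<le> c * (spectral_norm A * vnorm x)" using c0 by (intro mult_left_mono vnorm_mult_le_spectral[OF dims(3) x])
  finally have w_le: "vnorm ?w \<le> c * (spectral_norm A * vnorm x)" .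
  have "?u \<bullet> (Hess K *\<^sub>v ?u) = - (?u \<bullet> (Cross K *\<^sub>v x))"
    unfolding greedy(2)[OF K x] using carrier_vecD[OF u] carrier_vecD[OF mult_mat_vec_carrier[OF Cross_carrier x]]
    by (subst scalar_prod_uminus_right) (simp_all del: dim_mult_mat_vec)
  also have "\<dots> = - \<gamma> * (?u \<bullet> (B\<^sup>T *\<^sub>v ?w))"
    unfolding Cross_bilinear[OF u x] mult_transpose_move[OF dims(4) u w] by simp
  also have "\<dots> \<le> 1 * \<bar>?u \<bullet> (B\<^sup>T *\<^sub>v ?w)\<bar>"
  proof -
    have "- \<gamma> * t \<le> 1 * \<bar>t\<bar>" for t
    proof -
      have "\<gamma> * (- t) \<le> \<gamma> * \<bar>t\<bar>" using \<gamma>_pos by (intro mult_left_mono) auto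
      also have "\<dots> \<le> 1 * \<bar>t\<bar>" using \<gamma>_less_1 by (intro mult_right_mono) auto
      finally show ?thesis by simp
    qed
    then show ?thesis .
  qed
  also have "\<dots> \<le> vnorm ?u * vnorm (B\<^sup>T *\<^sub>v ?w)"
    using vec_cauchy_schwarz[OF u Bt_carrier[OF w]] by simp
  also have "\<dots> \<le> vnorm ?u * (spectral_norm B * (c * (spectral_norm A * vnorm x)))"
    using w_le nb by (intro mult_left_mono order_trans[OF Bt_bound[OF w]]) simp_all
  finally have H: "?u \<bullet> (Hess K *\<^sub>v ?u) \<le> vnorm ?u * (spectral_norm B * (c * (spectral_norm A * vnorm x)))" .
  have "vnorm ?u * vnorm ?u \<le> rR * (?u \<bullet> (Hess K *\<^sub>v ?u))"
    using Hess_coercive[OF K u] by (simp add: vnorm_sq[symmetric] power2_eq_square)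
  also have "\<dots> \<le> rR * (vnorm ?u * (spectral_norm B * (c * (spectral_norm A * vnorm x))))"
    using H rR_pos by (intro mult_left_mono) simp_all
  finally have "vnorm ?u * vnorm ?u \<le> (rR * spectral_norm A * spectral_norm B * c * vnorm x) * vnorm ?u"
    by (simp only: mult_ac)
  then show ?thesis by (rule mult_self_le_imp_le) (use c0 na nb rR_pos in simp_all)
qed

lemma approximates_QD:
  assumes "approximates_Q P \<gamma> e \<Theta> K"
  shows "\<Theta>22 \<Theta> \<in> carrier_mat d d" "\<Theta>21 \<Theta> \<in> carrier_mat d n"
    "frob_norm (\<Theta>22 \<Theta> - Hess K) \<le> e" "frob_norm (\<Theta>21 \<Theta> - Cross K) \<le> e"
proof -
  show "\<Theta>22 \<Theta> \<in> carrier_mat d d" "\<Theta>21 \<Theta> \<in> carrier_mat d n"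
    using assms by (auto simp: approximates_Q_def is_params_def)
  have dist: "params_dist \<Theta> (\<Theta>_star P \<gamma> K) \<le> e" using assms by (simp add: approximates_Q_def)
  have "frob_norm (\<Theta>22 \<Theta> - \<Theta>22 (\<Theta>_star P \<gamma> K)) \<le> params_dist \<Theta> (\<Theta>_star P \<gamma> K)"
    unfolding params_dist_def by (rule real_le_rsqrt) simp
  then show "frob_norm (\<Theta>22 \<Theta> - Hess K) \<le> e" using dist by (simp add: \<Theta>_star_def Hess_def)
  have "frob_norm (\<Theta>21 \<Theta> - \<Theta>21 (\<Theta>_star P \<gamma> K)) \<le> params_dist \<Theta> (\<Theta>_star P \<gamma> K)"
    unfolding params_dist_def by (rule real_le_rsqrt) simp
  then show "frob_norm (\<Theta>21 \<Theta> - Cross K) \<le> e" using dist by (simp add: \<Theta>_star_def Cross_def)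
qed

lemma approximate_greedy_excess:
  assumes K: "policy P K" "finite_cost K" and c: "trace (P_mat P \<gamma> K * D\<omega>_tilde P) \<le> c * sD"
    and appr: "approximates_Q P \<gamma> e \<Theta> K" and small: "2 * rR * e \<le> 1"
    and K': "K' = - (minv (\<Theta>22 \<Theta>) * \<Theta>21 \<Theta>)"
  shows "policy P K'"
    "\<And>x. x \<in> carrier_vec n \<Longrightarrow>
      excess K K' x \<le> 4 * rR * e\<^sup>2 * (1 + rR * spectral_norm A * spectral_norm B * c)\<^sup>2 * (x \<bullet> x)"
proof -
  note \<Theta> = approximates_QD[OF appr]
  have inj: "v = 0\<^sub>v d" if "v \<in> carrier_vec d" "\<Theta>22 \<Theta> *\<^sub>v v = 0\<^sub>v d" for v
    by (rule perturbed_system_inj[OF Hess_carrier \<Theta>(1) Hess_coercive[OF K] \<Theta>(3) small rR_pos that])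
  show pK': "policy P K'" unfolding policy_def K' by (rule minv_solve(1)[OF \<Theta>(1,2) inj zero_carrier_vec])
  fix x :: "real vec" assume x: "x \<in> carrier_vec n"
  let ?u = "greedy K *\<^sub>v x"
  have u: "?u \<in> carrier_vec d" using greedy(1)[OF K] x by simp
  have sol: "\<Theta>22 \<Theta> *\<^sub>v (K' *\<^sub>v x) = - (\<Theta>21 \<Theta> *\<^sub>v x)"
    unfolding K' by (rule minv_solve(2)[OF \<Theta>(1,2) inj x])
  have "excess K K' x \<le> 4 * rR * e\<^sup>2 * (vnorm x + vnorm ?u)\<^sup>2"
    unfolding excess_def
    by (rule perturbed_system_error[OF Hess_carrier \<Theta>(1) Cross_carrier \<Theta>(2) Hess_coercive[OF K] \<Theta>(3,4)
          small rR_pos x u greedy(2)[OF K x] Kx_carrier[OF pK' x] sol])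
  also have "\<dots> \<le> 4 * rR * e\<^sup>2 * ((1 + rR * spectral_norm A * spectral_norm B * c) * vnorm x)\<^sup>2"
    using greedy_bound[OF K x c] rR_pos by (intro mult_left_mono power_mono) (simp_all add: distrib_right)
  finally show "excess K K' x \<le> 4 * rR * e\<^sup>2 * (1 + rR * spectral_norm A * spectral_norm B * c)\<^sup>2 * (x \<bullet> x)"
    by (simp add: power_mult_distrib vnorm_sq mult.assoc)
qed

definition J_real :: "real mat \<Rightarrow> real" where
  "J_real K = \<gamma> / (1 - \<gamma>) * trace (P_mat P \<gamma> K * D\<omega>_tilde P) + (sigma P)\<^sup>2 * trace R / (1 - \<gamma>)"

lemma J_eq_J_real: "policy P K \<Longrightarrow> finite_cost K \<Longrightarrow> J P \<gamma> K = ereal (J_real K)"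
  by (simp add: J_formula J_real_def)

text \<open>
  Write \<open>T\<close> for the traces, \<open>h = \<gamma>/(1 - \<gamma>)\<close>, \<open>s\<close> for the norm of \<open>Sigma_mat\<close> at the optimum and \<open>F\<close> for the trace of the
  excess matrix. Improvement gives \<open>T K' \<le> T K + (2 c / \<sigma>_min S) T K - \<sigma>_min D F\<close>, and
  \<open>h (T K - T Ko) \<le> s F\<close> turns the last term into the contraction by \<open>y\<close>. The choice of
  \<open>step_const\<close> makes \<open>h\<close> times the middle term at most \<open>(y/2) \<epsilon>\<close>, and \<open>c\<close> small enough for the cost to stay finite.
\<close>
lemma approximate_policy_iteration_step:
  assumes \<gamma>: "1 / 2 \<le> \<gamma>"
    and K: "policy P K" "finite_cost K" and Ko: "policy P Ko" "finite_cost Ko"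
    and f: "0 < f" "trace (P_mat P \<gamma> K * D\<omega>_tilde P) \<le> 4 * f"
    and appr: "approximates_Q P \<gamma> e \<Theta> K" and small: "2 * rR * e \<le> 1"
    and e: "e \<le> step_const sD sS rR (spectral_norm A) (spectral_norm B) f * sqrt \<epsilon>
        / (sqrt (spectral_norm (Sigma_mat P \<gamma> Ko)) * J_real Ko)"
    and \<epsilon>: "0 < \<epsilon>" "\<epsilon> \<le> J_real Ko"
    and K': "K' = - (minv (\<Theta>22 \<Theta>) * \<Theta>21 \<Theta>)"
    and y: "y = \<gamma> / (1 - \<gamma>) * sD / spectral_norm (Sigma_mat P \<gamma> Ko)"
  shows "policy P K'" "finite_cost K'" "J_real K' - J_real Ko \<le> (1 - y) * (J_real K - J_real Ko) + y / 2 * \<epsilon>"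
proof -
  define X where "X = sS * sD"
  define h where "h = \<gamma> / (1 - \<gamma>)"
  define s where "s = spectral_norm (Sigma_mat P \<gamma> Ko)"
  define \<kappa> where "\<kappa> = 4 * f * rR * spectral_norm A * spectral_norm B / sD"
  define c where "c = 4 * rR * e\<^sup>2 * (1 + \<kappa>)\<^sup>2"
  define T where "T = (\<lambda>K. trace (P_mat P \<gamma> K * D\<omega>_tilde P))"
  obtain w where w: "factors w (D\<omega>_tilde P)" using factors_exist by blast
  have nb: "0 \<le> spectral_norm B" and na: "0 \<le> spectral_norm A"
    using spectral_norm_nonneg[OF dims(4) dims(2)] spectral_norm_nonneg[OF dims(3) dims(1)] by auto
  have X: "0 < X" using sS_pos sD_pos by (simp add: X_def)
  have h: "1 \<le> h" using \<gamma> \<gamma>_less_1 by (simp add: h_def)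
  have \<kappa>: "0 \<le> \<kappa>" using f rR_pos sD_pos na nb by (simp add: \<kappa>_def)
  have sh: "h * sD \<le> s" unfolding h_def s_def by (rule spectral_Sigma(1)[OF Ko w])
  have "1 * sD \<le> h * sD" using h sD_pos by (intro mult_right_mono) auto
  then have sd: "sD \<le> s" using sh by linarith
  then have s: "0 < s" using sD_pos by linarith
  have Tlow: "X \<le> T Ko" unfolding X_def T_def by (rule trace_P_mat_lower(1)[OF Ko])
  have q: "0 \<le> (sigma P)\<^sup>2 * trace R / (1 - \<gamma>)" using trace_R_nonneg \<gamma>_less_1 by simp
  have "1 * X \<le> h * T Ko" using h X Tlow by (intro mult_mono) auto
  then have JX: "X \<le> J_real Ko" using q by (simp add: J_real_def h_def T_def)
  then have J: "0 < J_real Ko" using X by linarith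
  have e0: "0 \<le> e" using approximates_QD(3)[OF appr] frob_norm_nonneg order_trans by blast
  have C: "(step_const sD sS rR (spectral_norm A) (spectral_norm B) f)\<^sup>2 = X ^ 3 / (64 * rR * (1 + \<kappa>)\<^sup>2 * (f + X))"
  proof -
    have cond: "0 < sD \<and> 0 < sS \<and> 0 < rR \<and> 0 \<le> spectral_norm A \<and> 0 \<le> spectral_norm B \<and> 0 < f"
      using sD_pos sS_pos rR_pos na nb f(1) by blast
    have "0 \<le> X ^ 3 / (64 * rR * (1 + \<kappa>)\<^sup>2 * (f + X))"
      using X rR_pos f(1) by (intro divide_nonneg_nonneg mult_nonneg_nonneg) auto
    then show ?thesis unfolding step_const_def if_P[OF cond] X_def[symmetric] \<kappa>_def[symmetric] by (rule real_sqrt_pow2)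
  qed
  have "e\<^sup>2 \<le> (step_const sD sS rR (spectral_norm A) (spectral_norm B) f * sqrt \<epsilon> / (sqrt s * J_real Ko))\<^sup>2"
    using e e0 unfolding s_def by (rule power_mono)
  also have "\<dots> = X ^ 3 / (64 * rR * (1 + \<kappa>)\<^sup>2 * (f + X)) * \<epsilon> / (s * (J_real Ko)\<^sup>2)"
    using \<epsilon> s by (simp add: power_mult_distrib power_divide C)
  finally have e2: "e\<^sup>2 \<le> X ^ 3 / (64 * rR * (1 + \<kappa>)\<^sup>2 * (f + X)) * \<epsilon> / (s * (J_real Ko)\<^sup>2)" .
  have k1: "0 < (1 + \<kappa>)\<^sup>2" using \<kappa> by (intro zero_less_power) linarith
  have "c \<le> 4 * rR * (X ^ 3 / (64 * rR * (1 + \<kappa>)\<^sup>2 * (f + X)) * \<epsilon> / (s * (J_real Ko)\<^sup>2)) * (1 + \<kappa>)\<^sup>2"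
    unfolding c_def using e2 rR_pos by (intro mult_right_mono mult_left_mono) auto
  also have "\<dots> = X ^ 3 / (16 * (f + X)) * \<epsilon> / (s * (J_real Ko)\<^sup>2)"
  proof -
    have "4 * r * (Z / (64 * r * k * D) * \<epsilon> / j) * k = Z / (16 * D) * \<epsilon> / j"
      if "0 < r" "0 < k" for r k Z D j :: real
    proof -
      have "Z / (64 * r * k * D) = Z / (16 * D) / (4 * r * k)" by simp
      then show ?thesis using that by simp
    qed
    from this[OF rR_pos k1] show ?thesis .
  qed
  finally have c_le: "c \<le> X ^ 3 / (16 * (f + X)) * \<epsilon> / (s * (J_real Ko)\<^sup>2)" .
  have c0: "0 \<le> c" using rR_pos by (simp add: c_def)
  have sJ: "0 < s * (J_real Ko)\<^sup>2" using s J by simp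
  have cs: "c * (s * (J_real Ko)\<^sup>2) * (16 * (f + X)) \<le> X ^ 3 * \<epsilon>"
  proof -
    have "c * (s * (J_real Ko)\<^sup>2) \<le> X ^ 3 / (16 * (f + X)) * \<epsilon>" using c_le unfolding pos_le_divide_eq[OF sJ] .
    then have "c * (s * (J_real Ko)\<^sup>2) * (16 * (f + X)) \<le> X ^ 3 / (16 * (f + X)) * \<epsilon> * (16 * (f + X))"
      using f X by (intro mult_right_mono) auto
    also have "\<dots> = X ^ 3 * \<epsilon>" using f X by simp
    finally show ?thesis .
  qed
  \<comment> \<open>The optimal cost is at least \<open>X\<close> and \<open>\<epsilon>\<close>, so the bound on \<open>c\<close> becomes absolute.\<close>
  have chalf: "c \<le> sS / 2"
  proof -
    have "X * \<epsilon> \<le> (J_real Ko)\<^sup>2" unfolding power2_eq_square by (rule mult_mono) (use JX \<epsilon> J in simp_all)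
    then have "sD * (X * \<epsilon>) \<le> s * (J_real Ko)\<^sup>2" by (intro mult_mono sd) (use s X \<epsilon> in simp_all)
    then have "c * (sD * (X * \<epsilon>)) \<le> c * (s * (J_real Ko)\<^sup>2)" using c0 by (rule mult_left_mono)
    then have "c * (sD * (X * \<epsilon>)) * (16 * X) \<le> c * (s * (J_real Ko)\<^sup>2) * (16 * (f + X))"
      by (rule mult_mono) (use f X c0 sJ in \<open>auto intro!: mult_nonneg_nonneg\<close>)
    also have "\<dots> \<le> X ^ 3 * \<epsilon>" by (rule cs)
    finally have "(16 * (c * sD)) * (X * X * \<epsilon>) \<le> X * (X * X * \<epsilon>)" unfolding power3_eq_cube by (simp only: mult_ac)
    moreover have "0 < X * X * \<epsilon>" using X \<epsilon> by simp
    ultimately have "16 * (c * sD) \<le> X" by (rule mult_right_le_imp_le)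
    then have "(16 * c) * sD \<le> sS * sD" by (simp add: X_def mult.assoc)
    then have "16 * c \<le> sS" using sD_pos by (rule mult_right_le_imp_le)
    then show ?thesis using c0 by linarith
  qed
  have Tc: "trace (P_mat P \<gamma> K * D\<omega>_tilde P) \<le> (4 * f / sD) * sD" using f sD_pos by simp
  note ag = approximate_greedy_excess[OF K Tc appr small K']
  show pK': "policy P K'" by (rule ag(1))
  have near: "excess K K' x \<le> c * (x \<bullet> x)" if "x \<in> carrier_vec n" for x
    using ag(2)[OF that] by (simp add: c_def \<kappa>_def mult_ac)
  show finK': "finite_cost K'" by (rule near_greedy_finite_cost(1)[OF K pK' near chalf])
  have em0: "0 \<le> x \<bullet> (excess_mat K *\<^sub>v x)" if "x \<in> carrier_vec n" for x
    unfolding excess_mat(2)[OF K that] by (rule excess_nonneg[OF K K(1) that])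
  define F where "F = trace (excess_mat K)"
  have "T K' \<le> T K + 2 * c / sS * T K - trace (excess_mat K * D\<omega>_tilde P)"
    unfolding T_def by (rule near_greedy_improves[OF K pK' near c0 chalf w])
  moreover have "sD * F \<le> trace (excess_mat K * D\<omega>_tilde P)"
    unfolding F_def by (rule trace_le_trace_noise[OF excess_mat(1)[OF K] em0])
  ultimately have "T K' \<le> T K + 2 * c / sS * T K - sD * F" by linarith
  then have "h * T K' \<le> h * (T K + 2 * c / sS * T K - sD * F)" using h by (intro mult_left_mono) auto
  then have imp: "h * (T K' - T Ko) \<le> h * (T K - T Ko) + h * (2 * c / sS * T K) - h * sD * F"
    by (simp add: right_diff_distrib distrib_left mult.assoc)
  have "T K - T Ko \<le> trace (excess_mat K * occupancy w Ko)"
    unfolding T_def by (rule gap_le_excess[OF K Ko w])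
  then have "h * (T K - T Ko) \<le> h * trace (excess_mat K * occupancy w Ko)" using h by (intro mult_left_mono) auto
  also have "\<dots> \<le> s * F"
    unfolding h_def s_def F_def by (rule spectral_Sigma(2)[OF Ko w excess_mat(1)[OF K] em0])
  finally have gF: "h * (T K - T Ko) \<le> s * F" .
  have y': "y = h * sD / s" by (simp add: y h_def s_def)
  have y0: "0 < y" using h sD_pos s by (simp add: y')
  have "y * (h * (T K - T Ko)) \<le> y * (s * F)" using gF y0 by (intro mult_left_mono) auto
  also have "\<dots> = h * sD * F" using s by (simp add: y')
  finally have yg: "y * (h * (T K - T Ko)) \<le> h * sD * F" .
  have err: "h * (2 * c / sS * T K) \<le> y / 2 * \<epsilon>"
  proof -
    have T0: "0 \<le> T K" using trace_P_mat_lower(1)[OF K] X by (simp add: T_def X_def)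
    have "4 * c * T K \<le> 4 * c * (4 * f)" using f(2) c0 by (intro mult_left_mono) (simp_all add: T_def)
    then have 1: "4 * c * T K * s \<le> 4 * c * (4 * f) * s" using s by (intro mult_right_mono) simp_all
    have 2: "4 * (X * X) \<le> 4 * (J_real Ko)\<^sup>2"
      unfolding power2_eq_square by (intro mult_left_mono mult_mono JX) (use X J in simp_all)
    have "(4 * c * T K * s) * (4 * (X * X)) \<le> (4 * c * (4 * f) * s) * (4 * (J_real Ko)\<^sup>2)"
      by (rule mult_mono[OF 1 2]) (use c0 s f in simp_all)
    also have "\<dots> = 4 * (c * (s * (J_real Ko)\<^sup>2) * (16 * f))"
    proof -
      have "(4 * c * (4 * f) * s) * (4 * j) = 4 * (c * (s * j) * (16 * f))" for c f s j :: real by simp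
      then show ?thesis .
    qed
    also have "\<dots> \<le> 4 * (c * (s * (J_real Ko)\<^sup>2) * (16 * (f + X)))"
      using c0 sJ X by (intro mult_left_mono) auto
    also have "\<dots> \<le> 4 * (X ^ 3 * \<epsilon>)" using cs by (rule mult_left_mono) simp
    also have "\<dots> = (X * \<epsilon>) * (4 * (X * X))" unfolding power3_eq_cube by (simp only: mult_ac)
    finally have "(4 * c * T K * s) * (4 * (X * X)) \<le> (X * \<epsilon>) * (4 * (X * X))" .
    moreover have "0 < 4 * (X * X)" using X by simp
    ultimately have "4 * c * T K * s \<le> X * \<epsilon>" by (rule mult_right_le_imp_le)
    then have "h * (4 * c * T K * s) \<le> h * (X * \<epsilon>)" using h by (intro mult_left_mono) auto
    then have "h * (4 * c * T K * s) / (2 * sS * s) \<le> h * (X * \<epsilon>) / (2 * sS * s)"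
      using sS_pos s by (intro divide_right_mono) auto
    moreover have "h * (4 * c * T K * s) / (2 * sS * s) = h * (2 * c / sS * T K)" using sS_pos s by simp
    moreover have "h * (X * \<epsilon>) / (2 * sS * s) = y / 2 * \<epsilon>" using sS_pos s by (simp add: y' X_def)
    ultimately show ?thesis by simp
  qed
  have gap: "J_real L - J_real Ko = h * (T L - T Ko)" for L by (simp add: J_real_def h_def T_def right_diff_distrib)
  show "J_real K' - J_real Ko \<le> (1 - y) * (J_real K - J_real Ko) + y / 2 * \<epsilon>"
    using imp yg err unfolding gap left_diff_distrib by linarith
qed

end

section \<open>Iterating the step\<close>

context discounted_lqr
begin

lemma global_minimizerD:
  assumes Ko: "global_minimizer P \<gamma> Ko" and K: "policy P K" "finite_cost K"
  shows "policy P Ko" "finite_cost Ko" "J_real Ko \<le> J_real K"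
proof -
  show p: "policy P Ko" using Ko by (simp add: global_minimizer_def)
  have le: "J P \<gamma> Ko \<le> ereal (J_real K)"
    using Ko K(1) unfolding global_minimizer_def J_eq_J_real[OF K, symmetric] by blast
  then show f: "finite_cost Ko" by (intro finite_cost_if_J_finite p) auto
  show "J_real Ko \<le> J_real K" using le unfolding J_eq_J_real[OF p f] by simp
qed

lemma trace_P_mat_le_J_real:
  assumes "1 / 2 \<le> \<gamma>" "0 \<le> J_real K"
  shows "trace (P_mat P \<gamma> K * D\<omega>_tilde P) \<le> 2 * ((1 - \<gamma>) * J_real K)"
proof -
  have "0 \<le> (sigma P)\<^sup>2 * trace R" using trace_R_nonneg by simp
  then have "\<gamma> * trace (P_mat P \<gamma> K * D\<omega>_tilde P) \<le> (1 - \<gamma>) * J_real K"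
    using \<gamma>_less_1 by (simp add: J_real_def distrib_left)
  then have "trace (P_mat P \<gamma> K * D\<omega>_tilde P) \<le> (1 - \<gamma>) * J_real K / \<gamma>"
    using \<gamma>_pos by (simp add: pos_le_divide_eq mult.commute)
  also have "\<dots> \<le> (1 - \<gamma>) * J_real K / (1 / 2)"
    using assms \<gamma>_less_1 by (intro divide_left_mono mult_nonneg_nonneg) auto
  finally show ?thesis by simp
qed

text \<open>
  As long as the gap exceeds \<open>\<epsilon>\<close>, the error term of a step costs at most half of the contraction; once it
  is below \<open>\<epsilon>\<close>, it stays there. Because \<open>\<epsilon>\<close> is at most the optimal cost for \<open>\<gamma>\<close> close to 1, the iterates never cost
  more than twice as much as the first policy, which keeps the trace below \<open>4 f\<close> and so makes \<open>step_const\<close>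
  with the initial cost valid for every step.
\<close>
lemma approximate_policy_iteration:
  assumes \<gamma>: "1 / 2 \<le> \<gamma>"
    and Ko: "global_minimizer P \<gamma> Ko"
    and K0: "policy P (K 0)" "finite_cost (K 0)"
    and f: "f = (1 - \<gamma>) * J_real (K 0)"
    and \<epsilon>: "0 < \<epsilon>" "(1 - \<gamma>) * \<epsilon> \<le> sS * sD / 2"
    and small: "2 * rR * e \<le> 1"
    and e: "e \<le> step_const sD sS rR (spectral_norm A) (spectral_norm B) f * sqrt \<epsilon>
        / (sqrt (spectral_norm (Sigma_mat P \<gamma> Ko)) * J_real Ko)"
    and appr: "\<And>s. s \<in> {1..N} \<Longrightarrow> approximates_Q P \<gamma> e (\<Theta> (s - 1)) (K (s - 1))"
    and K: "\<And>s. s \<in> {1..N} \<Longrightarrow> K s = - (minv (\<Theta>22 (\<Theta> (s - 1))) * \<Theta>21 (\<Theta> (s - 1)))"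
    and y: "y = \<gamma> / (1 - \<gamma>) * sD / spectral_norm (Sigma_mat P \<gamma> Ko)"
    and s: "s \<le> N"
  shows "policy P (K s)" "finite_cost (K s)" "trace (P_mat P \<gamma> (K s) * D\<omega>_tilde P) \<le> 4 * f"
    "J_real (K s) - J_real Ko \<le> max \<epsilon> ((1 - y / 2) ^ s * (J_real (K 0) - J_real Ko))"
    "0 < y" "y \<le> 1"
proof -
  note o = global_minimizerD[OF Ko K0]
  have X: "0 < sS * sD" using sS_pos sD_pos by simp
  obtain w where w: "factors w (D\<omega>_tilde P)" using factors_exist by blast
  have h: "0 < \<gamma> / (1 - \<gamma>)" using \<gamma>_pos \<gamma>_less_1 by simp
  have sh: "\<gamma> / (1 - \<gamma>) * sD \<le> spectral_norm (Sigma_mat P \<gamma> Ko)" by (rule spectral_Sigma(1)[OF o(1,2) w])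
  have hs: "0 < \<gamma> / (1 - \<gamma>) * sD" using h sD_pos by (rule mult_pos_pos)
  then have sp: "0 < spectral_norm (Sigma_mat P \<gamma> Ko)" using sh by linarith
  show y0: "0 < y" unfolding y using hs sp by (rule divide_pos_pos)
  show y1: "y \<le> 1" unfolding y using sh sp by (simp only: pos_divide_le_eq)
  \<comment> \<open>The optimal cost is of order \<open>1 / (1 - \<gamma>)\<close>.\<close>
  have Jo: "\<epsilon> \<le> J_real Ko"
  proof -
    have "0 \<le> (sigma P)\<^sup>2 * trace R" using trace_R_nonneg by simp
    then have "\<gamma> * trace (P_mat P \<gamma> Ko * D\<omega>_tilde P) \<le> (1 - \<gamma>) * J_real Ko"
      using \<gamma>_less_1 by (simp add: J_real_def distrib_left)
    moreover have "1 / 2 * (sS * sD) \<le> \<gamma> * trace (P_mat P \<gamma> Ko * D\<omega>_tilde P)"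
      using \<gamma> X trace_P_mat_lower(1)[OF o(1,2)] by (intro mult_mono) auto
    ultimately have "(1 - \<gamma>) * \<epsilon> \<le> (1 - \<gamma>) * J_real Ko" using \<epsilon>(2) by linarith
    then show ?thesis using \<gamma>_less_1 by simp
  qed
  have J0: "0 < J_real (K 0)" using Jo \<epsilon>(1) o(3) by linarith
  have fpos: "0 < f" unfolding f using J0 \<gamma>_less_1 by simp
  define g0 where "g0 = J_real (K 0) - J_real Ko"
  have g0: "0 \<le> g0" using o(3) by (simp add: g0_def)
  define m where "m = (\<lambda>s. (1 - y / 2) ^ s * g0)"
  have m_le: "m s \<le> g0" for s
    unfolding m_def using y0 y1 g0 by (intro mult_left_le_one_le power_le_one) auto
  have T: "trace (P_mat P \<gamma> L * D\<omega>_tilde P) \<le> 4 * f"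
    if L: "policy P L" "finite_cost L" "J_real L - J_real Ko \<le> max \<epsilon> (m s)" for L s
  proof -
    have "J_real L \<le> 2 * J_real (K 0)" using L(3) m_le[of s] Jo o(3) J0 unfolding g0_def by linarith
    then have "(1 - \<gamma>) * J_real L \<le> (1 - \<gamma>) * (2 * J_real (K 0))" using \<gamma>_less_1 by (intro mult_left_mono) auto
    moreover have "trace (P_mat P \<gamma> L * D\<omega>_tilde P) \<le> 2 * ((1 - \<gamma>) * J_real L)"
      using global_minimizerD(3)[OF Ko L(1,2)] Jo \<epsilon>(1) by (intro trace_P_mat_le_J_real[OF \<gamma>]) linarith
    ultimately show ?thesis unfolding f by (simp add: mult.left_commute)
  qed
  have inv: "policy P (K s) \<and> finite_cost (K s) \<and> J_real (K s) - J_real Ko \<le> max \<epsilon> (m s)" if "s \<le> N" for s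
    using that
  proof (induction s)
    case 0
    show ?case using K0 by (simp add: m_def g0_def)
  next
    case (Suc s)
    then have IH: "policy P (K s)" "finite_cost (K s)" "J_real (K s) - J_real Ko \<le> max \<epsilon> (m s)" by auto
    have sN: "Suc s \<in> {1..N}" using Suc.prems by simp
    note step = approximate_policy_iteration_step[OF \<gamma> IH(1,2) o(1,2) fpos T[OF IH]
        appr[OF sN, simplified] small e \<epsilon>(1) Jo K[OF sN, simplified] y]
    have "J_real (K (Suc s)) - J_real Ko \<le> (1 - y) * max \<epsilon> (m s) + y / 2 * \<epsilon>"
      using step(3) mult_left_mono[OF IH(3), of "1 - y"] y1 by linarith
    also have "\<dots> \<le> max \<epsilon> (m (Suc s))"
    proof (cases "\<epsilon> \<le> m s")
      case True
      have "y / 2 * \<epsilon> \<le> y / 2 * m s" using True y0 by (intro mult_left_mono) auto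
      moreover have "m (Suc s) = (1 - y) * m s + y / 2 * m s" by (simp add: m_def left_diff_distrib)
      ultimately show ?thesis using True by simp
    next
      case False
      have "(1 - y) * \<epsilon> + y / 2 * \<epsilon> = \<epsilon> - y / 2 * \<epsilon>" by (simp add: left_diff_distrib)
      moreover have "0 \<le> y / 2 * \<epsilon>" using y0 \<epsilon>(1) by simp
      ultimately show ?thesis using False by (simp add: max_def)
    qed
    finally show ?case using step(1,2) by blast
  qed
  from inv[OF s] show "policy P (K s)" "finite_cost (K s)" "J_real (K s) - J_real Ko \<le> max \<epsilon> ((1 - y / 2) ^ s * (J_real (K 0) - J_real Ko))"
    by (auto simp: m_def g0_def)
  show "trace (P_mat P \<gamma> (K s) * D\<omega>_tilde P) \<le> 4 * f" using T inv[OF s] by blast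
qed

text \<open>
  The product equals \<open>1 / (\<gamma> (1 - \<gamma>))\<close>: the contraction is faster by about \<open>1 / (1 - \<gamma>)\<close> than the number of
  iterations requires.
\<close>
lemma horizon_factor:
  assumes "0 < spectral_norm X" "y = \<gamma> / (1 - \<gamma>) * sD / spectral_norm X"
  shows "4 \<le> y / 2 * (2 * spectral_norm X / (\<gamma>\<^sup>2 * sD))"
proof -
  have "y / 2 * (2 * spectral_norm X / (\<gamma>\<^sup>2 * sD)) = 1 / (\<gamma> * (1 - \<gamma>))"
    using assms sD_pos \<gamma>_pos by (simp add: power2_eq_square)
  moreover have "4 \<le> 1 / (\<gamma> * (1 - \<gamma>))"
  proof -
    have "0 \<le> (2 * \<gamma> - 1)\<^sup>2" by simp
    then have "4 * (\<gamma> * (1 - \<gamma>)) \<le> 1" by (simp add: power2_eq_square algebra_simps)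
    moreover have "0 < \<gamma> * (1 - \<gamma>)" using \<gamma>_pos \<gamma>_less_1 by simp
    ultimately show ?thesis by (simp only: pos_le_divide_eq)
  qed
  ultimately show ?thesis by simp
qed

end

theorem theorem4p1:
  shows "\<exists>C1 :: real \<Rightarrow> real \<Rightarrow> real \<Rightarrow> real \<Rightarrow> real \<Rightarrow> real \<Rightarrow> real.
    (\<forall>a b c d e f. 0 < C1 a b c d e f) \<and>
    (\<forall>(P :: 'm lqr) (K0 :: real mat) (\<epsilon> :: real).
      lqr_setting P \<and> stable_policy P K0 \<and> 0 < \<epsilon> \<longrightarrow>
      (\<forall>\<^sub>F \<gamma> in at_left (1 :: real).
        \<forall>(Kopt :: real mat) (\<epsilon>0 :: real) (T :: nat) (K :: nat \<Rightarrow> real mat) (\<Theta> :: nat \<Rightarrow> params).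
          global_minimizer P \<gamma> Kopt \<and>
          \<epsilon>0 \<le> min (1 / (2 * spectral_norm (minv (mR P))))
                   (C1 (\<sigma>_min (D\<omega>_tilde P)) (\<sigma>_min (mS P)) (spectral_norm (minv (mR P)))
                       (spectral_norm (mA P)) (spectral_norm (mB P))
                       ((1 - \<gamma>) * real_of_ereal (J P \<gamma> K0))
                    * sqrt \<epsilon>
                    / (sqrt (spectral_norm (Sigma_mat P \<gamma> Kopt)) * real_of_ereal (J P \<gamma> Kopt))) \<and>
          K 0 = K0 \<and>
          (\<forall>s\<in>{1..T}. approximates_Q P \<gamma> \<epsilon>0 (\<Theta> (s - 1)) (K (s - 1)) \<and>
                       K s = - (minv (\<Theta>22 (\<Theta> (s - 1))) * \<Theta>21 (\<Theta> (s - 1)))) \<and>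
          real T \<ge> (2 * spectral_norm (Sigma_mat P \<gamma> Kopt) / (\<gamma>\<^sup>2 * \<sigma>_min (D\<omega>_tilde P)) - 1)
                   * ln (real_of_ereal (J P \<gamma> K0 - J P \<gamma> Kopt) / \<epsilon>)
          \<longrightarrow>
          (\<forall>s\<in>{1..T}. stable_policy P (K s)) \<and>
          (ereal \<epsilon> \<le> J P \<gamma> K0 - J P \<gamma> Kopt \<longrightarrow> (\<forall>s\<in>{1..T}. K s \<in> Dom_sub P \<gamma> Kopt K0 2)) \<and>
          J P \<gamma> (K T) - J P \<gamma> Kopt \<le> ereal \<epsilon>))"
proof (intro exI[of _ step_const] conjI allI impI, goal_cases)
  case (1 sd ss r a b f)
  show ?case by (rule step_const_pos)
next
  case (2 P K0 \<epsilon>)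
  then have P: "lqr_setting P" and K0: "stable_policy P K0" and \<epsilon>: "0 < \<epsilon>" by auto
  have pK0: "policy P K0" and sr: "spectral_radius (map_mat complex_of_real (closed_loop P K0)) < 1"
    using K0 by (auto simp: stable_policy_def)
  \<comment> \<open>The facts used before \<open>\<gamma>\<close> is fixed do not involve it; any admissible discount factor serves.\<close>
  interpret half: discounted_lqr P "1 / 2" by unfold_locales (use P in auto)
  obtain C r where Cr: "0 \<le> C" "0 < r" "r < 1" "\<And>k. (frob_norm (closed_loop P K0 ^\<^sub>m k))\<^sup>2 \<le> C * r ^ k"
    using spectral_radius_less_1_decay[OF half.closed_loop_carrier[OF pK0] half.dims(1) sr] by metis
  define F where "F = frob_norm (half.stage_mat K0) * C * trace (D\<omega>_tilde P) / (1 - r) + (sigma P)\<^sup>2 * trace (mR P)"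
  define X where "X = \<sigma>_min (mS P) * \<sigma>_min (D\<omega>_tilde P)"
  have X: "0 < X" using half.sS_pos half.sD_pos by (simp add: X_def)
  have lim: "((\<lambda>\<gamma>. (1 - \<gamma>) * \<epsilon>) \<longlongrightarrow> (1 - 1) * \<epsilon>) (at_left (1::real))"
    "((\<lambda>\<gamma>. 4 * F * (1 - \<gamma>)) \<longlongrightarrow> 4 * F * (1 - 1)) (at_left (1::real))"
    by (intro tendsto_intros)+
  have "\<forall>\<^sub>F \<gamma> in at_left 1. (1 - \<gamma>) * \<epsilon> < X / 2" "\<forall>\<^sub>F \<gamma> in at_left 1. 4 * F * (1 - \<gamma>) < X"
    using order_tendstoD(2)[OF lim(1), of "X / 2"] order_tendstoD(2)[OF lim(2), of X] X by simp_all
  moreover have "\<forall>\<^sub>F \<gamma> in at_left (1::real). \<gamma> \<in> {1 / 2<..<1}" by (rule eventually_at_left_real) simp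
  ultimately show ?case
  proof eventually_elim
    case (elim \<gamma>)
    interpret discounted_lqr P \<gamma> by unfold_locales (use P elim in auto)
    have finK0: "finite_cost K0" by (rule finite_cost_if_decay(1)[OF pK0 Cr])
    show ?case
    proof (intro allI impI, elim conjE)
      fix Kopt \<epsilon>0 T K \<Theta>
      assume opt: "global_minimizer P \<gamma> Kopt" and K0_eq: "K 0 = K0"
        and \<epsilon>0: "\<epsilon>0 \<le> min (1 / (2 * rR))
                   (step_const sD sS rR (spectral_norm A) (spectral_norm B) ((1 - \<gamma>) * real_of_ereal (J P \<gamma> K0))
                    * sqrt \<epsilon> / (sqrt (spectral_norm (Sigma_mat P \<gamma> Kopt)) * real_of_ereal (J P \<gamma> Kopt)))"
        and it: "\<forall>s\<in>{1..T}. approximates_Q P \<gamma> \<epsilon>0 (\<Theta> (s - 1)) (K (s - 1)) \<and>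
                       K s = - (minv (\<Theta>22 (\<Theta> (s - 1))) * \<Theta>21 (\<Theta> (s - 1)))"
        and T: "real T \<ge> (2 * spectral_norm (Sigma_mat P \<gamma> Kopt) / (\<gamma>\<^sup>2 * sD) - 1)
                   * ln (real_of_ereal (J P \<gamma> K0 - J P \<gamma> Kopt) / \<epsilon>)"
      note o = global_minimizerD[OF opt pK0 finK0]
      have J0: "J P \<gamma> K0 = ereal (J_real K0)" and Jo: "J P \<gamma> Kopt = ereal (J_real Kopt)"
        using J_eq_J_real pK0 finK0 o by auto
      define f where "f = (1 - \<gamma>) * J_real (K 0)"
      define y where "y = \<gamma> / (1 - \<gamma>) * sD / spectral_norm (Sigma_mat P \<gamma> Kopt)"
      define g0 where "g0 = J_real K0 - J_real Kopt"
      have g0: "0 \<le> g0" using o(3) by (simp add: g0_def)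
      have gap: "J P \<gamma> K0 - J P \<gamma> Kopt = ereal g0" by (simp add: J0 Jo g0_def)
      have "\<epsilon>0 \<le> 1 / (2 * rR)" using \<epsilon>0 by simp
      then have small: "2 * rR * \<epsilon>0 \<le> 1" using rR_pos by (simp add: field_simps)
      have e: "\<epsilon>0 \<le> step_const sD sS rR (spectral_norm A) (spectral_norm B) f * sqrt \<epsilon>
          / (sqrt (spectral_norm (Sigma_mat P \<gamma> Kopt)) * J_real Kopt)"
        using \<epsilon>0 by (simp add: J0 Jo f_def K0_eq)
      have \<gamma>h: "1 / 2 \<le> \<gamma>" using elim by simp
      have \<epsilon>X: "(1 - \<gamma>) * \<epsilon> \<le> sS * sD / 2" using elim by (simp add: X_def)
      have ap: "approximates_Q P \<gamma> \<epsilon>0 (\<Theta> (s - 1)) (K (s - 1))"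
        "K s = - (minv (\<Theta>22 (\<Theta> (s - 1))) * \<Theta>21 (\<Theta> (s - 1)))" if "s \<in> {1..T}" for s
        using it that by blast+
      have pf0: "policy P (K 0)" "finite_cost (K 0)" using pK0 finK0 by (simp_all add: K0_eq)
      have api: "policy P (K s)" "finite_cost (K s)" "trace (P_mat P \<gamma> (K s) * D\<omega>_tilde P) \<le> 4 * f"
        "J_real (K s) - J_real Kopt \<le> max \<epsilon> ((1 - y / 2) ^ s * g0)" "0 < y" "y \<le> 1" if s: "s \<le> T" for s
        using approximate_policy_iteration[OF \<gamma>h opt pf0 f_def \<epsilon> \<epsilon>X small e ap y_def s]
        by (simp_all add: g0_def K0_eq)
      have y: "0 < y" "y \<le> 1" using api(5,6)[of 0] by auto
      have JK: "J P \<gamma> (K s) - J P \<gamma> Kopt = ereal (J_real (K s) - J_real Kopt)" if "s \<le> T" for s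
        using api(1,2)[OF that] by (simp add: J_eq_J_real Jo)
      \<comment> \<open>For an unstable iterate the trace would exceed \<open>4 F\<close>, a bound for all iterates.\<close>
      have stable: "stable_policy P (K s)" if "s \<in> {1..T}" for s
      proof (rule ccontr)
        assume ns: "\<not> stable_policy P (K s)"
        have s: "s \<le> T" using that by simp
        have "f \<le> F"
          using finite_cost_if_decay(2)[OF pK0 Cr] by (simp add: J0 f_def K0_eq F_def)
        have "X / (1 - \<gamma>) \<le> 4 * f"
          using trace_P_mat_lower(2)[OF api(1,2)[OF s] ns] api(3)[OF s] by (simp add: X_def)
        then have "X \<le> 4 * f * (1 - \<gamma>)" using \<gamma>_less_1 by (simp only: pos_divide_le_eq)
        also have "\<dots> \<le> 4 * F * (1 - \<gamma>)" using \<open>f \<le> F\<close> \<gamma>_less_1 by (intro mult_right_mono) auto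
        finally show False using elim by simp
      qed
      have dom: "K s \<in> Dom_sub P \<gamma> Kopt K0 2" if "ereal \<epsilon> \<le> J P \<gamma> K0 - J P \<gamma> Kopt" "s \<in> {1..T}" for s
      proof -
        have s: "s \<le> T" using that by simp
        have "(1 - y / 2) ^ s * g0 \<le> g0" using y g0 by (intro mult_left_le_one_le power_le_one) auto
        moreover have "\<epsilon> \<le> g0" using that(1) by (simp add: gap)
        ultimately have "J_real (K s) - J_real Kopt \<le> 2 * g0" using api(4)[OF s] g0 by linarith
        then show ?thesis using api(1)[OF s] by (simp add: Dom_sub_def gap JK[OF s])
      qed
      have sp: "0 < spectral_norm (Sigma_mat P \<gamma> Kopt)"
      proof (rule ccontr)
        assume "\<not> ?thesis"
        then have "y \<le> 0" unfolding y_def using sD_pos \<gamma>_pos \<gamma>_less_1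
          by (intro divide_nonneg_nonpos mult_nonneg_nonneg) auto
        then show False using y by simp
      qed
      have "(1 - y / 2) ^ T * g0 \<le> \<epsilon>"
      proof (rule contraction_horizon[OF g0 \<epsilon>])
        show "4 \<le> y / 2 * (2 * spectral_norm (Sigma_mat P \<gamma> Kopt) / (\<gamma>\<^sup>2 * sD))"
          by (rule horizon_factor[OF sp y_def])
        show "(2 * spectral_norm (Sigma_mat P \<gamma> Kopt) / (\<gamma>\<^sup>2 * sD) - 1) * ln (g0 / \<epsilon>) \<le> real T"
          using T by (simp add: gap)
      qed (use y in auto)
      then have "J P \<gamma> (K T) - J P \<gamma> Kopt \<le> ereal \<epsilon>" using api(4)[of T] by (simp add: JK)
      then show "(\<forall>s\<in>{1..T}. stable_policy P (K s)) \<and>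
          (ereal \<epsilon> \<le> J P \<gamma> K0 - J P \<gamma> Kopt \<longrightarrow> (\<forall>s\<in>{1..T}. K s \<in> Dom_sub P \<gamma> Kopt K0 2)) \<and>
          J P \<gamma> (K T) - J P \<gamma> Kopt \<le> ereal \<epsilon>"
        using stable dom by blast
    qed
  qed
qed

end
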